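(* Let $G\colon\mathcal{P}(X)\to\mathbb{R}\cup\{+\infty\}$ be bounded below and lower semicontinuous with respect to weak convergence. Let $\{\boldsymbol\mu_n\}_{n\in\mathbb{N}}$ be a sequence of i.i.d. random elements of $E_0$ with distribution $P_\mu\in\mathcal{P}(E_0)$ such that $\mathrm{Bar}_G(P_\mu)\ne\emptyset$, and let $\overline{\boldsymbol\mu}_n\in\mathrm{Bar}_G\bigl(\frac1n\sum_{i=1}^n\delta_{\boldsymbol\mu_i}\bigr)$, $n\in\mathbb{N}$, be a measurable choice of empirical Fréchet barycenters. Then, almost surely, the sequence $\{\overline{\boldsymbol\mu}_n\}_{n\in\mathbb{N}}$ is precompact in $\tau_J$ and every partial limit of it (limit of a $\tau_J$-convergent subsequence) belongs to $\mathrm{Bar}_G(P_\mu)$.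
   Context: Setting. $(X,\rho)$ is a Radon space: a separable metric space such that for every Borel probability measure $\mu$ on $X$ and every $\epsilon>0$ there is a compact set $D$ with $\mu(X\setminus D)<\epsilon$. $\mathcal{P}(X)$ is the set of Borel probability measures on $X$. The cost function $c\colon X\times X\to[0,\infty)$ is continuous and consistent: for any $x\in X$ and $\{x_n\}\subset X$, $c(x,x_n)\to0$ iff $c(x_n,x)\to0$ iff $x_n\to x$. Growth assumption: there are constants $A,B\ge0$ such that for all $x,y,z\in X$ the number $c(x,y)$ is at most each of $A+B(c(x,z)+c(y,z))$, $A+B(c(x,z)+c(z,y))$, $A+B(c(z,x)+c(y,z))$, $A+B(c(z,x)+c(z,y))$. Compactness assumption: for some (and therefore any) $x_0\in X$ and all $r\ge 0$ the set $\{y\in X: c(x_0,y)\le r\}$ is compact. Transportation cost: $J(\mu,\nu)=\inf_{\gamma\in\Pi(\mu,\nu)}\int c(x,y)\,d\gamma(x,y)\in[0,\infty]$, where $\Pi(\mu,\nu)$ is the set of Borel probability measures on $X\times X$ with first marginal $\mu$ and second marginal $\nu$. The balls $\{\nu: J(\mu,\nu)<r\}$, $\mu\in\mathcal{P}(X)$, $r>0$, form a basis of a topology $\tau_J$ on $\mathcal{P}(X)$; $\nu_n\to\nu^*$ in $\tau_J$ is equivalent to $J(\nu_n,\nu^* )\to0$ and $J(\nu^*,\nu_n)\to0$. $E_0=\{\nu\in\mathcal{P}(X): J(\delta_{x_0},\nu)<\infty\}$ (independent of $x_0\in X$), endowed with $\tau_J$ and its Borel $\sigma$-algebra (which coincides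 on $E_0$ with that of the weak topology); $\mathcal{P}(E_0)$ is the set of Borel probability measures on $E_0$. For $P\in\mathcal{P}(E_0)$, a $G$-regularized Fréchet barycenter of $P$ is a measure $\nu\in\mathcal{P}(X)$ at which $\nu\mapsto\int J(\mu,\nu)\,dP(\mu)+G(\nu)$ attains its minimum over $\mathcal{P}(X)$, this minimum being finite; $\mathrm{Bar}_G(P)$ is the set of all of them. Precompact means having compact closure. *)

theory Defs
  imports "HOL-Probability.Probability"
begin

abbreviation probs :: "'b measure \<Rightarrow> 'b measure set" where
  "probs N \<equiv> space (prob_algebra N)"

definition borel_of :: "'b topology \<Rightarrow> 'b measure" where
  "borel_of T = sigma (topspace T) {U. openin T U}"

definition precompactin :: "'b topology \<Rightarrow> 'b set \<Rightarrow> bool" where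
  "precompactin T S \<longleftrightarrow> S \<subseteq> topspace T \<and> compactin T (T closure_of S)"

(* Separability of the metric space is expressed by the class second_countable_topology. *)
definition radon_space :: "'a::{metric_space, second_countable_topology} itself \<Rightarrow> bool" where
  "radon_space _ \<longleftrightarrow>
    (\<forall>\<mu>::'a measure. \<mu> \<in> probs borel \<longrightarrow>
      (\<forall>\<epsilon>>0. \<exists>D. compact D \<and> measure \<mu> (UNIV - D) < \<epsilon>))"

definition consistent_cost :: "('a::metric_space \<Rightarrow> 'a \<Rightarrow> real) \<Rightarrow> bool" where
  "consistent_cost c \<longleftrightarrow>
    (\<forall>x xs. ((\<lambda>n. c x (xs n)) \<longlonglongrightarrow> 0 \<longleftrightarrow> (\<lambda>n. c (xs n) x) \<longlonglongrightarrow> 0) \<and>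
            ((\<lambda>n. c (xs n) x) \<longlonglongrightarrow> 0 \<longleftrightarrow> xs \<longlonglongrightarrow> x))"

definition cost_function :: "('a::metric_space \<Rightarrow> 'a \<Rightarrow> real) \<Rightarrow> bool" where
  "cost_function c \<longleftrightarrow>
    (\<forall>x y. 0 \<le> c x y) \<and> continuous_on UNIV (\<lambda>(x, y). c x y) \<and> consistent_cost c"

definition growth_assumption :: "('a \<Rightarrow> 'a \<Rightarrow> real) \<Rightarrow> bool" where
  "growth_assumption c \<longleftrightarrow>
    (\<exists>A B. 0 \<le> A \<and> 0 \<le> B \<and>
      (\<forall>x y z. c x y \<le> A + B * (c x z + c y z) \<and>
               c x y \<le> A + B * (c x z + c z y) \<and>
               c x y \<le> A + B * (c z x + c y z) \<and>
               c x y \<le> A + B * (c z x + c z y)))"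

definition compactness_assumption :: "('a::topological_space \<Rightarrow> 'a \<Rightarrow> real) \<Rightarrow> bool" where
  "compactness_assumption c \<longleftrightarrow> (\<exists>x0. \<forall>r\<ge>0. compact {y. c x0 y \<le> r})"

definition couplings ::
  "'a::topological_space measure \<Rightarrow> 'a measure \<Rightarrow> ('a \<times> 'a) measure set" where
  "couplings \<mu> \<nu> = {\<gamma> \<in> probs borel. distr \<gamma> borel fst = \<mu> \<and> distr \<gamma> borel snd = \<nu>}"

definition transport_cost ::
  "('a::topological_space \<Rightarrow> 'a \<Rightarrow> real) \<Rightarrow> 'a measure \<Rightarrow> 'a measure \<Rightarrow> ennreal" where
  "transport_cost c \<mu> \<nu> = (INF \<gamma>\<in>couplings \<mu> \<nu>. \<integral>\<^sup>+ (x, y). ennreal (c x y) \<partial>\<gamma>)"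

definition tau_J :: "('a::topological_space \<Rightarrow> 'a \<Rightarrow> real) \<Rightarrow> 'a measure topology" where
  "tau_J c = topology_generated_by
    {{\<nu> \<in> probs borel. transport_cost c \<mu> \<nu> < ennreal r} | \<mu> r. \<mu> \<in> probs borel \<and> 0 < r}"

definition E0 :: "('a::topological_space \<Rightarrow> 'a \<Rightarrow> real) \<Rightarrow> 'a \<Rightarrow> 'a measure set" where
  "E0 c x0 = {\<nu> \<in> probs borel. transport_cost c (return borel x0) \<nu> < \<infinity>}"

definition borel_E0 :: "('a::topological_space \<Rightarrow> 'a \<Rightarrow> real) \<Rightarrow> 'a \<Rightarrow> 'a measure measure" where
  "borel_E0 c x0 = borel_of (subtopology (tau_J c) (E0 c x0))"

definition weakly_converges ::
  "(nat \<Rightarrow> 'a::topological_space measure) \<Rightarrow> 'a measure \<Rightarrow> bool" where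
  "weakly_converges \<nu>s \<nu> \<longleftrightarrow>
    (\<forall>f::'a \<Rightarrow> real. continuous_on UNIV f \<and> bounded (range f) \<longrightarrow>
      (\<lambda>n. \<integral>x. f x \<partial>\<nu>s n) \<longlonglongrightarrow> (\<integral>x. f x \<partial>\<nu>))"

(* Sequential lower semicontinuity; the weak topology is metrizable for separable metric X. *)
definition weakly_lsc :: "('a::topological_space measure \<Rightarrow> ereal) \<Rightarrow> bool" where
  "weakly_lsc G \<longleftrightarrow>
    (\<forall>\<nu>s \<nu>. (\<forall>n. \<nu>s n \<in> probs borel) \<and> \<nu> \<in> probs borel \<and> weakly_converges \<nu>s \<nu> \<longrightarrow>
      G \<nu> \<le> liminf (\<lambda>n. G (\<nu>s n)))"

definition frechet_functional ::
  "('a::topological_space \<Rightarrow> 'a \<Rightarrow> real) \<Rightarrow> ('a measure \<Rightarrow> ereal) \<Rightarrow> 'a measure measure \<Rightarrow>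
    'a measure \<Rightarrow> ereal" where
  "frechet_functional c G P \<nu> = enn2ereal (\<integral>\<^sup>+ \<mu>. transport_cost c \<mu> \<nu> \<partial>P) + G \<nu>"

definition Bar ::
  "('a::topological_space \<Rightarrow> 'a \<Rightarrow> real) \<Rightarrow> ('a measure \<Rightarrow> ereal) \<Rightarrow> 'a measure measure \<Rightarrow>
    'a measure set" where
  "Bar c G P = {\<nu> \<in> probs borel.
     (\<forall>\<nu>'\<in>probs borel. frechet_functional c G P \<nu> \<le> frechet_functional c G P \<nu>') \<and>
     \<bar>frechet_functional c G P \<nu>\<bar> \<noteq> \<infinity>}"

definition empirical :: "'b measure \<Rightarrow> nat \<Rightarrow> (nat \<Rightarrow> 'b) \<Rightarrow> 'b measure" where
  "empirical N n x = measure_of (space N) (sets N)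
     (\<lambda>A. ennreal (1 / n) * (\<Sum>i=1..n. emeasure (return N (x i)) A))"

lemma sets_empirical [simp]: "sets (empirical N n x) = sets N"
  by (simp add: empirical_def)

(* The set function in empirical is a measure, so measure_of does not fall back to 0. *)
lemma emeasure_empirical:
  assumes "A \<in> sets N"
  shows "emeasure (empirical N n x) A = ennreal (1 / n) * (\<Sum>i=1..n. emeasure (return N (x i)) A)"
proof (rule emeasure_measure_of[OF empirical_def])
  show "sets N \<subseteq> Pow (space N)" by (rule sets.space_closed)
  show "A \<in> sets (empirical N n x)" using assms by simp
  show "positive (sets (empirical N n x))
      (\<lambda>A. ennreal (1 / n) * (\<Sum>i=1..n. emeasure (return N (x i)) A))"
    by (simp add: positive_def)
  show "countably_additive (sets (empirical N n x))
      (\<lambda>A. ennreal (1 / n) * (\<Sum>i=1..n. emeasure (return N (x i)) A))"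
  proof (rule countably_additiveI)
    fix F :: "nat \<Rightarrow> _"
    assume F: "range F \<subseteq> sets (empirical N n x)" "disjoint_family F"
    have "(\<Sum>k. emeasure (return N (x i)) (F k)) = emeasure (return N (x i)) (\<Union>k. F k)" for i
      using F by (intro suminf_emeasure) auto
    then show "(\<Sum>k. ennreal (1 / n) * (\<Sum>i=1..n. emeasure (return N (x i)) (F k))) =
        ennreal (1 / n) * (\<Sum>i=1..n. emeasure (return N (x i)) (\<Union>k. F k))"
      by (simp add: suminf_sum)
  qed
qed

end

theory Submission
  imports Defs
begin

text \<open>
  On the measures with finite moment \<open>\<integral> c x0 y d\<nu>\<close> the topology \<open>tau_J\<close> is induced by the
  moment together with countably many integrals of bounded continuous functions, that is, it is the
  topology of weak convergence with convergence of moments. The moments of the empirical barycenters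
  are almost surely bounded, since the empirical functional at a fixed barycenter \<open>\<nu>0\<close> of \<open>P\<close>
  converges. Hence subsequences converge weakly to some \<open>\<nu>'\<close>, with moments tending to some
  \<open>m\<close> that is at least the moment of \<open>\<nu>'\<close>. Lower semicontinuity of the cost, sharpened by a
  multiple of the escaping moment, and the law of large numbers for infima of \<open>J\<close> over countably
  many neighbourhoods show that the functional at \<open>\<nu>'\<close> plus a multiple of the escaping moment is at
  most its minimum. So \<open>\<nu>'\<close> is a barycenter, no moment escapes, and the convergence holds in
  \<open>tau_J\<close>.
\<close>

section \<open>The strong law of large numbers\<close>

text \<open>The empirical barycenters are random, so no law of large numbers applies to
  \<open>J \<mu> (\<nu> n)\<close> directly: the exceptional null set would depend on
  \<open>\<nu> n\<close>. Infima over the members of a countable base of the coordinate space cost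
  only countably many null sets. Such an infimum need not be integrable, and is infinite where no
  measure is available, hence the truncation at \<open>Suc j\<close>, after which the law for
  bounded variables suffices. The unbounded law is used for the cost of \<open>\<nu>0\<close> alone,
  and there only from above. A weak limit may lose moment. The coordinates then tend to
  \<open>(coords \<nu>')(0 := m)\<close>, which is not the image of a measure of finite moment if
  \<open>m\<close> exceeds the moment of \<open>\<nu>'\<close>. Shrinking the neighbourhoods to this
  point, and not to \<open>coords \<nu>'\<close>, keeps the lost moment visible. Its factor is
  \<open>1 / B\<close> because the growth bound, solved for the cost, says that moving mass far out
  costs at least \<open>1 / B\<close> times the weight reached, up to terms that depend on the
  starting point.\<close>

lemma (in prob_space) indep_sets_reindex:
  assumes "indep_sets F (f ` I)" "inj_on f I"
  shows "indep_sets (\<lambda>i. F (f i)) I"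
proof (rule indep_setsI)
  show "F (f i) \<subseteq> events" if "i \<in> I" for i
    using assms(1) that by (auto simp: indep_sets_def)
next
  fix A J assume J: "J \<noteq> {}" "J \<subseteq> I" "finite J" and A: "\<forall>j\<in>J. A j \<in> F (f j)"
  define g where "g = the_inv_into J f"
  have inj: "inj_on f J" using assms(2) J inj_on_subset by blast
  have g: "g (f j) = j" if "j \<in> J" for j
    using that inj by (simp add: g_def the_inv_into_f_f)
  have "prob (\<Inter>j\<in>f ` J. A (g j)) = (\<Prod>j\<in>f ` J. prob (A (g j)))"
    using J A g by (intro indep_setsD[OF assms(1)]) auto
  then show "prob (\<Inter>j\<in>J. A j) = (\<Prod>j\<in>J. prob (A j))"
    using g by (simp add: prod.reindex[OF inj] cong: INF_cong prod.cong)
qed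

text \<open>Serves two index shifts: the sample starts at 1 while \<open>iid_sequence\<close> starts
  at 0, and a block of variables is compared with the block that starts at \<open>k\<close>.\<close>

lemma (in prob_space) indep_vars_reindex:
  assumes "indep_vars N X (f ` I)" "inj_on f I"
  shows "indep_vars (\<lambda>i. N (f i)) (\<lambda>i. X (f i)) I"
  using assms indep_sets_reindex[OF _ assms(2), of "\<lambda>i. {X i -` A \<inter> space M |A. A \<in> sets (N i)}"]
  unfolding indep_vars_def2 by auto

text \<open>The value is the maximum of \<open>0\<close> and of the partial sums \<open>f 0 + \<dots> + f j\<close> with \<open>j < n\<close>.\<close>

primrec max_partial_sum :: "nat \<Rightarrow> (nat \<Rightarrow> real) \<Rightarrow> real" where
  "max_partial_sum 0 f = 0"
| "max_partial_sum (Suc n) f = max 0 (f 0 + max_partial_sum n (\<lambda>i. f (Suc i)))"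

lemma max_partial_sum_nonneg: "0 \<le> max_partial_sum n f"
  by (cases n) auto

lemma max_partial_sum_Suc_mono: "max_partial_sum n f \<le> max_partial_sum (Suc n) f"
proof (induction n arbitrary: f)
  case (Suc n)
  then show ?case using Suc[of "\<lambda>i. f (Suc i)"] by (auto simp: max_def)
qed simp

lemma max_partial_sum_mono: "m \<le> n \<Longrightarrow> max_partial_sum m f \<le> max_partial_sum n f"
  using lift_Suc_mono_le[of "\<lambda>n. max_partial_sum n f"] max_partial_sum_Suc_mono by blast

lemma sum_le_max_partial_sum: "j \<le> n \<Longrightarrow> (\<Sum>i<j. f i) \<le> max_partial_sum n f"
proof (induction n arbitrary: j f)
  case (Suc n)
  show ?case
  proof (cases j)
    case 0
    then show ?thesis using max_partial_sum_nonneg[of "Suc n" f] by simp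
  next
    case (Suc j')
    then show ?thesis
      using Suc.IH[of j' "\<lambda>i. f (Suc i)"] Suc.prems
      by (simp add: sum.lessThan_Suc_shift del: sum.lessThan_Suc)
  qed
qed simp

lemma max_partial_sum_le: "max_partial_sum n f \<le> (\<Sum>i<n. \<bar>f i\<bar>)"
proof (induction n arbitrary: f)
  case (Suc n)
  show ?case
    using Suc[of "\<lambda>i. f (Suc i)"]
    unfolding sum.lessThan_Suc_shift max_partial_sum.simps
    by (intro max.boundedI) (auto intro!: add_nonneg_nonneg sum_nonneg add_mono)
qed simp

lemma max_partial_sum_cong:
  "(\<And>i. i < n \<Longrightarrow> f i = g i) \<Longrightarrow> max_partial_sum n f = max_partial_sum n g"
  by (induction n arbitrary: f g) (simp, smt (verit) Suc_less_eq max_partial_sum.simps(2) zero_less_Suc)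

lemma measurable_max_partial_sum[measurable]:
  assumes "\<And>i. i < n \<Longrightarrow> (\<lambda>x. f x i) \<in> borel_measurable M"
  shows "(\<lambda>x. max_partial_sum n (f x)) \<in> borel_measurable M"
  using assms
proof (induction n arbitrary: f)
  case (Suc n)
  note [measurable] = Suc.IH[of "\<lambda>x i. f x (Suc i)"] Suc.prems[of 0]
  show ?case using Suc.prems by simp measurable
qed simp

section \<open>Maximal inequality and laws of large numbers for i.i.d. real variables\<close>

locale iid_sequence = prob_space M for M :: "'w measure" +
  fixes X :: "nat \<Rightarrow> 'w \<Rightarrow> real"
  assumes indep: "indep_vars (\<lambda>_. borel) X UNIV"
    and ident: "\<And>i. distr M borel (X i) = distr M borel (X 0)"
begin

lemma measurable_X[measurable]: "X i \<in> borel_measurable M"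
  using indep by (auto simp: indep_vars_def2)

lemma expectation_X: "expectation (X i) = expectation (X 0)"
proof -
  have "expectation (X i) = integral\<^sup>L (distr M borel (X i)) (\<lambda>x. x)" for i
    by (subst integral_distr) auto
  then show ?thesis by (metis ident)
qed

lemma integrable_X: "integrable M (X 0) \<Longrightarrow> integrable M (X i)"
proof -
  have "integrable M (X i) \<longleftrightarrow> integrable (distr M borel (X i)) (\<lambda>x. x)" for i
    by (subst integrable_distr_eq) auto
  then show "integrable M (X 0) \<Longrightarrow> integrable M (X i)" by (metis ident)
qed

lemma iid_compose:
  assumes [measurable]: "g \<in> borel_measurable borel"
  shows "iid_sequence M (\<lambda>i x. g (X i x))"
proof
  show "indep_vars (\<lambda>_. borel) (\<lambda>i x. g (X i x)) UNIV"
    by (rule indep_vars_compose2[OF indep]) simp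
  have "distr M borel (\<lambda>x. g (X i x)) = distr (distr M borel (X i)) borel g" for i
    by (subst distr_distr) (auto simp: comp_def)
  then show "distr M borel (\<lambda>x. g (X i x)) = distr M borel (\<lambda>x. g (X 0 x))" for i
    using ident[of i] by metis
qed

text \<open>Stationarity: the right-hand side does not involve \<open>k\<close>. The length is
  \<open>Suc n\<close> because the characterisation of independence by product measures asks for a
  nonempty index set.\<close>

lemma distr_vector:
  "distr M (\<Pi>\<^sub>M i\<in>{..<Suc n}. borel) (\<lambda>x. \<lambda>i\<in>{..<Suc n}. X (k + i) x) =
    (\<Pi>\<^sub>M i\<in>{..<Suc n}. distr M borel (X 0))"
proof -
  have "indep_vars (\<lambda>_. borel) (\<lambda>i. X (k + i)) {..<Suc n}"
    by (rule indep_vars_reindex[OF indep_vars_subset[OF indep]]) auto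
  moreover have "(\<lambda>i. distr M borel (X (k + i))) = (\<lambda>_. distr M borel (X 0))"
    using ident by blast
  ultimately show ?thesis
    using indep_vars_iff_distr_eq_PiM'[of "{..<Suc n}" "\<lambda>i. X (k + i)" "\<lambda>_. borel"]
    by (simp add: lessThan_empty_iff)
qed

lemma expectation_max_partial_sum_shift:
  "expectation (\<lambda>x. max_partial_sum n (\<lambda>i. X (Suc i) x)) =
    expectation (\<lambda>x. max_partial_sum n (\<lambda>i. X i x))"
proof (cases n)
  case (Suc m)
  have *: "expectation (\<lambda>x. max_partial_sum n (\<lambda>i. X (k + i) x)) =
      integral\<^sup>L (\<Pi>\<^sub>M i\<in>{..<n}. distr M borel (X 0)) (max_partial_sum n)" for k
  proof -
    have "integral\<^sup>L (\<Pi>\<^sub>M i\<in>{..<n}. distr M borel (X 0)) (max_partial_sum n) =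
       integral\<^sup>L (distr M (\<Pi>\<^sub>M i\<in>{..<n}. borel) (\<lambda>x. \<lambda>i\<in>{..<n}. X (k + i) x)) (max_partial_sum n)"
      unfolding Suc distr_vector ..
    also have "\<dots> = expectation (\<lambda>x. max_partial_sum n (\<lambda>i\<in>{..<n}. X (k + i) x))"
      by (rule integral_distr) measurable
    also have "\<dots> = expectation (\<lambda>x. max_partial_sum n (\<lambda>i. X (k + i) x))"
      by (intro Bochner_Integration.integral_cong refl max_partial_sum_cong) auto
    finally show ?thesis by simp
  qed
  from *[of 1] *[of 0] show ?thesis by simp
qed simp

text \<open>Garsia's argument: where the maximum \<open>S (Suc n)\<close> is positive it equals \<open>X 0\<close> plus the
  maximum \<open>T\<close> of the shifted sequence, and \<open>T\<close> has the same expectation as \<open>S n\<close>.\<close>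

lemma maximal_inequality_aux:
  assumes int: "integrable M (X 0)"
  shows "0 \<le> (\<integral>x\<in>{x\<in>space M. 0 < max_partial_sum (Suc n) (\<lambda>i. X i x)}. X 0 x \<partial>M)"
proof -
  have [simp]: "integrable M (X i)" for i using int by (rule integrable_X)
  define S where "S n x = max_partial_sum n (\<lambda>i. X i x)" for n x
  define T where "T x = max_partial_sum n (\<lambda>i. X (Suc i) x)" for x
  have [measurable]: "S n \<in> borel_measurable M" "T \<in> borel_measurable M" for n
    unfolding S_def[abs_def] T_def[abs_def] by measurable
  have iS: "integrable M (S n)" for n
    by (rule Bochner_Integration.integrable_bound[of M "\<lambda>x. \<Sum>i<n. \<bar>X i x\<bar>"])
      (auto simp: S_def max_partial_sum_nonneg intro!: order.trans[OF max_partial_sum_le])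
  have iT: "integrable M T"
    by (rule Bochner_Integration.integrable_bound[of M "\<lambda>x. \<Sum>i<n. \<bar>X (Suc i) x\<bar>"])
      (auto simp: T_def max_partial_sum_nonneg intro!: order.trans[OF max_partial_sum_le])
  have "0 \<le> expectation (S (Suc n)) - expectation (S n)"
    using iS[of n] iS[of "Suc n"] max_partial_sum_Suc_mono[of n]
    by (auto simp: S_def simp del: max_partial_sum.simps intro!: integral_mono)
  also have "\<dots> = expectation (\<lambda>x. S (Suc n) x - T x)"
    using iS[of n] iS[of "Suc n"] iT expectation_max_partial_sum_shift[of n]
    by (simp add: S_def[abs_def] T_def[abs_def] del: max_partial_sum.simps)
  also have "\<dots> \<le> (\<integral>x\<in>{x\<in>space M. 0 < S (Suc n) x}. X 0 x \<partial>M)"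
    unfolding set_lebesgue_integral_def
  proof (rule integral_mono)
    show "integrable M (\<lambda>x. indicator {x\<in>space M. 0 < S (Suc n) x} x *\<^sub>R X 0 x)"
      using int by (intro integrable_mult_indicator) auto
    \<comment> \<open>Off the event \<open>S (Suc n) x\<close> is 0, so the left side is
      \<open>- T x\<close>, which is at most 0.\<close>
    show "S (Suc n) x - T x \<le> indicator {x\<in>space M. 0 < S (Suc n) x} x *\<^sub>R X 0 x" if "x \<in> space M" for x
      using that max_partial_sum_nonneg[of n "\<lambda>i. X (Suc i) x"]
      by (auto simp: indicator_def S_def T_def max_def)
  qed (use iS iT in auto)
  finally show ?thesis by (simp add: S_def)
qed

text \<open>Garsia's bound for the variables \<open>X i - l\<close> gives
  \<open>l * prob (A n) \<le> expectation (X 0)\<close> for every \<open>n\<close>. The events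
  \<open>A n\<close> increase, so the bound survives in their union, which contains the event in
  question. All running averages are controlled at once.\<close>

lemma maximal_inequality:
  assumes int: "integrable M (X 0)" and nonneg: "\<And>x. x \<in> space M \<Longrightarrow> 0 \<le> X 0 x" and l: "0 < l"
  shows "prob {x\<in>space M. \<exists>n\<ge>1. l * n < (\<Sum>i<n. X i x)} \<le> expectation (X 0) / l"
proof -
  interpret Y: iid_sequence M "\<lambda>i x. X i x - l"
    by (rule iid_compose[of "\<lambda>y. y - l"]) simp
  define A where "A n = {x\<in>space M. 0 < max_partial_sum (Suc n) (\<lambda>i. X i x - l)}" for n
  have [measurable]: "A n \<in> sets M" for n unfolding A_def by measurable
  have bound: "prob (A n) \<le> expectation (X 0) / l" for n
  proof -
    have "0 \<le> (\<integral>x\<in>A n. X 0 x - l \<partial>M)"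
      unfolding A_def by (rule Y.maximal_inequality_aux) (use int in simp)
    also have "\<dots> = (\<integral>x\<in>A n. X 0 x \<partial>M) - l * prob (A n)"
    proof -
      have "set_integrable M (A n) (X 0)" "set_integrable M (A n) (\<lambda>_. l)"
        unfolding set_integrable_def using int by (rule_tac [!] integrable_mult_indicator) simp_all
      then have "(\<integral>x\<in>A n. X 0 x - l \<partial>M) = (\<integral>x\<in>A n. X 0 x \<partial>M) - (\<integral>x\<in>A n. l \<partial>M)"
        by (rule set_integral_diff)
      then show ?thesis by (simp add: set_lebesgue_integral_def)
    qed
    also have "(\<integral>x\<in>A n. X 0 x \<partial>M) \<le> expectation (X 0)"
      unfolding set_lebesgue_integral_def
      using int nonneg by (intro integral_mono integrable_mult_indicator) (auto simp: indicator_def)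
    finally show ?thesis using l by (simp add: field_simps)
  qed
  have inc: "incseq A"
    using max_partial_sum_mono[of "Suc _" "Suc _"] unfolding A_def incseq_def
    by (auto intro: less_le_trans simp del: max_partial_sum.simps)
  have "(\<lambda>n. prob (A n)) \<longlonglongrightarrow> prob (\<Union>n. A n)"
    by (rule finite_Lim_measure_incseq) (use inc in auto)
  then have "prob (\<Union>n. A n) \<le> expectation (X 0) / l"
    by (rule LIMSEQ_le_const2) (use bound in auto)
  moreover have "prob {x\<in>space M. \<exists>n\<ge>1. l * n < (\<Sum>i<n. X i x)} \<le> prob (\<Union>n. A n)"
  proof (rule finite_measure_mono)
    show "{x\<in>space M. \<exists>n\<ge>1. l * n < (\<Sum>i<n. X i x)} \<subseteq> (\<Union>n. A n)"
    proof
      fix x assume "x \<in> {x\<in>space M. \<exists>n\<ge>1. l * n < (\<Sum>i<n. X i x)}"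
      then obtain n where n: "x \<in> space M" "n \<ge> 1" "l * n < (\<Sum>i<n. X i x)" by blast
      have "0 < (\<Sum>i<n. X i x - l)" using n by (simp add: sum_subtractf mult.commute)
      also have "\<dots> \<le> max_partial_sum (Suc n) (\<lambda>i. X i x - l)" by (rule sum_le_max_partial_sum) simp
      finally show "x \<in> (\<Union>n. A n)" using n by (auto simp: A_def)
    qed
  qed simp
  ultimately show ?thesis by linarith
qed

text \<open>Hoeffding's inequality makes the deviation probabilities geometrically small in
  \<open>n\<close>, so Borel-Cantelli applies for each tolerance, and countably many tolerances
  suffice.\<close>

lemma slln_bounded:
  assumes X: "\<And>i x. x \<in> space M \<Longrightarrow> 0 \<le> X i x \<and> X i x \<le> K" and "0 < K"
  shows "AE x in M. (\<lambda>n. (\<Sum>i<n. X i x) / n) \<longlonglongrightarrow> expectation (X 0)"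
proof -
  define \<mu> where "\<mu> = expectation (X 0)"
  have *: "AE x in M. \<forall>\<^sub>F n in sequentially. \<bar>(\<Sum>i<n. X i x) / n - \<mu>\<bar> < e" if e: "e > 0" for e
  proof -
    \<comment> \<open>The clause \<open>n \<ge> 1\<close> makes \<open>A 0\<close> empty; for an
      empty sum the exponent in Hoeffding's inequality would have denominator 0.\<close>
    define A where "A n = {x\<in>space M. n \<ge> 1 \<and> \<bar>(\<Sum>i<n. X i x) - n * \<mu>\<bar> \<ge> n * e}" for n :: nat
    define q where "q = exp (- 2 * e\<^sup>2 / K\<^sup>2)"
    have q: "0 < q" "q < 1" using e \<open>0 < K\<close> by (auto simp: q_def)
    have [measurable]: "A n \<in> sets M" for n unfolding A_def by measurable
    have bound: "prob (A n) \<le> 2 * q ^ n" for n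
    proof (cases "n \<ge> 1")
      case True
      interpret H: Hoeffding_ineq M "{..<n}" X "\<lambda>_. 0" "\<lambda>_. K" "n * \<mu>"
      proof unfold_locales
        show "indep_vars (\<lambda>_. borel) X {..<n}" by (rule indep_vars_subset[OF indep]) simp
        show "AE x in M. X i x \<in> {0..K}" for i using X by auto
        have "(\<Sum>i<n. expectation (X i)) = n * \<mu>"
          unfolding \<mu>_def by (subst expectation_X) simp
        then show "n * \<mu> \<equiv> \<Sum>i<n. expectation (X i)" by simp
      qed simp
      have "prob (A n) \<le> 2 * exp (- 2 * (n * e)\<^sup>2 / (\<Sum>i<n. (K - 0)\<^sup>2))"
        using H.Hoeffding_ineq_abs_ge[of "n * e"] True e \<open>0 < K\<close> by (simp add: A_def)
      also have "- 2 * (n * e)\<^sup>2 / (\<Sum>i<n. (K - 0)\<^sup>2) = n * (- 2 * e\<^sup>2 / K\<^sup>2)"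
        using True by (simp add: power2_eq_square)
      also have "exp (n * (- 2 * e\<^sup>2 / K\<^sup>2)) = q ^ n"
        unfolding q_def by (rule exp_of_nat_mult)
      finally show ?thesis .
    next
      case False
      then have "A n = {}" by (auto simp: A_def)
      then show ?thesis using q by simp
    qed
    have "summable (\<lambda>n. prob (A n))"
      by (rule summable_comparison_test'[of "\<lambda>n. 2 * q ^ n" 0])
        (use q bound in \<open>auto intro!: summable_mult summable_geometric\<close>)
    then have "AE x in M. \<forall>\<^sub>F n in sequentially. x \<in> space M - A n"
      by (intro borel_cantelli_AE1) (auto simp: emeasure_eq_measure)
    then show ?thesis
    proof eventually_elim
      case (elim x)
      then show ?case using eventually_ge_at_top[of 1]
      proof eventually_elim
        case (elim n)
        then have "\<bar>(\<Sum>i<n. X i x) - n * \<mu>\<bar> < n * e" by (auto simp: A_def)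
        moreover have "(\<Sum>i<n. X i x) / n - \<mu> = ((\<Sum>i<n. X i x) - n * \<mu>) / n"
          using elim by (simp add: field_simps)
        ultimately show ?case using elim by (simp add: abs_div field_simps)
      qed
    qed
  qed
  then have "AE x in M. \<forall>k. \<forall>\<^sub>F n in sequentially. \<bar>(\<Sum>i<n. X i x) / n - \<mu>\<bar> < 1 / Suc k"
    unfolding AE_all_countable by auto
  then show ?thesis
  proof eventually_elim
    case (elim x)
    show ?case unfolding \<mu>_def[symmetric]
    proof (rule tendstoI)
      fix e :: real assume "0 < e"
      then obtain k where "1 / real (Suc k) < e" using nat_approx_posE by blast
      then show "\<forall>\<^sub>F n in sequentially. dist ((\<Sum>i<n. X i x) / n) \<mu> < e"
        using elim[rule_format, of k] by (auto simp: dist_real_def elim: eventually_mono)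
    qed
  qed
qed

text \<open>Each variable is split into its truncation at \<open>K j\<close>, covered by the bounded
  case, and the excess \<open>Y (K j)\<close>. The maximal inequality bounds all running averages of
  the excess simultaneously, so Borel-Cantelli is applied along the levels \<open>j\<close> and not
  along \<open>n\<close>.\<close>

lemma slln_upper:
  assumes int: "integrable M (X 0)" and nonneg: "\<And>i x. x \<in> space M \<Longrightarrow> 0 \<le> X i x"
  shows "AE x in M. \<forall>e>0. \<forall>\<^sub>F n in sequentially. (\<Sum>i<n. X i x) / n \<le> expectation (X 0) + e"
proof -
  define Y where "Y K i x = max 0 (X i x - K)" for K :: nat and i x
  have iid_min: "iid_sequence M (\<lambda>i x. min (X i x) K)" for K
    by (rule iid_compose[of "\<lambda>y. min y K"]) simp
  have iid_Y: "iid_sequence M (Y K)" for K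
    unfolding Y_def by (rule iid_compose[of "\<lambda>y. max 0 (y - K)"]) simp
  have [measurable]: "Y k i \<in> borel_measurable M" for k i unfolding Y_def by measurable
  have iY: "integrable M (Y K 0)" for K
    by (rule Bochner_Integration.integrable_bound[OF int]) (use nonneg in \<open>auto simp: Y_def\<close>)
  have "(\<lambda>K. expectation (Y K 0)) \<longlonglongrightarrow> expectation (\<lambda>_. 0)"
  proof (rule integral_dominated_convergence[where w = "X 0"])
    show "AE x in M. (\<lambda>K. Y K 0 x) \<longlonglongrightarrow> 0"
    proof (rule AE_I2, rule tendsto_eventually)
      fix x
      show "\<forall>\<^sub>F K in sequentially. Y K 0 x = 0"
        using eventually_ge_at_top[of "nat \<lceil>X 0 x\<rceil>"]
        by eventually_elim (simp add: Y_def max_def nat_le_iff ceiling_le_iff)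
    qed
    show "AE x in M. norm (Y K 0 x) \<le> X 0 x" for K
      using nonneg by (auto simp: Y_def)
  qed (use int in \<open>auto simp: Y_def\<close>)
  then have EY: "(\<lambda>K. expectation (Y K 0)) \<longlonglongrightarrow> 0" by simp
  \<comment> \<open>An expectation below \<open>(1/4) ^ j\<close>, divided by the threshold
    \<open>(1/2) ^ j\<close> of the maximal inequality, leaves the summable bound
    \<open>(1/2) ^ j\<close>.\<close>
  have "\<exists>K>0. expectation (Y K 0) < (1/4) ^ j" for j :: nat
  proof -
    have "\<forall>\<^sub>F K in sequentially. expectation (Y K 0) < (1/4) ^ j"
      by (rule order_tendstoD(2)[OF EY]) simp
    from eventually_conj[OF this eventually_gt_at_top[of 0]] show ?thesis
      by (auto dest!: eventually_happens)
  qed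
  then obtain K where K: "\<And>j. K j > 0" "\<And>j. expectation (Y (K j) 0) < (1/4) ^ j" by metis
  have mxY: "prob {x\<in>space M. \<exists>n\<ge>1. (1/2)^j * n < (\<Sum>i<n. Y (K j) i x)} \<le> (1/2)^j" for j :: nat
  proof -
    interpret Y: iid_sequence M "Y (K j)" by (rule iid_Y)
    have "prob {x\<in>space M. \<exists>n\<ge>1. (1/2)^j * n < (\<Sum>i<n. Y (K j) i x)} \<le> expectation (Y (K j) 0) / (1/2)^j"
      by (rule Y.maximal_inequality) (use iY in \<open>auto simp: Y_def\<close>)
    also have "\<dots> \<le> (1/4)^j / (1/2)^j" using K(2)[of j] by (intro divide_right_mono) auto
    also have "\<dots> = (1/2)^j" by (simp add: power_divide[symmetric])
    finally show ?thesis .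
  qed
  have "AE x in M. \<forall>\<^sub>F j in sequentially. x \<in> space M - {x\<in>space M. \<exists>n\<ge>1. (1/2)^j * n < (\<Sum>i<n. Y (K j) i x)}"
  proof (rule borel_cantelli_AE1)
    show "summable (\<lambda>j. prob {x\<in>space M. \<exists>n\<ge>1. (1/2)^j * real n < (\<Sum>i<n. Y (K j) i x)})"
      by (rule summable_comparison_test'[of "\<lambda>n. (1/2) ^ n" 0]) (use mxY in auto)
  qed (auto simp: emeasure_eq_measure)
  moreover have "AE x in M. \<forall>j. (\<lambda>n. (\<Sum>i<n. min (X i x) (K j)) / n) \<longlonglongrightarrow> expectation (\<lambda>x. min (X 0 x) (K j))"
    unfolding AE_all_countable
  proof
    fix j
    interpret Z: iid_sequence M "\<lambda>i x. min (X i x) (K j)" by (rule iid_min)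
    show "AE x in M. (\<lambda>n. (\<Sum>i<n. min (X i x) (K j)) / n) \<longlonglongrightarrow> expectation (\<lambda>x. min (X 0 x) (K j))"
      by (rule Z.slln_bounded[of "K j"]) (use nonneg K(1) in auto)
  qed
  ultimately show ?thesis
  proof (eventually_elim, intro allI impI)
    case (elim x)
    fix e :: real assume e: "e > 0"
    have "\<forall>\<^sub>F j in sequentially. (1/2::real) ^ j < e / 2"
      by (rule order_tendstoD(2)[OF LIMSEQ_power_zero]) (use e in auto)
    from eventually_conj[OF this elim(1)] obtain j where j: "(1/2::real) ^ j < e / 2" "x \<in> space M"
      "x \<notin> {x\<in>space M. \<exists>n\<ge>1. (1/2)^j * n < (\<Sum>i<n. Y (K j) i x)}"
      by (auto dest!: eventually_happens)
    have "expectation (\<lambda>x. min (X 0 x) (K j)) \<le> expectation (X 0)"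
      using nonneg int
      by (intro integral_mono Bochner_Integration.integrable_bound[OF int, of "\<lambda>x. min (X 0 x) (K j)"]) auto
    then have "\<forall>\<^sub>F n in sequentially. (\<Sum>i<n. min (X i x) (K j)) / n < expectation (X 0) + e / 2"
      using elim(2) e by (intro order_tendstoD(2)[OF elim(2)[rule_format]]) auto
    then show "\<forall>\<^sub>F n in sequentially. (\<Sum>i<n. X i x) / n \<le> expectation (X 0) + e"
      using eventually_ge_at_top[of 1]
    proof eventually_elim
      case (elim n)
      have "(\<Sum>i<n. Y (K j) i x) \<le> (1/2)^j * n" using j elim by auto
      then have "(\<Sum>i<n. Y (K j) i x) / n \<le> (1/2)^j" using elim by (simp add: field_simps)
      moreover have "(\<Sum>i<n. X i x) = (\<Sum>i<n. min (X i x) (K j)) + (\<Sum>i<n. Y (K j) i x)"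
        unfolding sum.distrib[symmetric] by (intro sum.cong) (auto simp: Y_def)
      ultimately show ?case using elim j by (simp add: add_divide_distrib)
    qed
  qed
qed

end

section \<open>Tight sequences of measures and almost surely convergent representations\<close>

text \<open>A code by points of a Cantor set: with base 3 and digits 0 and 1 the places after a
  given one sum to at most half its weight, so close codes have equal leading digits. Binary
  expansions lack this, since distinct digit sequences may have the same value.\<close>

definition ternary :: "(nat \<Rightarrow> bool) \<Rightarrow> real" where
  "ternary f = (\<Sum>k. of_bool (f k) * (1/3) ^ Suc k)"

lemma summable_ternary: "summable (\<lambda>k. of_bool (f k) * (1/3::real) ^ Suc k)"
  by (rule summable_comparison_test'[of "\<lambda>k. (1/3) ^ Suc k" 0])
    (auto intro!: summable_mult summable_geometric)

lemma ternary_bounds: "0 \<le> ternary f" "ternary f \<le> 1/2"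
proof -
  show "0 \<le> ternary f"
    unfolding ternary_def by (rule suminf_nonneg[OF summable_ternary]) auto
  have "ternary f \<le> (\<Sum>k. (1/3) ^ Suc k)"
    unfolding ternary_def
    by (rule suminf_le[OF _ summable_ternary]) (auto intro!: summable_mult summable_geometric)
  also have "\<dots> = (1/3) * (\<Sum>k. (1/3::real) ^ k)"
    unfolding power_Suc by (rule suminf_mult) (auto intro!: summable_geometric)
  also have "\<dots> = 1/2" by (subst suminf_geometric) auto
  finally show "ternary f \<le> 1/2" .
qed

lemma ternary_split:
  "ternary f = (\<Sum>i<k. of_bool (f i) * (1/3) ^ Suc i) + of_bool (f k) * (1/3) ^ Suc k
    + (1/3) ^ Suc k * ternary (\<lambda>i. f (i + Suc k))"
proof -
  have "ternary f = (\<Sum>i. of_bool (f (i + Suc k)) * (1/3) ^ Suc (i + Suc k))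
      + (\<Sum>i<Suc k. of_bool (f i) * (1/3) ^ Suc i)"
    unfolding ternary_def by (rule suminf_split_initial_segment[OF summable_ternary])
  also have "(\<Sum>i. of_bool (f (i + Suc k)) * (1/3) ^ Suc (i + Suc k))
      = (\<Sum>i. (1/3::real) ^ Suc k * (of_bool (f (i + Suc k)) * (1/3) ^ Suc i))"
    by (intro suminf_cong) (simp add: power_add mult_ac)
  also have "\<dots> = (1/3) ^ Suc k * ternary (\<lambda>i. f (i + Suc k))"
    unfolding ternary_def by (rule suminf_mult[OF summable_ternary])
  finally show ?thesis by simp
qed

text \<open>At the first place \<open>j\<close> where the digits differ they contribute a difference
  \<open>t = (1/3) ^ Suc j\<close>, of which the tails can cancel at most half.\<close>

lemma ternary_digit_eq:
  assumes "\<bar>ternary f - ternary g\<bar> < (1/3) ^ Suc k / 2"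
  shows "f k = g k"
proof -
  have "\<forall>j\<le>k. f j = g j"
  proof (rule ccontr)
    assume "\<not> (\<forall>j\<le>k. f j = g j)"
    then have "\<exists>j. j \<le> k \<and> f j \<noteq> g j" by blast
    define j where "j = (LEAST j. j \<le> k \<and> f j \<noteq> g j)"
    have j: "j \<le> k" "f j \<noteq> g j"
      using LeastI_ex[OF \<open>\<exists>j. j \<le> k \<and> f j \<noteq> g j\<close>] by (auto simp: j_def)
    have eq: "f i = g i" if "i < j" for i
      using not_less_Least[of i "\<lambda>j. j \<le> k \<and> f j \<noteq> g j"] that j by (auto simp: j_def)
    define t where "t = (1/3::real) ^ Suc j"
    define a b where "a = ternary (\<lambda>i. f (i + Suc j))" and "b = ternary (\<lambda>i. g (i + Suc j))"
    have "(\<Sum>i<j. of_bool (f i) * (1/3) ^ Suc i) = (\<Sum>i<j. of_bool (g i) * (1/3::real) ^ Suc i)"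
      by (intro sum.cong) (auto simp: eq)
    then have d: "ternary f - ternary g = t * (of_bool (f j) - of_bool (g j) + (a - b))"
      unfolding ternary_split[of f j] ternary_split[of g j]
      by (simp add: t_def a_def b_def algebra_simps)
    have "1/2 \<le> \<bar>of_bool (f j) - of_bool (g j) + (a - b)\<bar>"
      using j(2) ternary_bounds[of "\<lambda>i. f (i + Suc j)"] ternary_bounds[of "\<lambda>i. g (i + Suc j)"]
      by (auto simp: a_def b_def)
    moreover have "0 < t" by (simp add: t_def)
    ultimately have "t / 2 \<le> \<bar>ternary f - ternary g\<bar>"
      unfolding d abs_mult by simp
    moreover have "(1/3::real) ^ Suc k \<le> t"
      unfolding t_def using j(1) by (intro power_decreasing) auto
    ultimately show False using assms by linarith
  qed
  then show ?thesis by simp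
qed

text \<open>The code is the integer part of \<open>w\<close> plus the ternary code of the membership
  in a countable base. Convergence of codes bounds \<open>w\<close>, so a subsequence converges by
  compactness; it also makes each membership eventually constant, so that the whole sequence follows
  the subsequence.\<close>

lemma proper_real_encoding:
  fixes w :: "'b::{metric_space, second_countable_topology} \<Rightarrow> real"
  assumes w[measurable]: "w \<in> borel_measurable borel" and compact: "\<And>r. compact {x. w x \<le> r}"
  obtains s :: "'b \<Rightarrow> real" where "s \<in> borel_measurable borel" "\<And>x. \<bar>s x - w x\<bar> \<le> 1"
    "\<And>xs L. (\<lambda>n. s (xs n)) \<longlonglongrightarrow> L \<Longrightarrow> convergent xs"
proof -
  obtain \<U> :: "'b set set" where \<U>: "countable \<U>" "topological_basis \<U>"
    using ex_countable_basis by blast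
  have ne: "\<U> \<noteq> {}"
    using \<U>(2) open_UNIV UNIV_not_empty unfolding topological_basis_def
    by (metis Union_empty ex_in_conv subset_empty)
  define U where "U = from_nat_into \<U>"
  have range_U: "range U = \<U>"
    using \<U> ne by (simp add: U_def range_from_nat_into)
  then have U_open: "open (U k)" for k
    using \<U>(2) topological_basis_open by blast
  define s where "s x = of_int \<lfloor>w x\<rfloor> + ternary (\<lambda>k. x \<in> U k)" for x
  show ?thesis
  proof
    have [measurable]: "U k \<in> sets borel" for k using U_open by auto
    have "(\<lambda>x. ternary (\<lambda>k. x \<in> U k)) \<in> borel_measurable borel"
      unfolding ternary_def of_bool_def by measurable
    then show "s \<in> borel_measurable borel"
      unfolding s_def[abs_def] by measurable
    show "\<bar>s x - w x\<bar> \<le> 1" for x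
      using ternary_bounds[of "\<lambda>k. x \<in> U k"] floor_correct[of "w x"] unfolding s_def by linarith
  next
    fix xs L assume lim: "(\<lambda>n. s (xs n)) \<longlonglongrightarrow> L"
    have digit: "\<exists>b. \<forall>\<^sub>F n in sequentially. (xs n \<in> U k) = b" for k
    proof -
      have "Cauchy (\<lambda>n. s (xs n))" using lim LIMSEQ_imp_Cauchy by blast
      moreover have "0 < (1/3::real) ^ Suc k / 2" by simp
      ultimately obtain n0 where n0: "\<And>m n. m \<ge> n0 \<Longrightarrow> n \<ge> n0 \<Longrightarrow>
          \<bar>s (xs m) - s (xs n)\<bar> < (1/3) ^ Suc k / 2"
        unfolding Cauchy_def dist_real_def by meson
      have "(xs n \<in> U k) = (xs n0 \<in> U k)" if n: "n \<ge> n0" for n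
      proof -
        let ?t = "\<lambda>n. ternary (\<lambda>k. xs n \<in> U k)"
        have d: "\<bar>s (xs n) - s (xs n0)\<bar> < (1/3) ^ Suc k / 2" using n0 n by blast
        moreover have "(1/3::real) ^ Suc k \<le> 1/3"
          using power_decreasing[of 1 "Suc k" "1/3::real"] by simp
        \<comment> \<open>The codes differ by less than \<open>1/6\<close> and the ternary parts by
          at most \<open>1/2\<close>; together this is less than 1, so the integer parts
          agree.\<close>
        ultimately have "\<bar>real_of_int (\<lfloor>w (xs n)\<rfloor> - \<lfloor>w (xs n0)\<rfloor>)\<bar> < 1"
          using ternary_bounds[of "\<lambda>k. xs n \<in> U k"] ternary_bounds[of "\<lambda>k. xs n0 \<in> U k"]
          unfolding s_def of_int_diff by linarith
        then have "\<lfloor>w (xs n)\<rfloor> = \<lfloor>w (xs n0)\<rfloor>" by linarith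
        then have "\<bar>?t n - ?t n0\<bar> < (1/3) ^ Suc k / 2" using d by (simp add: s_def)
        then show ?thesis by (rule ternary_digit_eq)
      qed
      then show ?thesis using eventually_sequentially by blast
    qed
    obtain R where R: "\<And>n. \<bar>s (xs n)\<bar> \<le> R"
      using convergent_imp_Bseq[of "\<lambda>n. s (xs n)"] lim
      unfolding convergent_def Bseq_def by (metis real_norm_def)
    have "w (xs n) \<le> R + 1" for n
      using R[of n] ternary_bounds[of "\<lambda>k. xs n \<in> U k"] floor_correct[of "w (xs n)"]
      unfolding s_def by linarith
    then obtain p r where r: "strict_mono r" "(xs \<circ> r) \<longlonglongrightarrow> p"
      using compact[of "R + 1"] unfolding compact_eq_seq_compact_metric seq_compact_def
      by (metis (mono_tags, lifting) mem_Collect_eq)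
    have "xs \<longlonglongrightarrow> p"
    proof (rule topological_tendstoI)
      fix V assume V: "open V" "p \<in> V"
      obtain u where u: "u \<in> \<U>" "p \<in> u" "u \<subseteq> V"
        using topological_basisE[OF \<U>(2) V] by metis
      obtain k where k: "U k = u" using u range_U by blast
      have "\<forall>\<^sub>F n in sequentially. (xs \<circ> r) n \<in> U k"
        using r(2) U_open u k by (auto simp: tendsto_def)
      moreover obtain b where b: "\<forall>\<^sub>F n in sequentially. (xs n \<in> U k) = b" using digit by blast
      have "\<forall>\<^sub>F n in sequentially. (xs (r n) \<in> U k) = b"
        using eventually_compose_filterlim[OF b filterlim_subseq[OF r(1)]] .
      \<comment> \<open>Along the convergent subsequence the membership holds eventually, so its
        eventual value \<open>b\<close> is true.\<close>
      ultimately have "\<forall>\<^sub>F n in sequentially. b" by eventually_elim auto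
      then have b by simp
      then show "\<forall>\<^sub>F n in sequentially. xs n \<in> V"
        using b u k by (auto elim!: eventually_mono)
    qed
    then show "convergent xs" unfolding convergent_def ..
  qed
qed

text \<open>The inverse of \<open>s\<close> is extended to limits of codes. Interlacing two
  sequences whose codes have the same limit shows that the extension does not depend on the
  sequence; a constant sequence shows that it inverts \<open>s\<close>.\<close>

lemma continuous_decoding:
  fixes s :: "'b::metric_space \<Rightarrow> real"
  assumes conv: "\<And>xs L. (\<lambda>n. s (xs n)) \<longlonglongrightarrow> L \<Longrightarrow> convergent xs"
  obtains \<phi> where "continuous_on (closure (range s)) \<phi>" "\<And>x. \<phi> (s x) = x"
proof -
  have "\<forall>t\<in>closure (range s). \<exists>xs. (\<lambda>n. s (xs n)) \<longlonglongrightarrow> t"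
  proof
    fix t assume "t \<in> closure (range s)"
    then obtain ys where ys: "\<And>n. ys n \<in> range s" "ys \<longlonglongrightarrow> t"
      unfolding closure_sequential by blast
    then have "\<forall>n. \<exists>x. ys n = s x" by blast
    then obtain xs where "\<And>n. ys n = s (xs n)" by metis
    then have "ys = (\<lambda>n. s (xs n))" by blast
    then show "\<exists>xs. (\<lambda>n. s (xs n)) \<longlonglongrightarrow> t" using ys(2) by auto
  qed
  then obtain xs where xs: "\<And>t. t \<in> closure (range s) \<Longrightarrow> (\<lambda>n. s (xs t n)) \<longlonglongrightarrow> t" by metis
  define \<phi> where "\<phi> t = lim (xs t)" for t
  have lim: "xs t \<longlonglongrightarrow> \<phi> t" if "t \<in> closure (range s)" for t
    unfolding \<phi>_def using conv[OF xs[OF that]] convergent_LIMSEQ_iff by blast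
  have unique: "ys \<longlonglongrightarrow> \<phi> t" if t: "t \<in> closure (range s)" and ys: "(\<lambda>n. s (ys n)) \<longlonglongrightarrow> t" for t ys
  proof -
    define zs where "zs n = (if even n then ys (n div 2) else xs t (n div 2))" for n :: nat
    have "(\<lambda>n. s (zs n)) \<longlonglongrightarrow> t"
      by (rule limseq_even_odd) (use ys xs[OF t] in \<open>simp_all add: zs_def\<close>)
    then obtain p where p: "zs \<longlonglongrightarrow> p" using conv[of zs] unfolding convergent_def by auto
    have "(\<lambda>n. zs (2 * n)) \<longlonglongrightarrow> p"
      using LIMSEQ_subseq_LIMSEQ[OF p, of "\<lambda>n. 2 * n"] by (simp add: strict_mono_def comp_def)
    moreover have "(\<lambda>n. zs (2 * n + 1)) \<longlonglongrightarrow> p"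
      using LIMSEQ_subseq_LIMSEQ[OF p, of "\<lambda>n. 2 * n + 1"] by (simp add: strict_mono_def comp_def)
    ultimately have "ys \<longlonglongrightarrow> p" "xs t \<longlonglongrightarrow> p" by (simp_all add: zs_def)
    then show ?thesis using lim[OF t] LIMSEQ_unique by blast
  qed
  have "\<phi> (s x) = x" for x
    using unique[of "s x" "\<lambda>_. x"] closure_subset[of "range s"] LIMSEQ_unique tendsto_const by blast
  moreover have "continuous_on (closure (range s)) \<phi>"
    unfolding continuous_on_sequentially
  proof (intro ballI allI impI)
    fix ts t assume t: "t \<in> closure (range s)" and ts: "(\<forall>n. ts n \<in> closure (range s)) \<and> ts \<longlonglongrightarrow> t"
    \<comment> \<open>Replaces \<open>ts n\<close> by a genuine code \<open>s (y n)\<close> close to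
      it, with \<open>y n\<close> close to the decoding of \<open>ts n\<close>; the uniqueness of
      limits then applies to \<open>y\<close>.\<close>
    have "\<exists>y. dist (s y) (ts n) < 1 / Suc n \<and> dist y (\<phi> (ts n)) < 1 / Suc n" for n
    proof -
      have "\<forall>\<^sub>F k in sequentially. dist (s (xs (ts n) k)) (ts n) < 1 / Suc n"
        using xs ts by (intro tendstoD) auto
      moreover have "\<forall>\<^sub>F k in sequentially. dist (xs (ts n) k) (\<phi> (ts n)) < 1 / Suc n"
        using lim ts by (intro tendstoD) auto
      ultimately show ?thesis by (metis (mono_tags, lifting) eventually_conj eventually_happens' sequentially_bot)
    qed
    then obtain y where y: "\<And>n. dist (s (y n)) (ts n) < 1 / Suc n" "\<And>n. dist (y n) (\<phi> (ts n)) < 1 / Suc n"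
      by metis
    have inv: "(\<lambda>n. 1 / real (Suc n)) \<longlonglongrightarrow> 0"
      by (rule LIMSEQ_Suc[OF lim_1_over_n])
    have "(\<lambda>n. dist (s (y n)) (ts n)) \<longlonglongrightarrow> 0"
      by (rule tendsto_sandwich[OF _ _ tendsto_const inv]) (use y in \<open>auto simp del: of_nat_Suc intro!: always_eventually less_imp_le\<close>)
    then have "(\<lambda>n. s (y n) - ts n) \<longlonglongrightarrow> 0"
      by (simp add: dist_real_def tendsto_rabs_zero_iff)
    then have "(\<lambda>n. s (y n)) \<longlonglongrightarrow> t"
      by (rule Lim_transform[rotated]) (use ts in simp)
    then have yt: "y \<longlonglongrightarrow> \<phi> t" using unique t by blast
    have "(\<lambda>n. dist (y n) (\<phi> (ts n))) \<longlonglongrightarrow> 0"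
      by (rule tendsto_sandwich[OF _ _ tendsto_const inv]) (use y in \<open>auto simp del: of_nat_Suc intro!: always_eventually less_imp_le\<close>)
    moreover have "(\<lambda>n. dist (y n) (\<phi> t)) \<longlonglongrightarrow> 0" using yt by (simp add: tendsto_dist_iff[symmetric])
    ultimately have "(\<lambda>n. dist (y n) (\<phi> (ts n)) + dist (y n) (\<phi> t)) \<longlonglongrightarrow> 0"
      by (rule tendsto_add_zero)
    then have "(\<lambda>n. dist (\<phi> (ts n)) (\<phi> t)) \<longlonglongrightarrow> 0"
      by (rule tendsto_sandwich[OF _ _ tendsto_const, rotated 2])
        (auto intro!: always_eventually dist_triangle3)
    then show "(\<phi> \<circ> ts) \<longlonglongrightarrow> \<phi> t" unfolding comp_def by (subst tendsto_dist_iff)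
  qed
  ultimately show ?thesis by (intro that)
qed

text \<open>Helly's selection theorem and Skorohod's representation theorem on the real line are
  transported to \<open>'b\<close> along a Borel injection into the reals whose inverse extends continuously
  to the closure of its range.\<close>

theorem skorohod_subsequence:
  fixes w :: "'b::{metric_space, second_countable_topology} \<Rightarrow> real" and \<rho> :: "nat \<Rightarrow> 'b measure"
  assumes \<rho>: "\<And>n. \<rho> n \<in> probs borel"
    and w[measurable]: "w \<in> borel_measurable borel" and compact: "\<And>r. compact {x. w x \<le> r}"
    and w_nonneg: "\<And>x. 0 \<le> w x" and bound: "\<And>n. (\<integral>\<^sup>+x. ennreal (w x) \<partial>\<rho> n) \<le> ennreal C"
  obtains r :: "nat \<Rightarrow> nat" and \<Omega> :: "real measure" and Z :: "nat \<Rightarrow> real \<Rightarrow> 'b" and Z'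
  where "strict_mono r" "prob_space \<Omega>" "\<And>n. Z n \<in> borel_measurable \<Omega>" "Z' \<in> borel_measurable \<Omega>"
    "\<And>n. distr \<Omega> borel (Z n) = \<rho> (r n)" "AE x in \<Omega>. (\<lambda>n. Z n x) \<longlonglongrightarrow> Z' x"
proof -
  obtain s where s[measurable]: "s \<in> borel_measurable borel" and sw: "\<And>x. \<bar>s x - w x\<bar> \<le> 1"
    and s_conv: "\<And>xs L. (\<lambda>n. s (xs n)) \<longlonglongrightarrow> L \<Longrightarrow> convergent xs"
    by (rule proper_real_encoding[OF w compact], rule that)
  obtain \<phi> where \<phi>: "continuous_on (closure (range s)) \<phi>" "\<And>x. \<phi> (s x) = x"
    by (rule continuous_decoding[OF s_conv], assumption, rule that)
  define C' where "C' = closure (range s)"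
  have C'[measurable]: "C' \<in> sets borel" by (simp add: C'_def borel_closed)
  have \<rho>_sets[measurable_cong, simp]: "sets (\<rho> n) = sets borel" and \<rho>_prob: "prob_space (\<rho> n)" for n
    using \<rho>[of n] by (auto simp: space_prob_algebra)
  define \<xi> where "\<xi> n = distr (\<rho> n) borel s" for n
  have real_\<xi>: "real_distribution (\<xi> n)" for n
    unfolding \<xi>_def
    by (intro real_distribution.intro real_distribution_axioms.intro prob_space.prob_space_distr[OF \<rho>_prob]) auto
  have "tight \<xi>"
    unfolding tight_def
  proof (intro conjI allI impI real_\<xi>)
    fix e :: real assume e: "0 < e"
    \<comment> \<open>Chosen so that \<open>\<bar>C\<bar> / R < e\<close> in Markov's
      inequality.\<close>
    define R where "R = 1 + (\<bar>C\<bar> + 1) / e"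
    have R: "R > 1" using e by (simp add: R_def)
    \<comment> \<open>As \<open>w\<close> is nonnegative and \<open>s\<close> is within 1 of it,
      \<open>s\<close> stays above -2, and \<open>s\<close> above \<open>R + 1\<close> forces
      \<open>w\<close> above \<open>R\<close>.\<close>
    have "1 - e < measure (\<xi> n) {-2<..R+1}" for n
    proof -
      interpret prob_space "\<rho> n" by (rule \<rho>_prob)
      interpret L: real_distribution "\<xi> n" by (rule real_\<xi>)
      have iw: "integrable (\<rho> n) w"
        using w_nonneg bound[of n] by (intro integrableI_nonneg) (auto simp: le_less_trans)
      have "ennreal (expectation w) \<le> ennreal \<bar>C\<bar>"
        using bound[of n] w_nonneg by (subst nn_integral_eq_integral[OF iw, symmetric])
          (auto intro: order.trans ennreal_leI)
      then have "expectation w \<le> \<bar>C\<bar>" by simp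
      then have "expectation w / R \<le> \<bar>C\<bar> / R" using R by (intro divide_right_mono) auto
      moreover have "measure (\<rho> n) {x\<in>space (\<rho> n). R \<le> w x} \<le> expectation w / R"
        by (rule integral_Markov_inequality_measure[OF iw sets.empty_sets]) (use R w_nonneg in auto)
      ultimately have "measure (\<rho> n) {x\<in>space (\<rho> n). R \<le> w x} \<le> \<bar>C\<bar> / R" by linarith
      also have "\<bar>C\<bar> / R < e" using e R by (simp add: R_def field_simps add_pos_pos)
      finally have "measure (\<rho> n) {x\<in>space (\<rho> n). R \<le> w x} < e" .
      moreover have "measure (\<xi> n) (UNIV - {-2<..R+1}) \<le> measure (\<rho> n) {x\<in>space (\<rho> n). R \<le> w x}"
      proof -
        have "measure (\<xi> n) (UNIV - {-2<..R+1}) = measure (\<rho> n) (s -` (UNIV - {-2<..R+1}) \<inter> space (\<rho> n))"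
          unfolding \<xi>_def by (rule measure_distr) auto
        also have "\<dots> \<le> measure (\<rho> n) {x\<in>space (\<rho> n). R \<le> w x}"
        proof (rule finite_measure_mono)
          show "s -` (UNIV - {-2<..R+1}) \<inter> space (\<rho> n) \<subseteq> {x\<in>space (\<rho> n). R \<le> w x}"
          proof safe
            fix x assume "s x \<notin> {-2<..R+1}"
            then show "R \<le> w x" using sw[of x] w_nonneg[of x] by auto
          qed
        qed measurable
        finally show ?thesis .
      qed
      moreover have "measure (\<xi> n) (UNIV - {-2<..R+1}) = 1 - measure (\<xi> n) {-2<..R+1}"
        using L.prob_compl[of "{-2<..R+1}"] by simp
      ultimately show ?thesis by linarith
    qed
    then show "\<exists>a b. a < b \<and> (\<forall>n. 1 - e < measure (\<xi> n) {a<..b})"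
      using R by (intro exI[of _ "-2"] exI[of _ "R + 1"]) auto
  qed
  then obtain r L where r: "strict_mono (r :: nat \<Rightarrow> nat)" "real_distribution L" "weak_conv_m (\<xi> \<circ> r) L"
    using tight_imp_convergent_subsubsequence[of \<xi> id] by (auto simp: strict_mono_def comp_def)
  obtain \<Omega> :: "real measure" and Y Y' where Y: "prob_space \<Omega>" "\<And>n. Y n \<in> borel_measurable \<Omega>"
    "\<And>n. distr \<Omega> borel (Y n) = (\<xi> \<circ> r) n" "Y' \<in> measurable \<Omega> lborel" "distr \<Omega> borel Y' = L"
    "\<And>x. x \<in> space \<Omega> \<Longrightarrow> (\<lambda>n. Y n x) \<longlonglongrightarrow> Y' x"
  proof -
    have "real_distribution ((\<xi> \<circ> r) n)" for n by (simp add: real_\<xi>)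
    from Skorohod[OF this r(2,3)] show ?thesis
      by (elim exE conjE) (rule that, blast+)
  qed
  \<comment> \<open>The value off \<open>C'\<close> is a mere default: the variables decoded below
    lie in \<open>C'\<close> almost surely.\<close>
  define \<psi> where "\<psi> t = (if t \<in> C' then \<phi> t else undefined)" for t
  have [measurable]: "\<psi> \<in> borel_measurable borel"
    unfolding \<psi>_def[abs_def] by (rule borel_measurable_continuous_on_if) (use \<phi> in \<open>auto simp: C'_def\<close>)
  have \<psi>s: "\<psi> (s x) = x" for x
    using \<phi>(2) closure_subset[of "range s"] by (auto simp: \<psi>_def C'_def)
  note [measurable] = Y(2)
  have [measurable]: "Y' \<in> borel_measurable \<Omega>" using Y(4) by simp
  show ?thesis
  proof
    show "strict_mono r" "prob_space \<Omega>" by fact+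
    show "(\<lambda>x. \<psi> (Y n x)) \<in> borel_measurable \<Omega>" "(\<lambda>x. \<psi> (Y' x)) \<in> borel_measurable \<Omega>" for n
      by measurable
    show "distr \<Omega> borel (\<lambda>x. \<psi> (Y n x)) = \<rho> (r n)" for n
    proof -
      have "distr \<Omega> borel (\<lambda>x. \<psi> (Y n x)) = distr (distr \<Omega> borel (Y n)) borel \<psi>"
        by (subst distr_distr) (auto simp: comp_def)
      also have "\<dots> = distr (distr (\<rho> (r n)) borel s) borel \<psi>" using Y(3) by (simp add: \<xi>_def)
      also have "\<dots> = distr (\<rho> (r n)) borel (\<lambda>x. x)"
        by (subst distr_distr) (auto simp: comp_def \<psi>s)
      also have "\<dots> = \<rho> (r n)" by (rule distr_id2) simp
      finally show ?thesis .
    qed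
    \<comment> \<open>\<open>Y n\<close> has the law of a code. As \<open>C'\<close> is closed, the
      limit \<open>Y'\<close> lies in it too, and there the decoding is continuous.\<close>
    have "AE x in \<Omega>. \<forall>n. Y n x \<in> C'"
      unfolding AE_all_countable
    proof
      fix n
      have "AE x in \<rho> (r n). s x \<in> C'" using closure_subset[of "range s"] by (auto simp: C'_def)
      then have "AE t in distr (\<rho> (r n)) borel s. t \<in> C'" by (simp add: AE_distr_iff)
      then have "AE t in distr \<Omega> borel (Y n). t \<in> C'" unfolding Y(3) by (simp only: \<xi>_def comp_apply)
      then show "AE x in \<Omega>. Y n x \<in> C'" by (simp add: AE_distr_iff)
    qed
    then show "AE x in \<Omega>. (\<lambda>n. \<psi> (Y n x)) \<longlonglongrightarrow> \<psi> (Y' x)"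
      using AE_space
    proof eventually_elim
      case (elim x)
      have "Y' x \<in> C'"
        using closed_sequentially[of C' "\<lambda>n. Y n x" "Y' x"] elim Y(6) by (auto simp: C'_def)
      moreover have "(\<lambda>n. \<phi> (Y n x)) \<longlonglongrightarrow> \<phi> (Y' x)"
        by (rule continuous_on_tendsto_compose[OF \<phi>(1) Y(6)])
          (use elim \<open>Y' x \<in> C'\<close> in \<open>auto simp: C'_def\<close>)
      ultimately show ?case using elim by (simp add: \<psi>_def)
    qed
  qed
qed

section \<open>Weak convergence and couplings\<close>

lemma probs_iff: "\<mu> \<in> probs N \<longleftrightarrow> sets \<mu> = sets N \<and> prob_space \<mu>"
  by (auto simp: space_prob_algebra)

lemma probs_distr: "prob_space \<Omega> \<Longrightarrow> X \<in> measurable \<Omega> N \<Longrightarrow> distr \<Omega> N X \<in> probs N"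
  by (simp add: probs_iff prob_space.prob_space_distr)

lemma convergent_imp_bounded_above:
  fixes xs :: "nat \<Rightarrow> real"
  assumes "xs \<longlonglongrightarrow> l"
  shows "\<exists>C. \<forall>n. xs n \<le> C"
proof -
  obtain K where "\<And>n. norm (xs n) \<le> K"
    using convergent_imp_Bseq[OF convergentI[OF assms]] unfolding Bseq_def by blast
  then have "xs n \<le> K" for n using abs_le_D1[of "xs n" K] by simp
  then show ?thesis by blast
qed

lemma subseq_converges_imp_converges:
  fixes xs :: "nat \<Rightarrow> 'b::metric_space"
  assumes "\<And>r :: nat \<Rightarrow> nat. strict_mono r \<Longrightarrow> \<exists>q :: nat \<Rightarrow> nat. strict_mono q \<and> (\<lambda>n. xs (r (q n))) \<longlonglongrightarrow> l"
  shows "xs \<longlonglongrightarrow> l"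
proof (rule tendstoI, rule ccontr)
  fix e :: real assume "0 < e" and "\<not> (\<forall>\<^sub>F n in sequentially. dist (xs n) l < e)"
  then obtain r :: "nat \<Rightarrow> nat" where r: "strict_mono r" "\<And>n. \<not> dist (xs (r n)) l < e"
    using not_eventually_sequentiallyD by blast
  from assms[OF r(1)] obtain q where "(\<lambda>n. xs (r (q n))) \<longlonglongrightarrow> l" by (elim exE conjE)
  from tendstoD[OF this \<open>0 < e\<close>] r(2) show False by simp
qed

section \<open>A countable family of test functions\<close>

definition separating_sequence :: "(nat \<Rightarrow> 'a::topological_space \<Rightarrow> real) \<Rightarrow> bool" where
  "separating_sequence f \<longleftrightarrow>
    (\<forall>i. continuous_on UNIV (f i)) \<and> (\<forall>i x. 0 \<le> f i x \<and> f i x \<le> 1) \<and>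
    (\<forall>\<mu>\<in>probs borel. \<forall>\<nu>\<in>probs borel. (\<forall>i. (\<integral>x. f i x \<partial>\<mu>) = (\<integral>x. f i x \<partial>\<nu>)) \<longrightarrow> \<mu> = \<nu>)"

text \<open>For an open \<open>V\<close> other than the whole space the functions
  \<open>min 1 (j * infdist x (- V))\<close> increase to the indicator of \<open>V\<close>, so their
  integrals determine the measure of \<open>V\<close>. Closing a countable base under finite
  intersections gives a countable pi-system that generates the Borel sets.\<close>

lemma separating_sequence_exists:
  "\<exists>f :: nat \<Rightarrow> 'a::{metric_space, second_countable_topology} \<Rightarrow> real. separating_sequence f"
proof -
  obtain \<U> :: "'a set set" where \<U>: "countable \<U>" "topological_basis \<U>"
    using ex_countable_basis by blast
  define \<V> where "\<V> = Inter ` {F. finite F \<and> F \<subseteq> \<U>}"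
  have count: "countable \<V>"
    unfolding \<V>_def using countable_Collect_finite_subset[OF \<U>(1)] by (intro countable_image) (simp add: conj_commute)
  have V_open: "open V" if "V \<in> \<V>" for V
    using that topological_basis_open[OF \<U>(2)] by (auto simp: \<V>_def intro!: open_Inter)
  have "\<U> \<subseteq> \<V>"
  proof
    fix u assume "u \<in> \<U>"
    then have "u = \<Inter>{u}" "{u} \<in> {F. finite F \<and> F \<subseteq> \<U>}" by auto
    then show "u \<in> \<V>" unfolding \<V>_def by (rule image_eqI)
  qed
  have basis: "topological_basis \<V>"
    unfolding topological_basis_def using V_open \<U>(2) \<open>\<U> \<subseteq> \<V>\<close> by (meson order_trans topological_basis_def)
  have stable: "Int_stable \<V>"
  proof (rule Int_stableI)
    fix a b assume "a \<in> \<V>" "b \<in> \<V>"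
    then obtain F G where "a = \<Inter>F" "b = \<Inter>G" "finite F" "F \<subseteq> \<U>" "finite G" "G \<subseteq> \<U>" by (auto simp: \<V>_def)
    then have "a \<inter> b = \<Inter>(F \<union> G)" "F \<union> G \<in> {F. finite F \<and> F \<subseteq> \<U>}" by auto
    then show "a \<inter> b \<in> \<V>" unfolding \<V>_def by (rule image_eqI)
  qed
  have UNIV: "UNIV \<in> \<V>"
    unfolding \<V>_def by (rule image_eqI[of _ _ "{}"]) auto
  define g where "g V j x = min 1 (real j * infdist x (- V))" for V :: "'a set" and j :: nat and x
  define f where "f i = (case prod_decode i of (m, j) \<Rightarrow> g (from_nat_into \<V> m) j)" for i
  have g_cont: "continuous_on UNIV (g V j)" for V j
    unfolding g_def by (intro continuous_intros)
  have g_bounds: "0 \<le> g V j x" "g V j x \<le> 1" for V j x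
    by (auto simp: g_def infdist_nonneg)
  \<comment> \<open>The whole space is excluded because \<open>infdist\<close> to the empty set is
    0; it has measure 1 under both measures anyway.\<close>
  have g_lim: "(\<lambda>j. (\<integral>x. g V j x \<partial>\<mu>)) \<longlonglongrightarrow> measure \<mu> V"
    if \<mu>: "\<mu> \<in> probs borel" and V: "open V" "V \<noteq> UNIV" for \<mu> V
  proof -
    interpret prob_space \<mu> using \<mu> by (simp add: probs_iff)
    have [measurable_cong]: "sets \<mu> = sets borel" using \<mu> by (simp add: probs_iff)
    have [measurable]: "g V j \<in> borel_measurable borel" for j
      using g_cont by (rule borel_measurable_continuous_onI)
    have [measurable]: "V \<in> sets borel" using V by simp
    have "(\<lambda>j. (\<integral>x. g V j x \<partial>\<mu>)) \<longlonglongrightarrow> (\<integral>x. indicator V x \<partial>\<mu>)"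
    proof (rule integral_dominated_convergence[where w = "\<lambda>_. 1"])
      have "(\<lambda>j. g V j x) \<longlonglongrightarrow> indicator V x" for x
      proof (cases "x \<in> V")
        case True
        then have "infdist x (- V) > 0"
          using V infdist_pos_not_in_closed[of "- V" x] by auto
        moreover obtain N :: nat where N: "1 / infdist x (- V) < N" using reals_Archimedean2 by blast
        ultimately have "g V j x = 1" if "j \<ge> N" for j
        proof -
          have "1 / infdist x (- V) \<le> j" using N that by linarith
          then show ?thesis using \<open>infdist x (- V) > 0\<close> by (simp add: g_def field_simps)
        qed
        then show ?thesis using True by (intro tendsto_eventually) (auto simp: eventually_sequentially)
      next
        case False
        then show ?thesis by (simp add: g_def)
      qed
      then show "AE x in \<mu>. (\<lambda>j. g V j x) \<longlonglongrightarrow> indicator V x" by simp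
      show "AE x in \<mu>. norm (g V j x) \<le> 1" for j using g_bounds by auto
    qed auto
    then show ?thesis by (simp add: sets_eq_imp_space_eq[of \<mu> borel])
  qed
  have "\<mu> = \<nu>" if \<mu>: "\<mu> \<in> probs borel" and \<nu>: "\<nu> \<in> probs borel"
    and eq: "\<forall>i. (\<integral>x. f i x \<partial>\<mu>) = (\<integral>x. f i x \<partial>\<nu>)" for \<mu> \<nu>
  proof -
    interpret \<mu>: prob_space \<mu> using \<mu> by (simp add: probs_iff)
    interpret \<nu>: prob_space \<nu> using \<nu> by (simp add: probs_iff)
    have sp: "space \<mu> = UNIV" "space \<nu> = UNIV"
      using \<mu> \<nu> sets_eq_imp_space_eq[of _ borel] by (auto simp: probs_iff)
    have "emeasure \<mu> V = emeasure \<nu> V" if V: "V \<in> \<V>" for V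
    proof (cases "V = UNIV")
      case True
      then show ?thesis using \<mu>.emeasure_space_1 \<nu>.emeasure_space_1 sp by simp
    next
      case False
      obtain m where m: "from_nat_into \<V> m = V" using from_nat_into_surj[OF count V] by blast
      have "(\<integral>x. g V j x \<partial>\<mu>) = (\<integral>x. g V j x \<partial>\<nu>)" for j
        using eq[rule_format, of "prod_encode (m, j)"] m by (simp add: f_def)
      then have "measure \<mu> V = measure \<nu> V"
        using g_lim[OF \<mu> V_open[OF V] False] g_lim[OF \<nu> V_open[OF V] False] LIMSEQ_unique by simp
      then show ?thesis by (simp add: \<mu>.emeasure_eq_measure \<nu>.emeasure_eq_measure)
    qed
    moreover have "sets borel = sigma_sets UNIV \<V>"
      unfolding borel_eq_countable_basis[OF count basis] by simp
    ultimately show "\<mu> = \<nu>"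
      using \<mu> \<nu> UNIV stable
      by (intro measure_eqI_generator_eq[where E = \<V> and \<Omega> = UNIV and A = "\<lambda>_. UNIV"])
        (auto simp: probs_iff)
  qed
  moreover have "continuous_on UNIV (f i)" "0 \<le> f i x" "f i x \<le> 1" for i x
    using g_cont g_bounds by (auto simp: f_def split: prod.split)
  ultimately show ?thesis unfolding separating_sequence_def by blast
qed

definition test_fun :: "nat \<Rightarrow> 'a::{metric_space, second_countable_topology} \<Rightarrow> real" where
  "test_fun = (SOME f. separating_sequence f)"

lemma test_fun: "separating_sequence test_fun"
  unfolding test_fun_def by (rule someI_ex[OF separating_sequence_exists])

lemma test_fun_continuous: "continuous_on UNIV (test_fun i)"
  and test_fun_bounds: "0 \<le> test_fun i x" "test_fun i x \<le> 1"
  using test_fun by (auto simp: separating_sequence_def)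

lemma test_fun_bounded: "bounded (range (test_fun i))"
proof (rule boundedI)
  fix y assume "y \<in> range (test_fun i :: 'a \<Rightarrow> real)"
  then obtain x :: 'a where "y = test_fun i x" by blast
  then show "norm y \<le> 1" using test_fun_bounds[of i x] by simp
qed

lemma test_fun_eqI:
  "\<mu> \<in> probs borel \<Longrightarrow> \<nu> \<in> probs borel \<Longrightarrow>
    (\<And>i. (\<integral>x. test_fun i x \<partial>\<mu>) = (\<integral>x. test_fun i x \<partial>\<nu>)) \<Longrightarrow> \<mu> = \<nu>"
  using test_fun unfolding separating_sequence_def by blast

lemma weakly_converges_unique:
  fixes \<nu> \<nu>' :: "'a::{metric_space, second_countable_topology} measure"
  assumes "weakly_converges \<nu>s \<nu>" "weakly_converges \<nu>s \<nu>'" "\<nu> \<in> probs borel" "\<nu>' \<in> probs borel"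
  shows "\<nu> = \<nu>'"
proof (rule test_fun_eqI)
  fix i
  have "(\<lambda>n. \<integral>x. test_fun i x \<partial>\<nu>s n) \<longlonglongrightarrow> (\<integral>x. test_fun i x \<partial>\<nu>)"
    "(\<lambda>n. \<integral>x. test_fun i x \<partial>\<nu>s n) \<longlonglongrightarrow> (\<integral>x. test_fun i x \<partial>\<nu>')"
    using assms test_fun_continuous test_fun_bounded by (auto simp: weakly_converges_def)
  then show "(\<integral>x. test_fun i x \<partial>\<nu>) = (\<integral>x. test_fun i x \<partial>\<nu>')" by (rule LIMSEQ_unique)
qed fact+

lemma weakly_converges_subseq:
  assumes "weakly_converges \<nu>s \<nu>" "strict_mono r"
  shows "weakly_converges (\<lambda>n. \<nu>s (r n)) \<nu>"
  unfolding weakly_converges_def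
proof (intro allI impI)
  fix f :: "'a \<Rightarrow> real" assume "continuous_on UNIV f \<and> bounded (range f)"
  then have "(\<lambda>n. \<integral>x. f x \<partial>\<nu>s n) \<longlonglongrightarrow> (\<integral>x. f x \<partial>\<nu>)"
    using assms(1) by (simp add: weakly_converges_def)
  from LIMSEQ_subseq_LIMSEQ[OF this assms(2)]
  show "(\<lambda>n. \<integral>x. f x \<partial>\<nu>s (r n)) \<longlonglongrightarrow> (\<integral>x. f x \<partial>\<nu>)" by (simp add: comp_def)
qed

lemma weakly_converges_const: "weakly_converges (\<lambda>_. \<nu>) \<nu>"
  by (simp add: weakly_converges_def)

lemma weakly_converges_distr:
  fixes Z :: "nat \<Rightarrow> 'w \<Rightarrow> 'a::{metric_space, second_countable_topology}"
  assumes "prob_space \<Omega>" and [measurable]: "\<And>n. Z n \<in> borel_measurable \<Omega>" "Z' \<in> borel_measurable \<Omega>"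
    and lim: "AE x in \<Omega>. (\<lambda>n. Z n x) \<longlonglongrightarrow> Z' x"
  shows "weakly_converges (\<lambda>n. distr \<Omega> borel (Z n)) (distr \<Omega> borel Z')"
  unfolding weakly_converges_def
proof (intro allI impI, elim conjE)
  interpret prob_space \<Omega> by fact
  fix f :: "'a \<Rightarrow> real" assume f: "continuous_on UNIV f" and "bounded (range f)"
  then obtain b where b: "\<And>x. norm (f x) \<le> b" unfolding bounded_iff by auto
  have [measurable]: "f \<in> borel_measurable borel" using f by (rule borel_measurable_continuous_onI)
  have "(\<lambda>n. \<integral>x. f (Z n x) \<partial>\<Omega>) \<longlonglongrightarrow> (\<integral>x. f (Z' x) \<partial>\<Omega>)"
  proof (rule integral_dominated_convergence[where w = "\<lambda>_. b"])
    show "AE x in \<Omega>. (\<lambda>n. f (Z n x)) \<longlonglongrightarrow> f (Z' x)"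
      using lim by eventually_elim (auto intro: continuous_on_tendsto_compose[OF f])
  qed (use b in auto)
  then show "(\<lambda>n. \<integral>x. f x \<partial>distr \<Omega> borel (Z n)) \<longlonglongrightarrow> (\<integral>x. f x \<partial>distr \<Omega> borel Z')"
    by (simp add: integral_distr)
qed

lemma distr_AE_limit:
  fixes Z :: "nat \<Rightarrow> 'w \<Rightarrow> 'a::{metric_space, second_countable_topology}"
  assumes "prob_space \<Omega>" "\<And>n. Z n \<in> borel_measurable \<Omega>" "Z' \<in> borel_measurable \<Omega>"
    and "AE x in \<Omega>. (\<lambda>n. Z n x) \<longlonglongrightarrow> Z' x"
    and "weakly_converges (\<lambda>n. distr \<Omega> borel (Z n)) \<nu>" "\<nu> \<in> probs borel"
  shows "distr \<Omega> borel Z' = \<nu>"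
  using assms by (intro weakly_converges_unique[OF weakly_converges_distr[OF assms(1-4)]] probs_distr) auto

section \<open>Approximate gluing along a common marginal\<close>

lemma measurable_partition_of_small_diameter:
  assumes "0 < e"
  obtains q :: "'a::{metric_space, second_countable_topology} \<Rightarrow> nat"
  where "q \<in> measurable borel (count_space UNIV)" "\<And>x y. q x = q y \<Longrightarrow> dist x y < e"
proof -
  obtain D :: "'a set" where D: "countable D" "\<And>X. open X \<Longrightarrow> X \<noteq> {} \<Longrightarrow> \<exists>d\<in>D. d \<in> X"
    using countable_dense_exists by metis
  define d where "d = from_nat_into D"
  have ex: "\<exists>k. dist x (d k) < e / 2" for x
  proof -
    obtain p where "p \<in> D" "p \<in> ball x (e / 2)" using D(2)[of "ball x (e / 2)"] assms by auto
    moreover obtain k where "d k = p" using from_nat_into_surj[OF D(1) \<open>p \<in> D\<close>] by (auto simp: d_def)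
    ultimately show ?thesis by auto
  qed
  define q where "q x = (LEAST k. dist x (d k) < e / 2)" for x
  have q: "dist x (d (q x)) < e / 2" for x
    unfolding q_def by (rule LeastI_ex[OF ex])
  show ?thesis
  proof
    show "q \<in> measurable borel (count_space UNIV)"
      unfolding q_def[abs_def] by measurable
    show "dist x y < e" if "q x = q y" for x y
      using dist_triangle_half_l[OF q[of x], of y] q[of y] that by simp
  qed
qed

lemma nn_integral_cell_density:
  assumes "prob_space N" and [measurable]: "V \<in> measurable N (count_space UNIV)"
    and "measure N {y \<in> space N. V y = k} \<noteq> 0"
  shows "(\<integral>\<^sup>+y. (if V y = k then ennreal (1 / measure N {y \<in> space N. V y = k}) else 0) \<partial>N) = 1"
proof -
  interpret prob_space N by fact
  have "(\<integral>\<^sup>+y. (if V y = k then ennreal (1 / prob {y \<in> space N. V y = k}) else 0) \<partial>N)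
      = (\<integral>\<^sup>+y. ennreal (1 / prob {y \<in> space N. V y = k}) * indicator {y \<in> space N. V y = k} y \<partial>N)"
    by (intro nn_integral_cong) (auto simp: indicator_def)
  also have "\<dots> = 1"
    using assms(3) by (subst nn_integral_cmult_indicator) (auto simp: emeasure_eq_measure ennreal_mult'[symmetric])
  finally show ?thesis .
qed

text \<open>Conditionally on the cell of the partition that contains \<open>Y1\<close> and \<open>Y2\<close>, the two
  coordinates are independent. This replaces a disintegration of \<open>M1\<close> and \<open>M2\<close> over the common
  law of \<open>Y1\<close> and \<open>Y2\<close>.\<close>

lemma approximate_gluing:
  fixes Y1 :: "'m \<Rightarrow> 'a::{metric_space, second_countable_topology}" and Y2 :: "'n \<Rightarrow> 'a"
  assumes "prob_space M1" "prob_space M2"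
    and [measurable]: "Y1 \<in> borel_measurable M1" "Y2 \<in> borel_measurable M2"
    and law: "distr M1 borel Y1 = distr M2 borel Y2" and e: "0 < e"
  obtains K where "prob_space K" "sets K = sets (M1 \<Otimes>\<^sub>M M2)" "distr K M1 fst = M1" "distr K M2 snd = M2"
    "AE z in K. dist (Y1 (fst z)) (Y2 (snd z)) < e"
proof -
  interpret M1: prob_space M1 by fact
  interpret M2: prob_space M2 by fact
  interpret pair_sigma_finite M1 M2 ..
  obtain q :: "'a \<Rightarrow> nat" where q[measurable]: "q \<in> measurable borel (count_space UNIV)"
    and q_dist: "\<And>x y. q x = q y \<Longrightarrow> dist x y < e"
    using measurable_partition_of_small_diameter[OF e] by blast
  define a where "a k = measure M1 {x \<in> space M1. q (Y1 x) = k}" for k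
  have a2: "a k = measure M2 {x \<in> space M2. q (Y2 x) = k}" for k
  proof -
    have "measure (distr M1 borel Y1) {y. q y = k} = measure M1 {x \<in> space M1. q (Y1 x) = k}"
      by (subst measure_distr) (auto intro!: arg_cong[where f = "measure M1"])
    moreover have "measure (distr M2 borel Y2) {y. q y = k} = measure M2 {x \<in> space M2. q (Y2 x) = k}"
      by (subst measure_distr) (auto intro!: arg_cong[where f = "measure M2"])
    ultimately show ?thesis by (simp add: a_def law)
  qed
  \<comment> \<open>There are countably many cells, so almost every point lies in a cell of positive
    mass; only there is the density below normalised.\<close>
  have pos: "AE x in N. measure N {y \<in> space N. V y = V x} \<noteq> 0"
    if "prob_space N" and V[measurable]: "V \<in> measurable N (count_space UNIV)" for N :: "'z measure" and V :: "'z \<Rightarrow> nat"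
  proof -
    interpret N: prob_space N by fact
    have "AE x in N. \<forall>k. measure N {y \<in> space N. V y = k} = 0 \<longrightarrow> V x \<noteq> k"
      unfolding AE_all_countable
    proof
      fix k
      show "AE x in N. measure N {y \<in> space N. V y = k} = 0 \<longrightarrow> V x \<noteq> k"
      proof (cases "measure N {y \<in> space N. V y = k} = 0")
        case True
        then show ?thesis
          by (intro AE_I[where N = "{y \<in> space N. V y = k}"]) (auto simp: N.emeasure_eq_measure)
      qed simp
    qed
    then show ?thesis by eventually_elim auto
  qed
  \<comment> \<open>Relative to the product measure, the density of two coordinates that are
    independent given a common cell: cell \<open>k\<close> has weight \<open>a k\<close> and
    conditional densities \<open>1 / a k\<close> on both sides, which multiply to
    \<open>1 / a k\<close>.\<close>
  define D where "D z = (if q (Y1 (fst z)) = q (Y2 (snd z)) then ennreal (1 / a (q (Y1 (fst z)))) else 0)" for z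
  have [measurable]: "a \<in> borel_measurable (count_space UNIV)" by simp
  have "Measurable.pred (M1 \<Otimes>\<^sub>M M2) (\<lambda>z. \<exists>k. q (Y1 (fst z)) = k \<and> q (Y2 (snd z)) = k)"
    by measurable
  then have [measurable]: "Measurable.pred (M1 \<Otimes>\<^sub>M M2) (\<lambda>z. q (Y1 (fst z)) = q (Y2 (snd z)))"
    by (rule back_subst[of "Measurable.pred _"]) auto
  have [measurable]: "D \<in> borel_measurable (M1 \<Otimes>\<^sub>M M2)"
    unfolding D_def[abs_def] by measurable
  define K where "K = density (M1 \<Otimes>\<^sub>M M2) D"
  have qY1: "(\<lambda>x. q (Y1 x)) \<in> measurable M1 (count_space UNIV)"
    and qY2: "(\<lambda>x. q (Y2 x)) \<in> measurable M2 (count_space UNIV)"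
    by measurable
  have D1: "AE x in M1. (\<integral>\<^sup>+y. D (x, y) \<partial>M2) = 1"
    using pos[OF \<open>prob_space M1\<close> qY1]
  proof eventually_elim
    case (elim x)
    have "D (x, y) = (if q (Y2 y) = q (Y1 x) then ennreal (1 / a (q (Y1 x))) else 0)" for y
      by (auto simp: D_def)
    then show ?case
      using elim nn_integral_cell_density[OF \<open>prob_space M2\<close> qY2, of "q (Y1 x)"]
      by (simp add: a2[symmetric] a_def[symmetric] cong: if_cong)
  qed
  have D2: "AE y in M2. (\<integral>\<^sup>+x. D (x, y) \<partial>M1) = 1"
    using pos[OF \<open>prob_space M2\<close> qY2]
  proof eventually_elim
    case (elim y)
    have "D (x, y) = (if q (Y1 x) = q (Y2 y) then ennreal (1 / a (q (Y2 y))) else 0)" for x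
      by (simp add: D_def)
    then show ?case
      using elim nn_integral_cell_density[OF \<open>prob_space M1\<close> qY1, of "q (Y2 y)"]
      by (simp add: a2[symmetric] a_def[symmetric] cong: if_cong)
  qed
  show ?thesis
  proof
    show sets_K: "sets K = sets (M1 \<Otimes>\<^sub>M M2)" by (simp add: K_def)
    have [measurable_cong]: "sets K = sets (M1 \<Otimes>\<^sub>M M2)" by (fact sets_K)
    show d1: "distr K M1 fst = M1"
    proof (rule measure_eqI)
      fix S assume "S \<in> sets (distr K M1 fst)"
      then have S[measurable]: "S \<in> sets M1" by simp
      have "emeasure (distr K M1 fst) S = (\<integral>\<^sup>+z. indicator S (fst z) \<partial>K)"
        by (subst nn_integral_distr[symmetric, of fst K M1 "indicator S"]) auto
      also have "\<dots> = (\<integral>\<^sup>+z. D z * indicator S (fst z) \<partial>(M1 \<Otimes>\<^sub>M M2))"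
        unfolding K_def by (rule nn_integral_density) measurable
      also have "\<dots> = (\<integral>\<^sup>+x. (\<integral>\<^sup>+y. D (x, y) * indicator S x \<partial>M2) \<partial>M1)"
        by (subst M2.nn_integral_fst[symmetric]) auto
      also have "\<dots> = (\<integral>\<^sup>+x. (\<integral>\<^sup>+y. D (x, y) \<partial>M2) * indicator S x \<partial>M1)"
        by (intro nn_integral_cong nn_integral_multc) measurable
      also have "\<dots> = (\<integral>\<^sup>+x. indicator S x \<partial>M1)"
        using D1 by (intro nn_integral_cong_AE) auto
      finally show "emeasure (distr K M1 fst) S = emeasure M1 S" by simp
    qed simp
    show "distr K M2 snd = M2"
    proof (rule measure_eqI)
      fix S assume "S \<in> sets (distr K M2 snd)"
      then have S[measurable]: "S \<in> sets M2" by simp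
      have "emeasure (distr K M2 snd) S = (\<integral>\<^sup>+z. indicator S (snd z) \<partial>K)"
        by (subst nn_integral_distr[symmetric, of snd K M2 "indicator S"]) auto
      also have "\<dots> = (\<integral>\<^sup>+z. D z * indicator S (snd z) \<partial>(M1 \<Otimes>\<^sub>M M2))"
        unfolding K_def by (rule nn_integral_density) measurable
      also have "\<dots> = (\<integral>\<^sup>+y. (\<integral>\<^sup>+x. D (x, y) * indicator S y \<partial>M1) \<partial>M2)"
        by (subst nn_integral_snd[symmetric]) auto
      also have "\<dots> = (\<integral>\<^sup>+y. (\<integral>\<^sup>+x. D (x, y) \<partial>M1) * indicator S y \<partial>M2)"
        by (intro nn_integral_cong nn_integral_multc) measurable
      also have "\<dots> = (\<integral>\<^sup>+y. indicator S y \<partial>M2)"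
        using D2 by (intro nn_integral_cong_AE) auto
      finally show "emeasure (distr K M2 snd) S = emeasure M2 S" by simp
    qed simp
    show "prob_space K"
      by (rule prob_space_distrD[of fst K M1]) (use d1 M1.prob_space_axioms in simp_all)
    show "AE z in K. dist (Y1 (fst z)) (Y2 (snd z)) < e"
      unfolding K_def by (subst AE_density) (auto simp: D_def q_dist)
  qed
qed

section \<open>Couplings and their costs\<close>

lemma borel_measurable_fst_snd[measurable]:
  "fst \<in> borel_measurable (borel :: ('a::topological_space \<times> 'b::topological_space) measure)"
  "snd \<in> borel_measurable (borel :: ('a \<times> 'b) measure)"
  by (auto intro!: borel_measurable_continuous_onI continuous_intros)

lemma couplingsD:
  assumes "\<gamma> \<in> couplings \<mu> \<nu>"
  shows "prob_space \<gamma>" "sets \<gamma> = sets borel" "distr \<gamma> borel fst = \<mu>" "distr \<gamma> borel snd = \<nu>"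
  using assms by (auto simp: couplings_def probs_iff)

lemma coupling_distr:
  fixes X Y :: "'w \<Rightarrow> 'a::{metric_space, second_countable_topology}"
  assumes "prob_space \<Omega>" and [measurable]: "X \<in> borel_measurable \<Omega>" "Y \<in> borel_measurable \<Omega>"
  shows "distr \<Omega> borel (\<lambda>\<omega>. (X \<omega>, Y \<omega>)) \<in> couplings (distr \<Omega> borel X) (distr \<Omega> borel Y)"
proof -
  have [measurable]: "(\<lambda>\<omega>. (X \<omega>, Y \<omega>)) \<in> borel_measurable \<Omega>"
    unfolding borel_prod[symmetric] by measurable
  show ?thesis
    unfolding couplings_def using assms(1) by (auto intro!: probs_distr simp: distr_distr comp_def)
qed

lemma couplings_nonempty:
  fixes \<mu> \<nu> :: "'a::{metric_space, second_countable_topology} measure"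
  assumes "\<mu> \<in> probs borel" "\<nu> \<in> probs borel"
  shows "couplings \<mu> \<nu> \<noteq> {}"
proof -
  interpret \<mu>: prob_space \<mu> using assms by (simp add: probs_iff)
  interpret \<nu>: prob_space \<nu> using assms by (simp add: probs_iff)
  interpret pair_prob_space \<mu> \<nu> ..
  have [measurable_cong]: "sets \<mu> = sets borel" "sets \<nu> = sets borel" using assms by (simp_all add: probs_iff)
  have "distr (\<mu> \<Otimes>\<^sub>M \<nu>) borel fst = \<mu>"
    using \<nu>.distr_pair_fst[of \<mu>] assms by (simp add: probs_iff cong: distr_cong)
  moreover have "distr (\<mu> \<Otimes>\<^sub>M \<nu>) borel snd = distr (\<nu> \<Otimes>\<^sub>M \<mu>) borel fst"
    by (subst distr_pair_swap) (simp add: distr_distr comp_def split_beta)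
  moreover have "distr (\<nu> \<Otimes>\<^sub>M \<mu>) borel fst = \<nu>"
    using \<mu>.distr_pair_fst[of \<nu>] assms by (simp add: probs_iff cong: distr_cong)
  ultimately show ?thesis
    using coupling_distr[OF prob_space_axioms, of fst snd] by auto
qed

lemma nn_integral_coupling_fst:
  fixes \<mu> \<nu> :: "'a::{metric_space, second_countable_topology} measure"
  assumes "\<gamma> \<in> couplings \<mu> \<nu>" "f \<in> borel_measurable borel"
  shows "(\<integral>\<^sup>+z. f (fst z) \<partial>\<gamma>) = (\<integral>\<^sup>+x. f x \<partial>\<mu>)"
proof -
  have [measurable_cong]: "sets \<gamma> = sets borel" using couplingsD[OF assms(1)] by simp
  show ?thesis
    unfolding couplingsD(3)[OF assms(1), symmetric] using assms(2) by (subst nn_integral_distr) auto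
qed

lemma nn_integral_coupling_snd:
  fixes \<mu> \<nu> :: "'a::{metric_space, second_countable_topology} measure"
  assumes "\<gamma> \<in> couplings \<mu> \<nu>" "f \<in> borel_measurable borel"
  shows "(\<integral>\<^sup>+z. f (snd z) \<partial>\<gamma>) = (\<integral>\<^sup>+x. f x \<partial>\<nu>)"
proof -
  have [measurable_cong]: "sets \<gamma> = sets borel" using couplingsD[OF assms(1)] by simp
  show ?thesis
    unfolding couplingsD(4)[OF assms(1), symmetric] using assms(2) by (subst nn_integral_distr) auto
qed

abbreviation coupling_cost :: "('a \<Rightarrow> 'a \<Rightarrow> real) \<Rightarrow> ('a \<times> 'a) measure \<Rightarrow> ennreal" where
  "coupling_cost k \<gamma> \<equiv> \<integral>\<^sup>+z. ennreal (k (fst z) (snd z)) \<partial>\<gamma>"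

lemma transport_cost_le_coupling:
  "\<gamma> \<in> couplings \<mu> \<nu> \<Longrightarrow> transport_cost k \<mu> \<nu> \<le> coupling_cost k \<gamma>"
  unfolding transport_cost_def split_beta by (rule INF_lower)

lemma transport_cost_lessD:
  "transport_cost k \<mu> \<nu> < a \<Longrightarrow> \<exists>\<gamma>\<in>couplings \<mu> \<nu>. coupling_cost k \<gamma> < a"
  unfolding transport_cost_def split_beta INF_less_iff .

text \<open>Takes the place of an optimal coupling; when the cost is infinite, every coupling
  qualifies.\<close>

lemma transport_cost_nearly_attained:
  fixes \<mu> \<nu> :: "'a::{metric_space, second_countable_topology} measure"
  assumes "\<mu> \<in> probs borel" "\<nu> \<in> probs borel" "0 < e"
  shows "\<exists>\<gamma>\<in>couplings \<mu> \<nu>. coupling_cost k \<gamma> \<le> transport_cost k \<mu> \<nu> + ennreal e"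
proof (cases "transport_cost k \<mu> \<nu> = \<infinity>")
  case True
  then show ?thesis using couplings_nonempty[OF assms(1,2)] by auto
next
  case False
  then have "transport_cost k \<mu> \<nu> < transport_cost k \<mu> \<nu> + ennreal e"
    using assms(3) by (cases "transport_cost k \<mu> \<nu>") (auto simp: ennreal_plus[symmetric] ennreal_less_iff simp del: ennreal_plus)
  from transport_cost_lessD[OF this] show ?thesis by (auto intro: less_imp_le)
qed

lemma transport_cost_le:
  fixes X Y :: "'w \<Rightarrow> 'a::{metric_space, second_countable_topology}"
  assumes k: "continuous_on UNIV (\<lambda>(x, y). k x y)"
    and \<Omega>: "prob_space \<Omega>" and [measurable]: "X \<in> borel_measurable \<Omega>" "Y \<in> borel_measurable \<Omega>"
  shows "transport_cost k (distr \<Omega> borel X) (distr \<Omega> borel Y) \<le> (\<integral>\<^sup>+\<omega>. ennreal (k (X \<omega>) (Y \<omega>)) \<partial>\<Omega>)"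
proof -
  have [measurable]: "(\<lambda>(x, y). k x y) \<in> borel_measurable borel" using k by (rule borel_measurable_continuous_onI)
  have "transport_cost k (distr \<Omega> borel X) (distr \<Omega> borel Y)
      \<le> (\<integral>\<^sup>+z. ennreal (case z of (x, y) \<Rightarrow> k x y) \<partial>distr \<Omega> borel (\<lambda>\<omega>. (X \<omega>, Y \<omega>)))"
    using transport_cost_le_coupling[OF coupling_distr[OF \<Omega> assms(3,4)], of k] by (simp add: split_beta)
  also have "\<dots> = (\<integral>\<^sup>+\<omega>. ennreal (k (X \<omega>) (Y \<omega>)) \<partial>\<Omega>)"
    by (subst nn_integral_distr) auto
  finally show ?thesis .
qed

text \<open>Transfers results on the second argument of the cost to the first.\<close>

lemma transport_cost_swap:
  fixes \<mu> \<nu> :: "'a::{metric_space, second_countable_topology} measure"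
  assumes k: "continuous_on UNIV (\<lambda>(x, y). k x y)"
  shows "transport_cost (\<lambda>x y. k y x) \<mu> \<nu> = transport_cost k \<nu> \<mu>"
proof -
  have le: "transport_cost (\<lambda>x y. k y x) \<mu> \<nu> \<le> transport_cost k \<nu> \<mu>"
    if k: "continuous_on UNIV (\<lambda>(x, y). k x y)" for \<mu> \<nu> :: "'a measure" and k :: "'a \<Rightarrow> 'a \<Rightarrow> real"
    unfolding transport_cost_def[of k]
  proof (rule INF_greatest)
    fix \<gamma> assume \<gamma>: "\<gamma> \<in> couplings \<nu> \<mu>"
    interpret prob_space \<gamma> using \<gamma> couplingsD by blast
    have [measurable_cong]: "sets \<gamma> = sets borel" using couplingsD[OF \<gamma>] by simp
    have "continuous_on UNIV (\<lambda>(x, y). k y x)"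
      using continuous_on_compose2[OF k continuous_on_swap, of UNIV] by (simp add: prod.swap_def split_beta)
    from transport_cost_le[OF this prob_space_axioms, of snd fst] show
      "transport_cost (\<lambda>x y. k y x) \<mu> \<nu> \<le> (\<integral>\<^sup>+ (x, y). ennreal (k x y) \<partial>\<gamma>)"
      using couplingsD(3,4)[OF \<gamma>] by (simp add: case_prod_beta')
  qed
  have k': "continuous_on UNIV (\<lambda>(x, y). k y x)"
    using continuous_on_compose2[OF k continuous_on_swap, of UNIV] by (simp add: prod.swap_def split_beta)
  show ?thesis using le[OF k, of \<mu> \<nu>] le[OF k', of \<nu> \<mu>] by simp
qed

section \<open>Semicontinuity of the transportation cost\<close>

text \<open>Supplies weights with compact sublevel sets on products, as
  \<open>skorohod_subsequence\<close> demands of \<open>w\<close>.\<close>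

lemma compact_sublevel_sum:
  fixes f :: "'a::metric_space \<Rightarrow> real" and g :: "'b::metric_space \<Rightarrow> real"
  assumes f: "continuous_on UNIV f" "\<And>x. 0 \<le> f x" "\<And>r. compact {x. f x \<le> r}"
    and g: "continuous_on UNIV g" "\<And>x. 0 \<le> g x" "\<And>r. compact {x. g x \<le> r}"
  shows "compact {z. f (fst z) + g (snd z) \<le> r}"
proof -
  have "continuous_on UNIV (\<lambda>z. f (fst z) + g (snd z))"
    by (intro continuous_intros continuous_on_compose2[OF f(1)] continuous_on_compose2[OF g(1)]) auto
  then have cl: "closed {z. f (fst z) + g (snd z) \<le> r}"
    by (intro closed_Collect_le continuous_on_const)
  have sub: "{z. f (fst z) + g (snd z) \<le> r} \<subseteq> {x. f x \<le> r} \<times> {x. g x \<le> r}"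
  proof
    fix z assume "z \<in> {z. f (fst z) + g (snd z) \<le> r}"
    then show "z \<in> {x. f x \<le> r} \<times> {x. g x \<le> r}"
      using f(2)[of "fst z"] g(2)[of "snd z"] by (auto simp: mem_Times_iff)
  qed
  have "compact (({x. f x \<le> r} \<times> {x. g x \<le> r}) \<inter> {z. f (fst z) + g (snd z) \<le> r})"
    by (intro compact_Int_closed compact_Times f(3) g(3) cl)
  then show ?thesis unfolding Int_absorb1[OF sub] .
qed

lemma nn_integral_distr_Fatou:
  fixes Z :: "nat \<Rightarrow> 'w \<Rightarrow> 'a::topological_space" and g :: "'a \<Rightarrow> real"
  assumes g: "continuous_on UNIV g"
    and [measurable]: "\<And>n. Z n \<in> borel_measurable \<Omega>" "Z' \<in> borel_measurable \<Omega>"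
    and lim: "AE x in \<Omega>. (\<lambda>n. Z n x) \<longlonglongrightarrow> Z' x"
  shows "(\<integral>\<^sup>+z. ennreal (g z) \<partial>distr \<Omega> borel Z') \<le> liminf (\<lambda>n. \<integral>\<^sup>+z. ennreal (g z) \<partial>distr \<Omega> borel (Z n))"
proof -
  have [measurable]: "g \<in> borel_measurable borel" using g by (rule borel_measurable_continuous_onI)
  have "(\<integral>\<^sup>+x. ennreal (g (Z' x)) \<partial>\<Omega>) = (\<integral>\<^sup>+x. liminf (\<lambda>n. ennreal (g (Z n x))) \<partial>\<Omega>)"
  proof (rule nn_integral_cong_AE)
    show "AE x in \<Omega>. ennreal (g (Z' x)) = liminf (\<lambda>n. ennreal (g (Z n x)))"
      using lim
    proof eventually_elim
      case (elim x)
      have "(\<lambda>n. g (Z n x)) \<longlonglongrightarrow> g (Z' x)"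
        by (rule continuous_on_tendsto_compose[OF g elim]) auto
      then have "(\<lambda>n. ennreal (g (Z n x))) \<longlonglongrightarrow> ennreal (g (Z' x))" by (rule tendsto_ennrealI)
      then show ?case by (simp add: lim_imp_Liminf)
    qed
  qed
  also have "\<dots> \<le> liminf (\<lambda>n. \<integral>\<^sup>+x. ennreal (g (Z n x)) \<partial>\<Omega>)"
    by (rule nn_integral_liminf) measurable
  finally show ?thesis by (simp add: nn_integral_distr)
qed

text \<open>Consistency enters as the vanishing of \<open>c\<close> exactly on the diagonal.
  \<open>B\<close> is positive because the estimates divide by it. As \<open>c\<close> may be
  asymmetric, several orientations of the growth bound are kept.\<close>

locale transport =
  fixes c :: "'a::{metric_space, second_countable_topology} \<Rightarrow> 'a \<Rightarrow> real" and x0 :: 'a and A B :: real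
  assumes c_nonneg: "0 \<le> c x y"
    and c_continuous: "continuous_on UNIV (\<lambda>(x, y). c x y)"
    and c_eq_0_iff: "c x y = 0 \<longleftrightarrow> x = y"
    and A_nonneg: "0 \<le> A" and B_pos: "0 < B"
    and growth_left: "c x y \<le> A + B * (c z x + c z y)"
    and growth_mid: "c x y \<le> A + B * (c x z + c z y)"
    and growth_right: "c x y \<le> A + B * (c x z + c y z)"
    and compact_sublevel: "compact {y. c x0 y \<le> r}"
begin

abbreviation J :: "'a measure \<Rightarrow> 'a measure \<Rightarrow> ennreal" where
  "J \<equiv> transport_cost c"

section \<open>Moments and the growth bound\<close>

definition moment :: "'a measure \<Rightarrow> ennreal" where
  "moment \<mu> = (\<integral>\<^sup>+x. ennreal (c x0 x) \<partial>\<mu>)"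

definition fin_moment :: "'a measure set" where
  "fin_moment = {\<mu> \<in> probs borel. moment \<mu> < \<infinity>}"

text \<open>\<open>enn2real\<close> turns an infinite moment into 0, so the value is meaningful on
  \<open>fin_moment\<close> only.\<close>

definition rmoment :: "'a measure \<Rightarrow> real" where
  "rmoment \<mu> = enn2real (moment \<mu>)"

lemma fin_momentD:
  "\<mu> \<in> fin_moment \<Longrightarrow> \<mu> \<in> probs borel" "\<mu> \<in> fin_moment \<Longrightarrow> moment \<mu> = ennreal (rmoment \<mu>)"
  by (auto simp: fin_moment_def rmoment_def)

lemma rmoment_nonneg: "0 \<le> rmoment \<mu>"
  by (simp add: rmoment_def)

lemma weight_continuous: "continuous_on UNIV (c x0)"
proof -
  have "continuous_on UNIV (\<lambda>y. (x0, y))" by (intro continuous_on_Pair continuous_on_const continuous_on_id)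
  from continuous_on_compose2[OF c_continuous this] show ?thesis by simp
qed

lemma weight_measurable[measurable]: "c x0 \<in> borel_measurable borel"
  using weight_continuous by (rule borel_measurable_continuous_onI)

lemma cost_continuous: "continuous_on UNIV (\<lambda>z. c (fst z) (snd z))"
  using c_continuous by (simp add: case_prod_beta')

lemma cost_measurable[measurable]: "(\<lambda>z. c (fst z) (snd z)) \<in> borel_measurable borel"
  using cost_continuous by (rule borel_measurable_continuous_onI)

definition pair_weight :: "'a \<times> 'a \<Rightarrow> real" where
  "pair_weight z = c x0 (fst z) + c x0 (snd z)"

lemma pair_weight_nonneg: "0 \<le> pair_weight z"
  using c_nonneg by (simp add: pair_weight_def)

lemma pair_weight_continuous: "continuous_on UNIV pair_weight"
  unfolding pair_weight_def[abs_def]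
  by (intro continuous_intros continuous_on_compose2[OF weight_continuous]) auto

lemma pair_weight_measurable[measurable]: "pair_weight \<in> borel_measurable borel"
  using pair_weight_continuous by (rule borel_measurable_continuous_onI)

lemma pair_weight_compact: "compact {x. pair_weight x \<le> r}"
  unfolding pair_weight_def
  by (rule compact_sublevel_sum) (use weight_continuous c_nonneg compact_sublevel in auto)

text \<open>Integrated growth bounds: the first goes from \<open>x0\<close> to the second point
  through the first, the other from \<open>x0\<close> to the first point through the second. The
  cost is read from the first point to the second in both, which calls for two orientations of the
  bound.\<close>

lemma moment_le_of_coupling:
  assumes \<gamma>: "\<gamma> \<in> couplings \<mu> \<nu>"
  shows "moment \<nu> \<le> ennreal A + ennreal B * (moment \<mu> + coupling_cost c \<gamma>)"
    and "moment \<mu> \<le> ennreal A + ennreal B * (moment \<nu> + coupling_cost c \<gamma>)"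
proof -
  interpret prob_space \<gamma> using couplingsD[OF \<gamma>] by simp
  have [measurable_cong]: "sets \<gamma> = sets borel" using couplingsD[OF \<gamma>] by simp
  have "moment \<nu> = (\<integral>\<^sup>+z. ennreal (c x0 (snd z)) \<partial>\<gamma>)"
    unfolding moment_def by (rule nn_integral_coupling_snd[OF \<gamma>, symmetric]) measurable
  also have "\<dots> \<le> (\<integral>\<^sup>+z. ennreal A + ennreal B * (ennreal (c x0 (fst z)) + ennreal (c (fst z) (snd z))) \<partial>\<gamma>)"
    using growth_mid A_nonneg B_pos c_nonneg
    by (intro nn_integral_mono) (simp add: ennreal_mult'[symmetric] ennreal_plus[symmetric] del: ennreal_plus)
  also have "\<dots> = ennreal A + ennreal B * ((\<integral>\<^sup>+z. ennreal (c x0 (fst z)) \<partial>\<gamma>) + coupling_cost c \<gamma>)"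
    by (simp add: nn_integral_add nn_integral_cmult emeasure_space_1)
  also have "(\<integral>\<^sup>+z. ennreal (c x0 (fst z)) \<partial>\<gamma>) = moment \<mu>"
    unfolding moment_def by (rule nn_integral_coupling_fst[OF \<gamma>]) measurable
  finally show "moment \<nu> \<le> ennreal A + ennreal B * (moment \<mu> + coupling_cost c \<gamma>)" .
  have "moment \<mu> = (\<integral>\<^sup>+z. ennreal (c x0 (fst z)) \<partial>\<gamma>)"
    unfolding moment_def by (rule nn_integral_coupling_fst[OF \<gamma>, symmetric]) measurable
  also have "\<dots> \<le> (\<integral>\<^sup>+z. ennreal A + ennreal B * (ennreal (c x0 (snd z)) + ennreal (c (fst z) (snd z))) \<partial>\<gamma>)"
    using growth_right A_nonneg B_pos c_nonneg
    by (intro nn_integral_mono) (simp add: ennreal_mult'[symmetric] ennreal_plus[symmetric] del: ennreal_plus)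
  also have "\<dots> = ennreal A + ennreal B * ((\<integral>\<^sup>+z. ennreal (c x0 (snd z)) \<partial>\<gamma>) + coupling_cost c \<gamma>)"
    by (simp add: nn_integral_add nn_integral_cmult emeasure_space_1)
  also have "(\<integral>\<^sup>+z. ennreal (c x0 (snd z)) \<partial>\<gamma>) = moment \<nu>"
    unfolding moment_def by (rule nn_integral_coupling_snd[OF \<gamma>]) measurable
  finally show "moment \<mu> \<le> ennreal A + ennreal B * (moment \<nu> + coupling_cost c \<gamma>)" .
qed

lemma affine_INF:
  fixes f :: "'i \<Rightarrow> ennreal"
  assumes "S \<noteq> {}" "\<And>i. i \<in> S \<Longrightarrow> a \<le> ennreal A + ennreal B * (b + f i)"
  shows "a \<le> ennreal A + ennreal B * (b + (INF i\<in>S. f i))"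
proof (cases "(INF i\<in>S. f i) = \<infinity>")
  case False
  have eps: "a \<le> ennreal A + ennreal B * (b + (INF i\<in>S. f i)) + ennreal e" if "0 < e" for e
  proof -
    have "(INF i\<in>S. f i) < (INF i\<in>S. f i) + ennreal (e / B)"
      using False that B_pos by (cases "INF i\<in>S. f i") (auto simp: ennreal_plus[symmetric] ennreal_less_iff simp del: ennreal_plus)
    then obtain i where i: "i \<in> S" "f i < (INF i\<in>S. f i) + ennreal (e / B)" by (auto simp: INF_less_iff)
    have "a \<le> ennreal A + ennreal B * (b + f i)" using assms i by simp
    also have "\<dots> \<le> ennreal A + ennreal B * (b + ((INF i\<in>S. f i) + ennreal (e / B)))"
      using i by (intro add_left_mono mult_left_mono) auto
    also have "\<dots> = ennreal A + ennreal B * (b + (INF i\<in>S. f i)) + ennreal e"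
      using B_pos that by (simp add: distrib_left add.assoc ennreal_mult[symmetric])
    finally show ?thesis .
  qed
  show ?thesis by (rule ennreal_le_epsilon, rule eps)
qed (use B_pos in \<open>simp add: ennreal_mult_top\<close>)

lemma moment_le:
  assumes "\<mu> \<in> probs borel" "\<nu> \<in> probs borel"
  shows "moment \<nu> \<le> ennreal A + ennreal B * (moment \<mu> + J \<mu> \<nu>)"
    and "moment \<mu> \<le> ennreal A + ennreal B * (moment \<nu> + J \<mu> \<nu>)"
  unfolding transport_cost_def[of c \<mu> \<nu>] case_prod_beta'
  using moment_le_of_coupling by (auto intro!: affine_INF couplings_nonempty[OF assms])

text \<open>So measures of finite and of infinite moment have infinite cost to each other, which
  makes \<open>fin_moment\<close> clopen in \<open>tau_J\<close>.\<close>

lemma fin_moment_if_cost_finite: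
  assumes "\<mu> \<in> probs borel" "\<nu> \<in> probs borel" "J \<mu> \<nu> < \<infinity>"
  shows "\<mu> \<in> fin_moment \<longleftrightarrow> \<nu> \<in> fin_moment"
proof -
  have "ennreal A + ennreal B * (m + J \<mu> \<nu>) < \<infinity>" if "m < \<infinity>" for m
    using that assms(3) by (auto simp: ennreal_mult_less_top)
  then show ?thesis
    using moment_le[OF assms(1,2)] assms(1,2) by (auto simp: fin_moment_def intro: le_less_trans)
qed

lemma cost_le_weights: "c x y \<le> A + B * (c x0 x + c x0 y)"
  by (rule growth_left)

lemma nn_integral_weights:
  assumes \<gamma>: "\<gamma> \<in> couplings \<mu> \<nu>" and "\<mu> \<in> fin_moment" "\<nu> \<in> fin_moment" and "0 \<le> a" "0 \<le> b"
  shows "(\<integral>\<^sup>+z. ennreal (a + b * (c x0 (fst z) + c x0 (snd z))) \<partial>\<gamma>) = ennreal (a + b * (rmoment \<mu> + rmoment \<nu>))"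
proof -
  interpret prob_space \<gamma> using couplingsD[OF \<gamma>] by simp
  have [measurable_cong]: "sets \<gamma> = sets borel" using couplingsD[OF \<gamma>] by simp
  have "(\<integral>\<^sup>+z. ennreal (a + b * (c x0 (fst z) + c x0 (snd z))) \<partial>\<gamma>)
      = (\<integral>\<^sup>+z. ennreal a + ennreal b * (ennreal (c x0 (fst z)) + ennreal (c x0 (snd z))) \<partial>\<gamma>)"
    using assms c_nonneg by (intro nn_integral_cong) (simp add: ennreal_mult)
  also have "\<dots> = ennreal a + ennreal b * ((\<integral>\<^sup>+z. ennreal (c x0 (fst z)) \<partial>\<gamma>) + (\<integral>\<^sup>+z. ennreal (c x0 (snd z)) \<partial>\<gamma>))"
    by (simp add: nn_integral_add nn_integral_cmult emeasure_space_1)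
  also have "(\<integral>\<^sup>+z. ennreal (c x0 (fst z)) \<partial>\<gamma>) = ennreal (rmoment \<mu>)"
    using nn_integral_coupling_fst[OF \<gamma>, of "\<lambda>x. ennreal (c x0 x)"] fin_momentD(2)[OF assms(2)] by (simp add: moment_def)
  also have "(\<integral>\<^sup>+z. ennreal (c x0 (snd z)) \<partial>\<gamma>) = ennreal (rmoment \<nu>)"
    using nn_integral_coupling_snd[OF \<gamma>, of "\<lambda>x. ennreal (c x0 x)"] fin_momentD(2)[OF assms(3)] by (simp add: moment_def)
  also have "ennreal a + ennreal b * (ennreal (rmoment \<mu>) + ennreal (rmoment \<nu>)) = ennreal (a + b * (rmoment \<mu> + rmoment \<nu>))"
    using assms rmoment_nonneg by (simp add: ennreal_mult)
  finally show ?thesis .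
qed

text \<open>Bounded moments give tightness, since the sublevel sets of \<open>c x0\<close> are
  compact. Fatou's lemma yields only an inequality between moments; the gap between
  \<open>rmoment \<nu>'\<close> and \<open>m\<close> is the moment that escapes.\<close>

lemma weak_compactness:
  assumes \<nu>: "\<And>n. \<nu> n \<in> fin_moment" and bound: "\<And>n. rmoment (\<nu> n) \<le> C"
  obtains r :: "nat \<Rightarrow> nat" and \<nu>' m where "strict_mono r" "\<nu>' \<in> fin_moment"
    "weakly_converges (\<lambda>n. \<nu> (r n)) \<nu>'" "(\<lambda>n. rmoment (\<nu> (r n))) \<longlonglongrightarrow> m" "rmoment \<nu>' \<le> m"
proof -
  have "\<forall>n. rmoment (\<nu> n) \<in> {0..C}" using bound rmoment_nonneg by auto
  then obtain m r1 where r1: "strict_mono (r1 :: nat \<Rightarrow> nat)" "((\<lambda>n. rmoment (\<nu> n)) \<circ> r1) \<longlonglongrightarrow> m"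
    using compact_Icc[of 0 C] unfolding compact_eq_seq_compact_metric seq_compact_def by metis
  have p: "\<nu> (r1 n) \<in> probs borel" for n using \<nu> fin_momentD by blast
  have b: "(\<integral>\<^sup>+x. ennreal (c x0 x) \<partial>\<nu> (r1 n)) \<le> ennreal C" for n
    using fin_momentD(2)[OF \<nu>[of "r1 n"]] bound[of "r1 n"] by (simp add: moment_def ennreal_leI)
  obtain r2 :: "nat \<Rightarrow> nat" and \<Omega> :: "real measure" and Z Z' where Z: "strict_mono r2" "prob_space \<Omega>"
    "\<And>n. Z n \<in> borel_measurable \<Omega>" "Z' \<in> borel_measurable \<Omega>"
    "\<And>n. distr \<Omega> borel (Z n) = \<nu> (r1 (r2 n))" "AE x in \<Omega>. (\<lambda>n. Z n x) \<longlonglongrightarrow> Z' x"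
    by (rule skorohod_subsequence[of "\<lambda>n. \<nu> (r1 n)" "c x0" C,
          OF p weight_measurable compact_sublevel c_nonneg b], rule that)
  define r where "r n = r1 (r2 n)" for n
  have r: "strict_mono r" using r1(1) Z(1) by (auto simp: r_def strict_mono_def)
  have m: "(\<lambda>n. rmoment (\<nu> (r n))) \<longlonglongrightarrow> m"
    using LIMSEQ_subseq_LIMSEQ[OF r1(2) Z(1)] by (simp add: r_def comp_def)
  have "m \<ge> 0" by (rule LIMSEQ_le_const[OF m]) (auto simp: rmoment_nonneg)
  define \<nu>' where "\<nu>' = distr \<Omega> borel Z'"
  have "moment \<nu>' \<le> liminf (\<lambda>n. moment (\<nu> (r n)))"
    using nn_integral_distr_Fatou[OF weight_continuous Z(3,4,6)] by (simp add: Z(5) moment_def \<nu>'_def r_def)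
  also have "(\<lambda>n. moment (\<nu> (r n))) = (\<lambda>n. ennreal (rmoment (\<nu> (r n))))"
    using fin_momentD(2)[OF \<nu>] by simp
  also have "liminf \<dots> = ennreal m"
    using tendsto_ennrealI[OF m] by (simp add: lim_imp_Liminf)
  finally have le: "moment \<nu>' \<le> ennreal m" .
  have "\<nu>' \<in> probs borel" unfolding \<nu>'_def using Z by (intro probs_distr) auto
  then have fin: "\<nu>' \<in> fin_moment" using le by (auto simp: fin_moment_def intro: le_less_trans)
  show ?thesis
  proof
    show "strict_mono r" "\<nu>' \<in> fin_moment" "(\<lambda>n. rmoment (\<nu> (r n))) \<longlonglongrightarrow> m" by fact+
    show "weakly_converges (\<lambda>n. \<nu> (r n)) \<nu>'"
      using weakly_converges_distr[OF Z(2-4,6)] by (simp add: Z(5) \<nu>'_def r_def)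
    show "rmoment \<nu>' \<le> m" using le fin_momentD(2)[OF fin] \<open>m \<ge> 0\<close> by simp
  qed
qed

text \<open>By the growth condition \<open>c x y + c x0 x + A / B - c x0 y / B\<close> is nonnegative, and Fatou's
  lemma for this function accounts for the moment that is lost in the weak limit.\<close>

lemma transport_cost_lower_limit:
  assumes \<mu>: "\<mu> \<in> fin_moment" and \<nu>: "\<And>n. \<nu> n \<in> fin_moment" and \<nu>': "\<nu>' \<in> fin_moment"
    and weak: "weakly_converges \<nu> \<nu>'" and m: "(\<lambda>n. rmoment (\<nu> n)) \<longlonglongrightarrow> m" and le: "rmoment \<nu>' \<le> m"
  obtains \<gamma> where "\<gamma> \<in> couplings \<mu> \<nu>'"
    "coupling_cost c \<gamma> + ennreal ((m - rmoment \<nu>') / B) \<le> liminf (\<lambda>n. J \<mu> (\<nu> n))"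
proof (cases "liminf (\<lambda>n. J \<mu> (\<nu> n)) = \<infinity>")
  case True
  then show ?thesis using couplings_nonempty fin_momentD(1)[OF \<mu>] fin_momentD(1)[OF \<nu>'] that by force
next
  case False
  define l where "l = liminf (\<lambda>n. J \<mu> (\<nu> n))"
  obtain r where r: "strict_mono r" "((\<lambda>n. J \<mu> (\<nu> n)) \<circ> r) \<longlonglongrightarrow> l"
    using liminf_subseq_lim[of "\<lambda>n. J \<mu> (\<nu> n)"] unfolding l_def by blast
  have "\<forall>n. \<exists>\<gamma>\<in>couplings \<mu> (\<nu> (r n)). coupling_cost c \<gamma> \<le> J \<mu> (\<nu> (r n)) + ennreal (1 / Suc n)"
    by (intro allI transport_cost_nearly_attained fin_momentD(1) \<mu> \<nu>) simp
  then obtain \<gamma> where \<gamma>: "\<And>n. \<gamma> n \<in> couplings \<mu> (\<nu> (r n))"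
    "\<And>n. coupling_cost c (\<gamma> n) \<le> J \<mu> (\<nu> (r n)) + ennreal (1 / Suc n)" by metis
  obtain C where C: "\<And>n. rmoment (\<nu> n) \<le> C"
    using convergent_imp_bounded_above[OF m] by blast
  have \<gamma>_probs: "\<gamma> n \<in> probs borel" for n using couplingsD[OF \<gamma>(1)] by (simp add: probs_iff)
  \<comment> \<open>Bounded marginal moments make the near-optimal couplings tight, so they have a
    convergent representation along a subsequence.\<close>
  have w2_bound: "(\<integral>\<^sup>+z. ennreal (pair_weight z) \<partial>\<gamma> n) \<le> ennreal (rmoment \<mu> + C)" for n
    using nn_integral_weights[OF \<gamma>(1) \<mu> \<nu>, of 0 1 n] C[of "r n"] by (simp add: pair_weight_def ennreal_leI)
  obtain q :: "nat \<Rightarrow> nat" and \<Omega> :: "real measure" and Z Z' where Z: "strict_mono q" "prob_space \<Omega>"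
    "\<And>n. Z n \<in> borel_measurable \<Omega>" "Z' \<in> borel_measurable \<Omega>"
    "\<And>n. distr \<Omega> borel (Z n) = \<gamma> (q n)" "AE x in \<Omega>. (\<lambda>n. Z n x) \<longlonglongrightarrow> Z' x"
    by (rule skorohod_subsequence[of \<gamma> pair_weight "rmoment \<mu> + C",
          OF \<gamma>_probs pair_weight_measurable pair_weight_compact pair_weight_nonneg w2_bound], rule that)
  note [measurable] = Z(3,4)
  define N where "N n = \<nu> (r (q n))" for n
  have rq: "strict_mono (\<lambda>n. r (q n))" using r(1) Z(1) by (auto simp: strict_mono_def)
  have N_fin: "N n \<in> fin_moment" for n using \<nu> by (simp add: N_def)
  have N_m: "(\<lambda>n. rmoment (N n)) \<longlonglongrightarrow> m" using LIMSEQ_subseq_LIMSEQ[OF m rq] by (simp add: N_def comp_def)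
  have dfst: "distr \<Omega> borel (\<lambda>x. fst (Z n x)) = \<mu>" for n
    using couplingsD(3)[OF \<gamma>(1)[of "q n"]] distr_distr[of fst borel borel "Z n" \<Omega>] by (simp add: Z(5) comp_def)
  have dsnd: "distr \<Omega> borel (\<lambda>x. snd (Z n x)) = N n" for n
    using couplingsD(4)[OF \<gamma>(1)[of "q n"]] distr_distr[of snd borel borel "Z n" \<Omega>] by (simp add: Z(5) comp_def N_def)
  have "distr \<Omega> borel (\<lambda>x. fst (Z' x)) = \<mu>"
  proof (rule distr_AE_limit[OF Z(2)])
    show "AE x in \<Omega>. (\<lambda>n. fst (Z n x)) \<longlonglongrightarrow> fst (Z' x)"
      using Z(6) by eventually_elim (rule tendsto_fst)
  qed (auto simp: dfst weakly_converges_const fin_momentD(1)[OF \<mu>])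
  moreover have "distr \<Omega> borel (\<lambda>x. snd (Z' x)) = \<nu>'"
  proof (rule distr_AE_limit[OF Z(2)])
    show "AE x in \<Omega>. (\<lambda>n. snd (Z n x)) \<longlonglongrightarrow> snd (Z' x)"
      using Z(6) by eventually_elim (rule tendsto_snd)
    show "weakly_converges (\<lambda>n. distr \<Omega> borel (\<lambda>x. snd (Z n x))) \<nu>'"
      unfolding dsnd N_def by (rule weakly_converges_subseq[OF weak rq])
  qed (auto simp: fin_momentD(1)[OF \<nu>'])
  ultimately have \<gamma>': "distr \<Omega> borel Z' \<in> couplings \<mu> \<nu>'"
    using coupling_distr[OF Z(2), of "\<lambda>x. fst (Z' x)" "\<lambda>x. snd (Z' x)"] by simp
  define g where "g z = c (fst z) (snd z) + c x0 (fst z) + A / B - c x0 (snd z) / B" for z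
  have g_cont: "continuous_on UNIV g"
    unfolding g_def[abs_def]
    by (intro continuous_intros cost_continuous continuous_on_compose2[OF weight_continuous]) (use B_pos in auto)
  have [measurable]: "g \<in> borel_measurable borel" using g_cont by (rule borel_measurable_continuous_onI)
  have g_nonneg: "0 \<le> g z" for z
  proof -
    have "c x0 (snd z) / B \<le> (A + B * (c x0 (fst z) + c (fst z) (snd z))) / B"
      using growth_mid[of x0 "snd z" "fst z"] B_pos by (intro divide_right_mono) auto
    then show ?thesis using B_pos by (simp add: g_def add_divide_distrib)
  qed
  define b where "b = ennreal (rmoment \<mu> + A / B)"
  \<comment> \<open>Stated with sums because subtraction in \<open>ennreal\<close> truncates at 0.
    It exchanges the integral of \<open>g\<close> and the moment of the second marginal for the cost
    and the constant \<open>b\<close>.\<close>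
  have ident: "(\<integral>\<^sup>+z. ennreal (g z) \<partial>\<sigma>) + ennreal (rmoment \<eta> / B) = coupling_cost c \<sigma> + b"
    if \<sigma>: "\<sigma> \<in> couplings \<mu> \<eta>" and \<eta>: "\<eta> \<in> fin_moment" for \<sigma> \<eta>
  proof -
    interpret prob_space \<sigma> using couplingsD[OF \<sigma>] by simp
    have [measurable_cong]: "sets \<sigma> = sets borel" using couplingsD[OF \<sigma>] by simp
    have 1: "(\<integral>\<^sup>+z. ennreal (c x0 (snd z) / B) \<partial>\<sigma>) = ennreal (rmoment \<eta> / B)"
    proof -
      have "(\<integral>\<^sup>+z. ennreal (c x0 (snd z) / B) \<partial>\<sigma>) = (\<integral>\<^sup>+z. ennreal (c x0 (snd z)) \<partial>\<sigma>) / ennreal B"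
        using B_pos c_nonneg by (subst nn_integral_divide[symmetric]) (auto simp: divide_ennreal)
      also have "(\<integral>\<^sup>+z. ennreal (c x0 (snd z)) \<partial>\<sigma>) = ennreal (rmoment \<eta>)"
        using nn_integral_coupling_snd[OF \<sigma>, of "\<lambda>x. ennreal (c x0 x)"] fin_momentD(2)[OF \<eta>] by (simp add: moment_def)
      finally show ?thesis using B_pos rmoment_nonneg by (simp add: divide_ennreal)
    qed
    have 2: "(\<integral>\<^sup>+z. ennreal (c x0 (fst z) + A / B) \<partial>\<sigma>) = b"
    proof -
      have "(\<integral>\<^sup>+z. ennreal (c x0 (fst z) + A / B) \<partial>\<sigma>) = (\<integral>\<^sup>+z. ennreal (c x0 (fst z)) + ennreal (A / B) \<partial>\<sigma>)"
        using A_nonneg B_pos c_nonneg by (intro nn_integral_cong) simp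
      also have "\<dots> = (\<integral>\<^sup>+z. ennreal (c x0 (fst z)) \<partial>\<sigma>) + ennreal (A / B)"
        by (simp add: nn_integral_add emeasure_space_1)
      also have "(\<integral>\<^sup>+z. ennreal (c x0 (fst z)) \<partial>\<sigma>) = ennreal (rmoment \<mu>)"
        using nn_integral_coupling_fst[OF \<sigma>, of "\<lambda>x. ennreal (c x0 x)"] fin_momentD(2)[OF \<mu>] by (simp add: moment_def)
      finally show ?thesis using A_nonneg B_pos rmoment_nonneg by (simp add: b_def)
    qed
    have "(\<integral>\<^sup>+z. ennreal (g z) \<partial>\<sigma>) + (\<integral>\<^sup>+z. ennreal (c x0 (snd z) / B) \<partial>\<sigma>)
        = (\<integral>\<^sup>+z. ennreal (g z) + ennreal (c x0 (snd z) / B) \<partial>\<sigma>)"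
      by (rule nn_integral_add[symmetric]) measurable
    also have "\<dots> = (\<integral>\<^sup>+z. ennreal (c (fst z) (snd z)) + ennreal (c x0 (fst z) + A / B) \<partial>\<sigma>)"
      using g_nonneg c_nonneg A_nonneg B_pos
      by (intro nn_integral_cong) (simp add: ennreal_plus[symmetric] g_def del: ennreal_plus)
    also have "\<dots> = coupling_cost c \<sigma> + (\<integral>\<^sup>+z. ennreal (c x0 (fst z) + A / B) \<partial>\<sigma>)"
      by (rule nn_integral_add) measurable
    finally show ?thesis unfolding 1 2 .
  qed
  define K where "K n = coupling_cost c (\<gamma> (q n))" for n
  define I where "I n = (\<integral>\<^sup>+z. ennreal (g z) \<partial>\<gamma> (q n))" for n
  have IK: "I n + ennreal (rmoment (N n) / B) = K n + b" for n
    using ident[OF \<gamma>(1)[of "q n"] \<nu>] by (simp add: I_def K_def N_def)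
  have Jl: "(\<lambda>n. J \<mu> (N n)) \<longlonglongrightarrow> l"
    using LIMSEQ_subseq_LIMSEQ[OF r(2) Z(1)] by (simp add: N_def comp_def)
  have K_lim: "K \<longlonglongrightarrow> l"
  proof (rule tendsto_sandwich)
    show "\<forall>\<^sub>F n in sequentially. J \<mu> (N n) \<le> K n"
      unfolding K_def N_def by (intro always_eventually allI transport_cost_le_coupling \<gamma>(1))
    show "\<forall>\<^sub>F n in sequentially. K n \<le> J \<mu> (N n) + ennreal (1 / Suc (q n))"
      unfolding K_def N_def by (intro always_eventually allI \<gamma>(2))
    have "(\<lambda>n. 1 / real (Suc n)) \<longlonglongrightarrow> 0" by (rule LIMSEQ_Suc[OF lim_1_over_n])
    from LIMSEQ_subseq_LIMSEQ[OF this Z(1)] have "(\<lambda>n. ennreal (1 / Suc (q n))) \<longlonglongrightarrow> ennreal 0"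
      unfolding comp_def by (rule tendsto_ennrealI)
    from tendsto_add[OF Jl this] show "(\<lambda>n. J \<mu> (N n) + ennreal (1 / Suc (q n))) \<longlonglongrightarrow> l" by simp
  qed (rule Jl)
  have M_lim: "(\<lambda>n. ennreal (rmoment (N n) / B)) \<longlonglongrightarrow> ennreal (m / B)"
    by (intro tendsto_ennrealI tendsto_divide N_m tendsto_const) (use B_pos in auto)
  have Kb: "(\<lambda>n. K n + b) \<longlonglongrightarrow> l + b" by (intro tendsto_add K_lim tendsto_const)
  have "I = (\<lambda>n. (K n + b) - ennreal (rmoment (N n) / B))"
    by (simp add: IK[symmetric])
  moreover have "(\<lambda>n. (K n + b) - ennreal (rmoment (N n) / B)) \<longlonglongrightarrow> (l + b) - ennreal (m / B)"
    by (rule tendsto_diff_ennreal[OF Kb M_lim]) (use False in \<open>auto simp: l_def b_def\<close>)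
  ultimately have "liminf I = (l + b) - ennreal (m / B)" by (simp add: lim_imp_Liminf)
  moreover have "(\<integral>\<^sup>+z. ennreal (g z) \<partial>distr \<Omega> borel Z') \<le> liminf I"
    using nn_integral_distr_Fatou[OF g_cont Z(3,4,6)] by (simp add: Z(5) I_def[abs_def])
  ultimately have I': "(\<integral>\<^sup>+z. ennreal (g z) \<partial>distr \<Omega> borel Z') \<le> (l + b) - ennreal (m / B)" by simp
  \<comment> \<open>Ensures that adding \<open>ennreal (m / B)\<close> undoes the truncated
    subtraction in \<open>I'\<close>.\<close>
  have mb: "ennreal (m / B) \<le> l + b"
  proof (rule LIMSEQ_le[OF M_lim Kb], intro exI allI impI)
    show "ennreal (rmoment (N n) / B) \<le> K n + b" for n
      unfolding IK[symmetric] by (rule add_increasing) simp_all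
  qed
  define K' where "K' = coupling_cost c (distr \<Omega> borel Z')"
  have mm: "ennreal (m / B) = ennreal ((m - rmoment \<nu>') / B) + ennreal (rmoment \<nu>' / B)"
    using le rmoment_nonneg[of \<nu>'] B_pos by (subst ennreal_plus[symmetric]) (auto simp: field_simps)
  \<comment> \<open>Fatou's bound with everything moved into sums; the finite term
    \<open>b + ennreal (rmoment \<nu>' / B)\<close> then cancels.\<close>
  have "(b + ennreal (rmoment \<nu>' / B)) + (K' + ennreal ((m - rmoment \<nu>') / B)) = (K' + b) + ennreal (m / B)"
    unfolding mm by (simp add: ac_simps)
  also have "\<dots> = (\<integral>\<^sup>+z. ennreal (g z) \<partial>distr \<Omega> borel Z') + ennreal (m / B) + ennreal (rmoment \<nu>' / B)"
    unfolding K'_def ident[OF \<gamma>' \<nu>', symmetric] by (simp add: ac_simps)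
  also have "\<dots> \<le> ((l + b) - ennreal (m / B)) + ennreal (m / B) + ennreal (rmoment \<nu>' / B)"
    using I' by (intro add_right_mono)
  also have "\<dots> = (b + ennreal (rmoment \<nu>' / B)) + l"
    using mb by (simp add: diff_add_cancel_ennreal ac_simps)
  finally have "K' + ennreal ((m - rmoment \<nu>') / B) \<le> l"
    by (simp add: ennreal_add_left_cancel_le b_def)
  then show ?thesis using that[OF \<gamma>'] by (simp add: K'_def l_def)
qed

text \<open>A coupling of \<open>\<mu>\<close> and \<open>\<nu>'\<close> with cost below
  \<open>a\<close> has to be moved to couplings with the approximating measures. It is glued
  approximately to a Skorohod representation of these; a second representation, of the glued
  triples, turns the approximate match into an exact one in the limit. Fatou's lemma for
  \<open>h\<close>, the gap between \<open>k\<close> and its bound by weights, becomes an upper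
  bound for the costs because the moments converge. The cost \<open>k\<close> is general so that
  \<open>c\<close> with exchanged arguments is covered.\<close>

lemma transport_cost_upper_limit:
  fixes k :: "'a \<Rightarrow> 'a \<Rightarrow> real"
  assumes k_cont: "continuous_on UNIV (\<lambda>(x, y). k x y)" and k_nonneg: "\<And>x y. 0 \<le> k x y"
    and k_le: "\<And>x y. k x y \<le> A + B * (c x0 x + c x0 y)"
    and \<mu>: "\<mu> \<in> fin_moment" and \<nu>: "\<And>n. \<nu> n \<in> fin_moment" and \<nu>': "\<nu>' \<in> fin_moment"
    and weak: "weakly_converges \<nu> \<nu>'" and m: "(\<lambda>n. rmoment (\<nu> n)) \<longlonglongrightarrow> rmoment \<nu>'"
    and less: "transport_cost k \<mu> \<nu>' < a"
  shows "\<forall>\<^sub>F n in sequentially. transport_cost k \<mu> (\<nu> n) < a"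
proof (rule ccontr)
  assume "\<not> (\<forall>\<^sub>F n in sequentially. transport_cost k \<mu> (\<nu> n) < a)"
  then obtain r1 :: "nat \<Rightarrow> nat" where r1: "strict_mono r1" "\<And>n. \<not> transport_cost k \<mu> (\<nu> (r1 n)) < a"
    using not_eventually_sequentiallyD by blast
  obtain C where C: "\<And>n. rmoment (\<nu> n) \<le> C"
    using convergent_imp_bounded_above[OF m] by blast
  have p: "\<nu> (r1 n) \<in> probs borel" for n using \<nu> fin_momentD by blast
  have b: "(\<integral>\<^sup>+x. ennreal (c x0 x) \<partial>\<nu> (r1 n)) \<le> ennreal C" for n
    using fin_momentD(2)[OF \<nu>[of "r1 n"]] C[of "r1 n"] by (simp add: moment_def ennreal_leI)
  obtain r2 :: "nat \<Rightarrow> nat" and \<Omega> :: "real measure" and Z Z' where Z: "strict_mono r2" "prob_space \<Omega>"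
    "\<And>n. Z n \<in> borel_measurable \<Omega>" "Z' \<in> borel_measurable \<Omega>"
    "\<And>n. distr \<Omega> borel (Z n) = \<nu> (r1 (r2 n))" "AE x in \<Omega>. (\<lambda>n. Z n x) \<longlonglongrightarrow> Z' x"
    by (rule skorohod_subsequence[of "\<lambda>n. \<nu> (r1 n)" "c x0" C,
          OF p weight_measurable compact_sublevel c_nonneg b], rule that)
  note [measurable] = Z(3,4)
  have r12: "strict_mono (\<lambda>n. r1 (r2 n))" using r1(1) Z(1) by (auto simp: strict_mono_def)
  have Z'_law: "distr \<Omega> borel Z' = \<nu>'"
  proof (rule distr_AE_limit[OF Z(2-4,6)])
    show "weakly_converges (\<lambda>n. distr \<Omega> borel (Z n)) \<nu>'"
      unfolding Z(5) by (rule weakly_converges_subseq[OF weak r12])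
  qed (rule fin_momentD(1)[OF \<nu>'])
  obtain \<gamma> where \<gamma>: "\<gamma> \<in> couplings \<mu> \<nu>'" "coupling_cost k \<gamma> < a"
    using transport_cost_lessD[OF less] by blast
  note \<gamma>D = couplingsD[OF \<gamma>(1)]
  interpret \<gamma>: prob_space \<gamma> by (rule \<gamma>D(1))
  interpret \<Omega>: prob_space \<Omega> by (rule Z(2))
  have \<gamma>_sets[measurable_cong]: "sets \<gamma> = sets borel" by (rule \<gamma>D(2))
  have "\<exists>K. prob_space K \<and> sets K = sets (\<gamma> \<Otimes>\<^sub>M \<Omega>) \<and> distr K \<gamma> fst = \<gamma> \<and> distr K \<Omega> snd = \<Omega> \<and>
      (AE z in K. dist (snd (fst z)) (Z' (snd z)) < 1 / Suc n)" for n
  proof -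
    have snd: "snd \<in> borel_measurable \<gamma>" by measurable
    have law: "distr \<gamma> borel snd = distr \<Omega> borel Z'" by (simp add: Z'_law \<gamma>D(4))
    have pos: "0 < 1 / real (Suc n)" by simp
    show ?thesis
      by (rule approximate_gluing[OF \<gamma>D(1) Z(2) snd Z(4) law pos]) blast
  qed
  then have "\<exists>K. \<forall>n. prob_space (K n) \<and> sets (K n) = sets (\<gamma> \<Otimes>\<^sub>M \<Omega>) \<and> distr (K n) \<gamma> fst = \<gamma> \<and>
      distr (K n) \<Omega> snd = \<Omega> \<and> (AE z in K n. dist (snd (fst z)) (Z' (snd z)) < 1 / Suc n)"
    by (intro choice allI)
  then obtain K where K: "\<And>n. prob_space (K n)" "\<And>n. sets (K n) = sets (\<gamma> \<Otimes>\<^sub>M \<Omega>)"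
    "\<And>n. distr (K n) \<gamma> fst = \<gamma>" "\<And>n. distr (K n) \<Omega> snd = \<Omega>"
    "\<And>n. AE z in K n. dist (snd (fst z)) (Z' (snd z)) < 1 / Suc n" by blast
  note [measurable_cong] = K(2)
  \<comment> \<open>A triple: a pair distributed as \<open>\<gamma>\<close>, and a point distributed
    as an approximating measure that is to replace the second entry of the pair.\<close>
  define T where "T n z = (fst z, Z n (snd z))" for n and z :: "('a \<times> 'a) \<times> real"
  have fst_meas[measurable]: "fst \<in> measurable (\<gamma> \<Otimes>\<^sub>M \<Omega>) (borel :: ('a \<times> 'a) measure)"
    using measurable_fst[of \<gamma> \<Omega>] measurable_cong_sets[OF refl \<gamma>_sets] by blast
  have T_meas[measurable]: "T n \<in> borel_measurable (K n)" for n
    unfolding T_def[abs_def] borel_prod[symmetric, where ?'a = "'a \<times> 'a" and ?'b = 'a] by measurable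
  define \<rho> where "\<rho> n = distr (K n) borel (T n)" for n
  have \<rho>_probs: "\<rho> n \<in> probs borel" for n
    unfolding \<rho>_def by (rule probs_distr[OF K(1)]) measurable
  have \<rho>_fst: "distr (\<rho> n) borel fst = \<gamma>" for n
  proof -
    have "distr (\<rho> n) borel fst = distr (K n) borel (\<lambda>z. fst z)"
      unfolding \<rho>_def by (subst distr_distr) (auto simp: comp_def T_def)
    also have "\<dots> = distr (K n) \<gamma> fst" by (rule distr_cong) (simp_all add: \<gamma>_sets)
    finally show ?thesis by (simp add: K(3))
  qed
  have \<rho>_snd: "distr (\<rho> n) borel snd = \<nu> (r1 (r2 n))" for n
  proof -
    have "distr (\<rho> n) borel snd = distr (K n) borel (\<lambda>z. Z n (snd z))"
      unfolding \<rho>_def by (subst distr_distr) (auto simp: comp_def T_def)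
    also have "\<dots> = distr (distr (K n) \<Omega> snd) borel (Z n)"
      by (subst distr_distr) (auto simp: comp_def)
    finally show ?thesis by (simp add: K(4) Z(5))
  qed
  have \<rho>_sets[measurable_cong]: "sets (\<rho> n) = sets borel" for n by (simp add: \<rho>_def)
  define w3 where "w3 = (\<lambda>z. pair_weight (fst z) + c x0 (snd z))"
  have w3_cont: "continuous_on UNIV w3"
    unfolding w3_def
    by (intro continuous_intros continuous_on_compose2[OF weight_continuous] continuous_on_compose2[OF pair_weight_continuous]) auto
  have w3_compact: "compact {x. w3 x \<le> r}" for r
    unfolding w3_def by (rule compact_sublevel_sum) (use weight_continuous c_nonneg compact_sublevel pair_weight_continuous pair_weight_nonneg pair_weight_compact in auto)
  have w3_nonneg: "0 \<le> w3 z" for z using c_nonneg pair_weight_nonneg by (simp add: w3_def)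
  have w3_meas: "w3 \<in> borel_measurable borel" using w3_cont by (rule borel_measurable_continuous_onI)
  have w3_bound: "(\<integral>\<^sup>+z. ennreal (w3 z) \<partial>\<rho> n) \<le> ennreal (rmoment \<mu> + rmoment \<nu>' + C)" for n
  proof -
    have "(\<integral>\<^sup>+z. ennreal (w3 z) \<partial>\<rho> n) = (\<integral>\<^sup>+z. ennreal (pair_weight (fst z)) + ennreal (c x0 (snd z)) \<partial>\<rho> n)"
      using c_nonneg pair_weight_nonneg by (intro nn_integral_cong) (simp add: w3_def)
    also have "\<dots> = (\<integral>\<^sup>+z. ennreal (pair_weight (fst z)) \<partial>\<rho> n) + (\<integral>\<^sup>+z. ennreal (c x0 (snd z)) \<partial>\<rho> n)"
      by (rule nn_integral_add) measurable
    also have "(\<integral>\<^sup>+z. ennreal (pair_weight (fst z)) \<partial>\<rho> n) = (\<integral>\<^sup>+z. ennreal (pair_weight z) \<partial>distr (\<rho> n) borel fst)"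
      by (subst nn_integral_distr) auto
    also have "\<dots> = ennreal (rmoment \<mu> + rmoment \<nu>')"
      using nn_integral_weights[OF \<gamma>(1) \<mu> \<nu>', of 0 1] by (simp add: \<rho>_fst pair_weight_def)
    also have "(\<integral>\<^sup>+z. ennreal (c x0 (snd z)) \<partial>\<rho> n) = (\<integral>\<^sup>+z. ennreal (c x0 z) \<partial>distr (\<rho> n) borel snd)"
      by (subst nn_integral_distr) auto
    also have "\<dots> = ennreal (rmoment (\<nu> (r1 (r2 n))))"
      using fin_momentD(2)[OF \<nu>] by (simp add: \<rho>_snd moment_def)
    also have "ennreal (rmoment \<mu> + rmoment \<nu>') + ennreal (rmoment (\<nu> (r1 (r2 n)))) \<le> ennreal (rmoment \<mu> + rmoment \<nu>' + C)"
      using C[of "r1 (r2 n)"] rmoment_nonneg by (simp add: ennreal_plus[symmetric] ennreal_leI del: ennreal_plus)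
    finally show ?thesis .
  qed
  obtain r3 :: "nat \<Rightarrow> nat" and \<Xi> :: "real measure" and S S' where S: "strict_mono r3" "prob_space \<Xi>"
    "\<And>n. S n \<in> borel_measurable \<Xi>" "S' \<in> borel_measurable \<Xi>"
    "\<And>n. distr \<Xi> borel (S n) = \<rho> (r3 n)" "AE x in \<Xi>. (\<lambda>n. S n x) \<longlonglongrightarrow> S' x"
    by (rule skorohod_subsequence[of \<rho> w3 "rmoment \<mu> + rmoment \<nu>' + C",
          OF \<rho>_probs w3_meas w3_compact w3_nonneg w3_bound], rule that)
  note [measurable] = S(3,4)
  define N where "N n = \<nu> (r1 (r2 (r3 n)))" for n
  have N_fin: "N n \<in> fin_moment" for n by (simp add: N_def \<nu>)
  have r123: "strict_mono (\<lambda>n. r1 (r2 (r3 n)))" using r12 S(1) by (auto simp: strict_mono_def)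
  have N_m: "(\<lambda>n. rmoment (N n)) \<longlonglongrightarrow> rmoment \<nu>'"
    using LIMSEQ_subseq_LIMSEQ[OF m r123] by (simp add: N_def comp_def)
  have S_fst: "distr \<Xi> borel (\<lambda>x. fst (S n x)) = \<gamma>" for n
    using distr_distr[of fst borel borel "S n" \<Xi>] \<rho>_fst by (simp add: S(5) comp_def)
  have S_snd: "distr \<Xi> borel (\<lambda>x. snd (S n x)) = N n" for n
    using distr_distr[of snd borel borel "S n" \<Xi>] \<rho>_snd by (simp add: S(5) comp_def N_def)
  have S_X: "distr \<Xi> borel (\<lambda>x. fst (fst (S n x))) = \<mu>" for n
  proof -
    have "distr \<Xi> borel (\<lambda>x. fst (fst (S n x))) = distr (distr \<Xi> borel (\<lambda>x. fst (S n x))) borel fst"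
      by (subst distr_distr) (auto simp: comp_def)
    then show ?thesis by (simp add: S_fst \<gamma>D(3))
  qed
  have S'_fst: "distr \<Xi> borel (\<lambda>x. fst (S' x)) = \<gamma>"
  proof (rule distr_AE_limit[OF S(2)])
    show "AE x in \<Xi>. (\<lambda>n. fst (S n x)) \<longlonglongrightarrow> fst (S' x)"
      using S(6) by eventually_elim (rule tendsto_fst)
  qed (use \<gamma>D in \<open>auto simp: S_fst weakly_converges_const probs_iff\<close>)
  \<comment> \<open>The second entry of the pair and the third point coincide in the limit: the mean
    of their truncated distance is at most the gluing error \<open>1 / Suc n\<close> plus the mean
    truncated distance of \<open>Z n\<close> from \<open>Z'\<close>.\<close>
  have eq: "AE x in \<Xi>. snd (fst (S' x)) = snd (S' x)"
  proof -
    define f where "f z = min 1 (dist (snd (fst z)) (snd z))" for z :: "('a \<times> 'a) \<times> 'a"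
    have f_cont: "continuous_on UNIV f" unfolding f_def by (intro continuous_intros)
    have [measurable]: "f \<in> borel_measurable borel" using f_cont by (rule borel_measurable_continuous_onI)
    have f_bd: "0 \<le> f z" "f z \<le> 1" for z by (auto simp: f_def)
    have "bounded (range f)" by (rule boundedI[of _ 1]) (use f_bd in auto)
    then have "(\<lambda>n. \<integral>z. f z \<partial>distr \<Xi> borel (S n)) \<longlonglongrightarrow> (\<integral>z. f z \<partial>distr \<Xi> borel S')"
      using weakly_converges_distr[OF S(2-4,6)] f_cont unfolding weakly_converges_def by blast
    moreover have "(\<lambda>n. \<integral>z. f z \<partial>distr \<Xi> borel (S n)) \<longlonglongrightarrow> 0"
    proof -
      define d where "d n = (\<integral>\<omega>. min 1 (dist (Z' \<omega>) (Z n \<omega>)) \<partial>\<Omega>)" for n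
      have "d \<longlonglongrightarrow> (\<integral>\<omega>. 0 \<partial>\<Omega>)"
        unfolding d_def
      proof (rule integral_dominated_convergence[where w = "\<lambda>_. 1"])
        show "AE x in \<Omega>. (\<lambda>n. min 1 (dist (Z' x) (Z n x))) \<longlonglongrightarrow> 0"
          using Z(6)
        proof eventually_elim
          case (elim x)
          have "(\<lambda>n. min 1 (dist (Z' x) (Z n x))) \<longlonglongrightarrow> min 1 (dist (Z' x) (Z' x))"
            by (intro tendsto_intros elim)
          then show ?case by simp
        qed
      qed auto
      then have d: "d \<longlonglongrightarrow> 0" by simp
      have bound: "(\<integral>z. f z \<partial>\<rho> n) \<le> 1 / Suc n + d n" for n
      proof -
        interpret Kn: prob_space "K n" by (rule K(1))
        have "(\<integral>z. f z \<partial>\<rho> n) = (\<integral>z. f (T n z) \<partial>K n)"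
          unfolding \<rho>_def by (rule integral_distr) measurable
        also have "\<dots> \<le> (\<integral>z. 1 / Suc n + min 1 (dist (Z' (snd z)) (Z n (snd z))) \<partial>K n)"
        proof (rule integral_mono_AE)
          show "integrable (K n) (\<lambda>z. f (T n z))"
            by (rule Kn.integrable_const_bound[where B = 1]) (use f_bd in auto)
          have "integrable (K n) (\<lambda>z. min 1 (dist (Z' (snd z)) (Z n (snd z))))"
            by (rule Kn.integrable_const_bound[where B = 1]) auto
          then show "integrable (K n) (\<lambda>z. 1 / Suc n + min 1 (dist (Z' (snd z)) (Z n (snd z))))" by simp
          show "AE z in K n. f (T n z) \<le> 1 / Suc n + min 1 (dist (Z' (snd z)) (Z n (snd z)))"
            using K(5)[of n]
          proof eventually_elim
            case (elim z)
            have "0 \<le> 1 / real (Suc n)" by simp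
            then show ?case
              using elim dist_triangle[of "snd (fst z)" "Z n (snd z)" "Z' (snd z)"]
              unfolding f_def T_def fst_conv snd_conv by linarith
          qed
        qed
        also have "\<dots> = 1 / Suc n + (\<integral>z. min 1 (dist (Z' (snd z)) (Z n (snd z))) \<partial>K n)"
        proof -
          have "integrable (K n) (\<lambda>z. min 1 (dist (Z' (snd z)) (Z n (snd z))))"
            by (rule Kn.integrable_const_bound[where B = 1]) auto
          then show ?thesis by (simp add: Kn.prob_space)
        qed
        also have "(\<integral>z. min 1 (dist (Z' (snd z)) (Z n (snd z))) \<partial>K n)
            = (\<integral>\<omega>. min 1 (dist (Z' \<omega>) (Z n \<omega>)) \<partial>distr (K n) \<Omega> snd)"
          by (rule integral_distr[symmetric]) measurable
        also have "\<dots> = d n" by (simp add: K(4) d_def)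
        finally show ?thesis .
      qed
      have lim: "(\<lambda>n. 1 / Suc n + d n) \<longlonglongrightarrow> 0 + 0"
        by (intro tendsto_add d LIMSEQ_Suc[OF lim_1_over_n])
      have "(\<lambda>n. \<integral>z. f z \<partial>\<rho> n) \<longlonglongrightarrow> 0"
      proof (rule tendsto_sandwich[OF _ _ tendsto_const])
        show "(\<lambda>n. 1 / Suc n + d n) \<longlonglongrightarrow> 0" using lim by simp
        show "\<forall>\<^sub>F n in sequentially. (\<integral>z. f z \<partial>\<rho> n) \<le> 1 / Suc n + d n"
          by (intro always_eventually allI bound)
        show "\<forall>\<^sub>F n in sequentially. 0 \<le> (\<integral>z. f z \<partial>\<rho> n)"
          by (intro always_eventually allI Bochner_Integration.integral_nonneg f_bd)
      qed
      from LIMSEQ_subseq_LIMSEQ[OF this S(1)] show ?thesis by (simp add: S(5) comp_def)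
    qed
    ultimately have "(\<integral>z. f z \<partial>distr \<Xi> borel S') = 0" by (rule LIMSEQ_unique)
    moreover have "(\<integral>z. f z \<partial>distr \<Xi> borel S') = (\<integral>x. f (S' x) \<partial>\<Xi>)" by (rule integral_distr) measurable
    ultimately have "(\<integral>x. f (S' x) \<partial>\<Xi>) = 0" by simp
    moreover interpret \<Xi>: prob_space \<Xi> by (rule S(2))
    have "integrable \<Xi> (\<lambda>x. f (S' x))"
      by (rule \<Xi>.integrable_const_bound[where B = 1]) (use f_bd in auto)
    ultimately have "AE x in \<Xi>. f (S' x) = 0"
      using integral_nonneg_eq_0_iff_AE[of \<Xi> "\<lambda>x. f (S' x)"] f_bd by simp
    then show ?thesis by eventually_elim (auto simp: f_def min_def split: if_splits)
  qed
  define W where "W n x = (fst (fst (S n x)), snd (S n x))" for n x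
  define W' where "W' x = (fst (fst (S' x)), snd (S' x))" for x
  have W_meas[measurable]: "W n \<in> borel_measurable \<Xi>" "W' \<in> borel_measurable \<Xi>" for n
    unfolding W_def[abs_def] W'_def[abs_def] borel_prod[symmetric, where ?'a = 'a and ?'b = 'a] by measurable
  have W_lim: "AE x in \<Xi>. (\<lambda>n. W n x) \<longlonglongrightarrow> W' x"
    using S(6) by eventually_elim (auto simp: W_def W'_def intro!: tendsto_Pair tendsto_fst tendsto_snd)
  have W_coup: "distr \<Xi> borel (W n) \<in> couplings \<mu> (N n)" for n
    using coupling_distr[OF S(2), of "\<lambda>x. fst (fst (S n x))" "\<lambda>x. snd (S n x)"]
    by (simp add: S_X S_snd W_def[abs_def])
  have W'_law: "distr \<Xi> borel W' = \<gamma>"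
    unfolding S'_fst[symmetric]
  proof (rule distr_cong_AE)
    show "AE x in \<Xi>. W' x = fst (S' x)"
      using eq by eventually_elim (simp add: W'_def prod_eq_iff)
  qed auto
  define h where "h z = A + B * (c x0 (fst z) + c x0 (snd z)) - k (fst z) (snd z)" for z
  have k_cont': "continuous_on UNIV (\<lambda>z. k (fst z) (snd z))"
    using k_cont by (simp add: case_prod_beta')
  have h_cont: "continuous_on UNIV h"
    unfolding h_def[abs_def]
    by (intro continuous_intros k_cont' continuous_on_compose2[OF weight_continuous]) auto
  have [measurable]: "h \<in> borel_measurable borel" "(\<lambda>z. k (fst z) (snd z)) \<in> borel_measurable borel"
    using h_cont k_cont' by (auto intro: borel_measurable_continuous_onI)
  have ident: "(\<integral>\<^sup>+z. ennreal (h z) \<partial>\<sigma>) + coupling_cost k \<sigma> = ennreal (A + B * (rmoment \<mu> + rmoment \<eta>))"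
    if \<sigma>: "\<sigma> \<in> couplings \<mu> \<eta>" and \<eta>: "\<eta> \<in> fin_moment" for \<sigma> \<eta>
  proof -
    have [measurable_cong]: "sets \<sigma> = sets borel" using couplingsD[OF \<sigma>] by simp
    have "(\<integral>\<^sup>+z. ennreal (h z) \<partial>\<sigma>) + coupling_cost k \<sigma>
        = (\<integral>\<^sup>+z. ennreal (h z) + ennreal (k (fst z) (snd z)) \<partial>\<sigma>)"
      by (rule nn_integral_add[symmetric]) measurable
    also have "\<dots> = (\<integral>\<^sup>+z. ennreal (A + B * (c x0 (fst z) + c x0 (snd z))) \<partial>\<sigma>)"
      using k_le k_nonneg by (intro nn_integral_cong) (simp add: h_def ennreal_plus[symmetric] del: ennreal_plus)
    also have "\<dots> = ennreal (A + B * (rmoment \<mu> + rmoment \<eta>))"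
      using A_nonneg B_pos by (intro nn_integral_weights[OF \<sigma> \<mu> \<eta>]) auto
    finally show ?thesis .
  qed
  define t where "t = A + B * (rmoment \<mu> + rmoment \<nu>')"
  have t: "0 \<le> t" using A_nonneg B_pos rmoment_nonneg by (simp add: t_def)
  define Hn where "Hn n = (\<integral>\<^sup>+z. ennreal (h z) \<partial>distr \<Xi> borel (W n))" for n
  define H where "H = (\<integral>\<^sup>+z. ennreal (h z) \<partial>\<gamma>)"
  define k' where "k' = coupling_cost k \<gamma>"
  have Hk: "H + k' = ennreal t" using ident[OF \<gamma>(1) \<nu>'] by (simp add: H_def k'_def t_def)
  have Hn_a: "Hn n + a \<le> ennreal (A + B * (rmoment \<mu> + rmoment (N n)))" for n
  proof -
    have "a \<le> transport_cost k \<mu> (N n)" using r1(2) by (simp add: N_def not_less)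
    also have "\<dots> \<le> coupling_cost k (distr \<Xi> borel (W n))"
      by (rule transport_cost_le_coupling[OF W_coup])
    finally have "Hn n + a \<le> Hn n + \<dots>" by (rule add_left_mono)
    also have "\<dots> = ennreal (A + B * (rmoment \<mu> + rmoment (N n)))"
      unfolding Hn_def by (rule ident[OF W_coup N_fin])
    finally show ?thesis .
  qed
  have rhs: "(\<lambda>n. ennreal (A + B * (rmoment \<mu> + rmoment (N n)))) \<longlonglongrightarrow> ennreal t"
    unfolding t_def by (intro tendsto_ennrealI tendsto_intros N_m)
  have a_le: "a \<le> ennreal (A + B * (rmoment \<mu> + rmoment (N n)))" for n
    by (rule order.trans[OF add_increasing Hn_a]) simp_all
  then have a_fin: "a < \<top>"
    by (rule le_less_trans) simp
  have "H \<le> liminf Hn"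
    using nn_integral_distr_Fatou[OF h_cont W_meas(1) W_meas(2) W_lim] by (simp add: W'_law H_def Hn_def[abs_def])
  also have "liminf Hn \<le> liminf (\<lambda>n. ennreal (A + B * (rmoment \<mu> + rmoment (N n))) - a)"
  proof (intro Liminf_mono always_eventually allI)
    fix n
    show "Hn n \<le> ennreal (A + B * (rmoment \<mu> + rmoment (N n))) - a"
      using ennreal_minus_mono[OF Hn_a[of n] order_refl, of a] a_fin
      by (simp add: ennreal_add_diff_cancel_right less_top)
  qed
  also have "\<dots> = ennreal t - a"
    using a_fin by (intro lim_imp_Liminf tendsto_diff_ennreal rhs tendsto_const) auto
  finally have "H \<le> ennreal t - a" .
  moreover have "a \<le> ennreal t"
  proof (rule LIMSEQ_le_const[OF rhs], intro exI allI impI)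
    show "a \<le> ennreal (A + B * (rmoment \<mu> + rmoment (N n)))" for n
      by (rule a_le)
  qed
  ultimately have "H + a \<le> ennreal t"
    using add_right_mono[of H "ennreal t - a" a] by (simp add: diff_add_cancel_ennreal)
  \<comment> \<open>Cancelling the finite \<open>H\<close> gives \<open>a \<le> k'\<close>, against
    the choice of a coupling with cost below \<open>a\<close>.\<close>
  then have "H + a \<le> H + k'" by (simp add: Hk)
  moreover have "H \<noteq> \<top>" using Hk by auto
  ultimately have "a \<le> k'" by (simp add: ennreal_add_left_cancel_le)
  then show False using \<gamma>(2) by (simp add: k'_def)
qed

end

section \<open>An embedding that describes the transport topology\<close>

lemma tendsto_fun_iff:
  fixes f :: "'b \<Rightarrow> 'i \<Rightarrow> 'c::topological_space"
  shows "(f \<longlongrightarrow> l) F \<longleftrightarrow> (\<forall>i. ((\<lambda>n. f n i) \<longlongrightarrow> l i) F)"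
  using limitin_componentwise[of "\<lambda>_. euclidean :: 'c topology" UNIV f l F]
  by (simp add: euclidean_product_topology limitin_canonical_iff)

lemma transport_cost_self:
  fixes c :: "'a::{metric_space, second_countable_topology} \<Rightarrow> 'a \<Rightarrow> real"
  assumes "continuous_on UNIV (\<lambda>(x, y). c x y)" "\<And>x. c x x = 0" and \<mu>: "\<mu> \<in> probs borel"
  shows "transport_cost c \<mu> \<mu> = 0"
proof -
  have [measurable_cong]: "sets \<mu> = sets borel" using \<mu> by (simp add: probs_iff)
  have "distr \<mu> borel (\<lambda>x. x) = \<mu>" by (rule distr_id2) (use \<mu> in \<open>simp add: probs_iff\<close>)
  then have "transport_cost c \<mu> \<mu> \<le> (\<integral>\<^sup>+x. ennreal (c x x) \<partial>\<mu>)"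
    using transport_cost_le[OF assms(1), of \<mu> "\<lambda>x. x" "\<lambda>x. x"] \<mu> by (simp add: probs_iff)
  then show ?thesis by (simp add: assms(2))
qed

context transport
begin

text \<open>The target \<open>nat \<Rightarrow> real\<close> with its product topology is a metric
  space with a countable base: sequences suffice, and the base supplies the countably many
  neighbourhoods.\<close>

definition coords :: "'a measure \<Rightarrow> nat \<Rightarrow> real" where
  "coords \<mu> i = (case i of 0 \<Rightarrow> rmoment \<mu> | Suc j \<Rightarrow> \<integral>x. test_fun j x \<partial>\<mu>)"

lemma coords_simps[simp]:
  "coords \<mu> 0 = rmoment \<mu>" "coords \<mu> (Suc j) = (\<integral>x. test_fun j x \<partial>\<mu>)"
  by (simp_all add: coords_def)

lemma tendsto_nat_fun_iff:
  fixes f :: "'b \<Rightarrow> nat \<Rightarrow> real"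
  shows "(f \<longlongrightarrow> l) F \<longleftrightarrow> ((\<lambda>n. f n 0) \<longlongrightarrow> l 0) F \<and> (\<forall>j. ((\<lambda>n. f n (Suc j)) \<longlongrightarrow> l (Suc j)) F)"
  unfolding tendsto_fun_iff using not0_implies_Suc by metis

lemma coords_tendsto:
  assumes "weakly_converges \<nu> \<nu>'" "(\<lambda>n. rmoment (\<nu> n)) \<longlonglongrightarrow> m"
  shows "(\<lambda>n. coords (\<nu> n)) \<longlonglongrightarrow> (coords \<nu>')(0 := m)"
  unfolding tendsto_nat_fun_iff
  using assms test_fun_continuous test_fun_bounded by (auto simp: weakly_converges_def)

lemma coords_inj:
  assumes "\<mu> \<in> fin_moment" "\<nu> \<in> fin_moment" "\<And>j. coords \<mu> (Suc j) = coords \<nu> (Suc j)"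
  shows "\<mu> = \<nu>"
  using assms fin_momentD(1) by (intro test_fun_eqI) auto

text \<open>The moment coordinate supplies tightness, without which convergence of the test
  integrals would not give weak convergence. Every subsequence has a further weakly convergent one,
  and the test integrals force all these limits to be the same measure.\<close>

lemma coords_limit:
  assumes \<nu>: "\<And>n. \<nu> n \<in> fin_moment" and lim: "(\<lambda>n. coords (\<nu> n)) \<longlonglongrightarrow> p"
  obtains \<nu>' where "\<nu>' \<in> fin_moment" "rmoment \<nu>' \<le> p 0" "\<And>j. coords \<nu>' (Suc j) = p (Suc j)"
    "weakly_converges \<nu> \<nu>'" "(\<lambda>n. rmoment (\<nu> n)) \<longlonglongrightarrow> p 0"
proof -
  have m: "(\<lambda>n. rmoment (\<nu> n)) \<longlonglongrightarrow> p 0" and f: "\<And>j. (\<lambda>n. coords (\<nu> n) (Suc j)) \<longlonglongrightarrow> p (Suc j)"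
    using lim unfolding tendsto_nat_fun_iff by auto
  obtain C where C: "\<And>n. rmoment (\<nu> n) \<le> C"
    using convergent_imp_bounded_above[OF m] by blast
  have sub: "\<exists>q \<eta>. strict_mono (q :: nat \<Rightarrow> nat) \<and> \<eta> \<in> fin_moment \<and> weakly_converges (\<lambda>n. \<nu> (r (q n))) \<eta> \<and>
      rmoment \<eta> \<le> p 0 \<and> (\<forall>j. coords \<eta> (Suc j) = p (Suc j))" if r: "strict_mono r" for r :: "nat \<Rightarrow> nat"
  proof -
    obtain q :: "nat \<Rightarrow> nat" and \<eta> m' where q: "strict_mono q" "\<eta> \<in> fin_moment" "weakly_converges (\<lambda>n. \<nu> (r (q n))) \<eta>"
      "(\<lambda>n. rmoment (\<nu> (r (q n)))) \<longlonglongrightarrow> m'" "rmoment \<eta> \<le> m'"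
      by (rule weak_compactness[of "\<lambda>n. \<nu> (r n)" C, OF \<nu> C], rule that)
    have rq: "strict_mono (\<lambda>n. r (q n))" using r q(1) by (auto simp: strict_mono_def)
    have "m' = p 0"
      by (rule LIMSEQ_unique[OF q(4)]) (use LIMSEQ_subseq_LIMSEQ[OF m rq] in \<open>simp add: comp_def\<close>)
    moreover have "coords \<eta> (Suc j) = p (Suc j)" for j
    proof (rule LIMSEQ_unique)
      show "(\<lambda>n. coords (\<nu> (r (q n))) (Suc j)) \<longlonglongrightarrow> p (Suc j)"
        using LIMSEQ_subseq_LIMSEQ[OF f rq] by (simp add: comp_def)
      show "(\<lambda>n. coords (\<nu> (r (q n))) (Suc j)) \<longlonglongrightarrow> coords \<eta> (Suc j)"
        using q(3) test_fun_continuous test_fun_bounded by (auto simp: weakly_converges_def)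
    qed
    ultimately show ?thesis using q by blast
  qed
  obtain \<nu>' where \<nu>': "\<nu>' \<in> fin_moment" "rmoment \<nu>' \<le> p 0" "\<And>j. coords \<nu>' (Suc j) = p (Suc j)"
    using sub[of "\<lambda>n. n"] by (auto simp: strict_mono_def)
  show ?thesis
  proof
    show "weakly_converges \<nu> \<nu>'"
      unfolding weakly_converges_def
    proof (intro allI impI)
      fix f :: "'a \<Rightarrow> real" assume f: "continuous_on UNIV f \<and> bounded (range f)"
      show "(\<lambda>n. \<integral>x. f x \<partial>\<nu> n) \<longlonglongrightarrow> (\<integral>x. f x \<partial>\<nu>')"
      proof (rule subseq_converges_imp_converges)
        fix r :: "nat \<Rightarrow> nat" assume "strict_mono r"
        from sub[OF this] obtain q \<eta> where q: "strict_mono (q :: nat \<Rightarrow> nat)" "\<eta> \<in> fin_moment"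
          "weakly_converges (\<lambda>n. \<nu> (r (q n))) \<eta>" "\<And>j. coords \<eta> (Suc j) = p (Suc j)" by blast
        have "\<eta> = \<nu>'" using coords_inj[OF q(2) \<nu>'(1)] q(4) \<nu>'(3) by simp
        then show "\<exists>q. strict_mono (q :: nat \<Rightarrow> nat) \<and> (\<lambda>n. \<integral>x. f x \<partial>\<nu> (r (q n))) \<longlonglongrightarrow> (\<integral>x. f x \<partial>\<nu>')"
          using q(1,3) f unfolding weakly_converges_def by blast
      qed
    qed
  qed fact+
qed

lemma coords_convD:
  assumes \<nu>: "\<And>n. \<nu> n \<in> fin_moment" and \<nu>': "\<nu>' \<in> fin_moment" and lim: "(\<lambda>n. coords (\<nu> n)) \<longlonglongrightarrow> coords \<nu>'"
  shows "weakly_converges \<nu> \<nu>'" "(\<lambda>n. rmoment (\<nu> n)) \<longlonglongrightarrow> rmoment \<nu>'"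
proof -
  obtain \<eta> where \<eta>: "\<eta> \<in> fin_moment" "rmoment \<eta> \<le> coords \<nu>' 0" "\<And>j. coords \<eta> (Suc j) = coords \<nu>' (Suc j)" "weakly_converges \<nu> \<eta>"
    "(\<lambda>n. rmoment (\<nu> n)) \<longlonglongrightarrow> coords \<nu>' 0"
    by (rule coords_limit[OF \<nu> lim], rule that)
  show "(\<lambda>n. rmoment (\<nu> n)) \<longlonglongrightarrow> rmoment \<nu>'" using \<eta>(5) by simp
  show "weakly_converges \<nu> \<nu>'" using \<eta>(4) coords_inj[OF \<eta>(1) \<nu>' \<eta>(3)] by simp
qed

section \<open>Upper semicontinuity in either argument, and costs tending to 0\<close>

lemma upper_semicontinuous_right:
  assumes "\<mu> \<in> fin_moment" "\<And>n. \<nu> n \<in> fin_moment" "\<nu>' \<in> fin_moment" "(\<lambda>n. coords (\<nu> n)) \<longlonglongrightarrow> coords \<nu>'"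
    and "J \<mu> \<nu>' < a"
  shows "\<forall>\<^sub>F n in sequentially. J \<mu> (\<nu> n) < a"
  using assms coords_convD[OF assms(2-4)]
  by (intro transport_cost_upper_limit[OF c_continuous c_nonneg cost_le_weights])

lemma upper_semicontinuous_left:
  assumes "\<mu> \<in> fin_moment" "\<And>n. \<nu> n \<in> fin_moment" "\<nu>' \<in> fin_moment" "(\<lambda>n. coords (\<nu> n)) \<longlonglongrightarrow> coords \<nu>'"
    and "J \<nu>' \<mu> < a"
  shows "\<forall>\<^sub>F n in sequentially. J (\<nu> n) \<mu> < a"
proof -
  have "continuous_on UNIV (\<lambda>(x, y). c y x)"
    using continuous_on_compose2[OF c_continuous continuous_on_swap, of UNIV] by (simp add: prod.swap_def split_beta)
  moreover have "c y x \<le> A + B * (c x0 x + c x0 y)" for x y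
    using cost_le_weights[of y x] by (simp add: add.commute)
  ultimately have "\<forall>\<^sub>F n in sequentially. transport_cost (\<lambda>x y. c y x) \<mu> (\<nu> n) < a"
    using assms coords_convD[OF assms(2-4)] transport_cost_swap[OF c_continuous]
    by (intro transport_cost_upper_limit) (auto simp: c_nonneg)
  then show ?thesis unfolding transport_cost_swap[OF c_continuous] .
qed

lemma cost_zero_imp_eq:
  assumes \<gamma>: "\<gamma> \<in> couplings \<mu> \<nu>" and zero: "coupling_cost c \<gamma> = 0"
  shows "\<mu> = \<nu>"
proof -
  have [measurable_cong]: "sets \<gamma> = sets borel" using couplingsD[OF \<gamma>] by simp
  have "AE z in \<gamma>. ennreal (c (fst z) (snd z)) = 0"
    using zero by (subst (asm) nn_integral_0_iff_AE) auto
  then have "AE z in \<gamma>. fst z = snd z"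
  proof eventually_elim
    case (elim z)
    then have "c (fst z) (snd z) = 0" using c_nonneg[of "fst z" "snd z"] by (simp add: ennreal_eq_0_iff)
    then show ?case by (simp add: c_eq_0_iff)
  qed
  then have "distr \<gamma> borel fst = distr \<gamma> borel snd" by (intro distr_cong_AE) auto
  then show ?thesis using couplingsD(3,4)[OF \<gamma>] by simp
qed

text \<open>Bounded cost bounds the moments, so subsequences have weak limits. The lower estimate,
  applied to costs tending to 0, forces such a limit to be \<open>\<mu>\<close> and the escaping
  moment to vanish at the same time.\<close>

lemma cost_tendsto_0_imp_coords_tendsto:
  assumes \<mu>: "\<mu> \<in> fin_moment" and \<nu>: "\<And>n. \<nu> n \<in> probs borel" and J: "\<And>n. J \<mu> (\<nu> n) < ennreal (1 / Suc n)"
  shows "\<And>n. \<nu> n \<in> fin_moment" "(\<lambda>n. coords (\<nu> n)) \<longlonglongrightarrow> coords \<mu>"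
proof -
  note \<mu>_probs = fin_momentD(1)[OF \<mu>]
  show \<nu>_fin: "\<nu> n \<in> fin_moment" for n
    using fin_moment_if_cost_finite[OF \<mu>_probs \<nu>[of n]] less_trans[OF J[of n] ennreal_less_top] \<mu> by simp
  have J_lim: "(\<lambda>n. J \<mu> (\<nu> n)) \<longlonglongrightarrow> 0"
  proof (rule tendsto_sandwich[OF _ _ tendsto_const])
    show "\<forall>\<^sub>F n in sequentially. J \<mu> (\<nu> n) \<le> ennreal (1 / Suc n)" by (intro always_eventually allI less_imp_le J)
    have "(\<lambda>n. ennreal (1 / real (Suc n))) \<longlonglongrightarrow> ennreal 0" by (intro tendsto_ennrealI LIMSEQ_Suc[OF lim_1_over_n])
    then show "(\<lambda>n. ennreal (1 / real (Suc n))) \<longlonglongrightarrow> 0" by simp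
  qed auto
  have bound: "rmoment (\<nu> n) \<le> A + B * (rmoment \<mu> + 1)" for n
  proof -
    have "J \<mu> (\<nu> n) \<le> ennreal 1"
      using J[of n] by (rule order.trans[OF less_imp_le]) (simp add: ennreal_leI del: ennreal_1)
    then have "moment (\<nu> n) \<le> ennreal A + ennreal B * (moment \<mu> + ennreal 1)"
      by (intro order.trans[OF moment_le(1)[OF \<mu>_probs \<nu>]] add_left_mono mult_left_mono) auto
    also have "\<dots> = ennreal (A + B * (rmoment \<mu> + 1))"
      unfolding fin_momentD(2)[OF \<mu>] using A_nonneg B_pos rmoment_nonneg by (simp add: ennreal_mult del: ennreal_1)
    finally show ?thesis
      unfolding fin_momentD(2)[OF \<nu>_fin] using A_nonneg B_pos rmoment_nonneg[of \<mu>]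
      by (subst (asm) ennreal_le_iff) auto
  qed
  show "(\<lambda>n. coords (\<nu> n)) \<longlonglongrightarrow> coords \<mu>"
  proof (rule subseq_converges_imp_converges)
    fix r :: "nat \<Rightarrow> nat" assume r: "strict_mono r"
    obtain q :: "nat \<Rightarrow> nat" and \<eta> m where q: "strict_mono q" "\<eta> \<in> fin_moment" "weakly_converges (\<lambda>n. \<nu> (r (q n))) \<eta>"
      "(\<lambda>n. rmoment (\<nu> (r (q n)))) \<longlonglongrightarrow> m" "rmoment \<eta> \<le> m"
      by (rule weak_compactness[of "\<lambda>n. \<nu> (r n)", OF \<nu>_fin bound], rule that)
    have rq: "strict_mono (\<lambda>n. r (q n))" using r q(1) by (auto simp: strict_mono_def)
    obtain \<gamma> where \<gamma>: "\<gamma> \<in> couplings \<mu> \<eta>"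
      "coupling_cost c \<gamma> + ennreal ((m - rmoment \<eta>) / B) \<le> liminf (\<lambda>n. J \<mu> (\<nu> (r (q n))))"
      by (rule transport_cost_lower_limit[OF \<mu> \<nu>_fin q(2-5)])
    have "liminf (\<lambda>n. J \<mu> (\<nu> (r (q n)))) = 0"
      using LIMSEQ_subseq_LIMSEQ[OF J_lim rq] by (simp add: comp_def lim_imp_Liminf)
    with \<gamma>(2) have "coupling_cost c \<gamma> = 0" "ennreal ((m - rmoment \<eta>) / B) = 0" by auto
    then have "\<mu> = \<eta>" "m = rmoment \<eta>"
      using cost_zero_imp_eq[OF \<gamma>(1)] q(5) B_pos by (auto simp: ennreal_eq_0_iff divide_le_0_iff)
    then have "(\<lambda>n. coords (\<nu> (r (q n)))) \<longlonglongrightarrow> coords \<mu>"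
      using coords_tendsto[OF q(3,4)] by (simp add: fun_upd_idem)
    then show "\<exists>q. strict_mono (q :: nat \<Rightarrow> nat) \<and> (\<lambda>n. coords (\<nu> (r (q n)))) \<longlonglongrightarrow> coords \<mu>"
      using q(1) by blast
  qed
qed

section \<open>Comparison of the transport topology with the one induced by the coordinates\<close>

lemma J_self: "\<mu> \<in> probs borel \<Longrightarrow> J \<mu> \<mu> = 0"
  using c_eq_0_iff by (intro transport_cost_self[OF c_continuous]) auto

lemma openin_J_ball:
  "\<mu> \<in> probs borel \<Longrightarrow> 0 < r \<Longrightarrow> openin (tau_J c) {\<nu> \<in> probs borel. J \<mu> \<nu> < ennreal r}"
  unfolding tau_J_def by (rule topology_generated_by_Basis) blast

lemma topspace_tau_J: "topspace (tau_J c) = probs borel"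
proof
  show "topspace (tau_J c) \<subseteq> probs borel" unfolding tau_J_def by auto
  show "probs borel \<subseteq> topspace (tau_J c)"
  proof
    fix \<mu> :: "'a measure" assume \<mu>: "\<mu> \<in> probs borel"
    then have "\<mu> \<in> {\<nu> \<in> probs borel. J \<mu> \<nu> < ennreal 1}" by (simp add: J_self)
    then show "\<mu> \<in> topspace (tau_J c)" using openin_subset[OF openin_J_ball[OF \<mu>, of 1]] by auto
  qed
qed

lemma openin_tau_J_if_balls:
  assumes "S \<subseteq> probs borel" "\<And>\<mu>. \<mu> \<in> S \<Longrightarrow> \<exists>r>0. \<forall>\<nu>\<in>probs borel. J \<mu> \<nu> < ennreal r \<longrightarrow> \<nu> \<in> S"
  shows "openin (tau_J c) S"
proof (subst openin_subopen, intro ballI)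
  fix \<mu> assume \<mu>: "\<mu> \<in> S"
  then obtain r where r: "0 < r" "\<forall>\<nu>\<in>probs borel. J \<mu> \<nu> < ennreal r \<longrightarrow> \<nu> \<in> S" using assms(2) by blast
  have "\<mu> \<in> probs borel" using \<mu> assms(1) by blast
  then show "\<exists>T. openin (tau_J c) T \<and> \<mu> \<in> T \<and> T \<subseteq> S"
    using r by (intro exI[of _ "{\<nu> \<in> probs borel. J \<mu> \<nu> < ennreal r}"] conjI openin_J_ball) (auto simp: J_self)
qed

lemma fin_moment_clopen: "openin (tau_J c) fin_moment" "closedin (tau_J c) fin_moment"
proof -
  have iff: "\<mu> \<in> fin_moment \<longleftrightarrow> \<nu> \<in> fin_moment" if "\<mu> \<in> probs borel" "\<nu> \<in> probs borel" "J \<mu> \<nu> < ennreal 1" for \<mu> \<nu>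
    using that by (intro fin_moment_if_cost_finite) (auto intro: less_trans)
  have sub: "fin_moment \<subseteq> probs borel" by (auto simp: fin_moment_def)
  show "openin (tau_J c) fin_moment"
    using iff sub by (intro openin_tau_J_if_balls) (auto intro!: exI[of _ 1] simp del: ennreal_1)
  have "openin (tau_J c) (probs borel - fin_moment)"
    using iff by (intro openin_tau_J_if_balls) (auto intro!: exI[of _ 1] simp del: ennreal_1)
  then show "closedin (tau_J c) fin_moment"
    using sub by (simp add: closedin_def topspace_tau_J)
qed

text \<open>Half of the comparison: \<open>coords\<close> is continuous on
  \<open>fin_moment\<close>. If no ball around \<open>\<mu>\<close> fitted into the set, picking a
  point outside the set from each ball of radius \<open>1 / Suc n\<close> would contradict the
  convergence of coordinates.\<close>

lemma openin_coords_vimage: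
  assumes "open V"
  shows "openin (tau_J c) (fin_moment \<inter> coords -` V)"
proof (rule openin_tau_J_if_balls)
  show "fin_moment \<inter> coords -` V \<subseteq> probs borel" by (auto simp: fin_moment_def)
  fix \<mu> assume \<mu>: "\<mu> \<in> fin_moment \<inter> coords -` V"
  show "\<exists>r>0. \<forall>\<nu>\<in>probs borel. J \<mu> \<nu> < ennreal r \<longrightarrow> \<nu> \<in> fin_moment \<inter> coords -` V"
  proof (rule ccontr)
    assume neg: "\<not> ?thesis"
    have "\<exists>\<nu>. \<nu> \<in> probs borel \<and> J \<mu> \<nu> < ennreal (1 / Suc n) \<and> \<nu> \<notin> fin_moment \<inter> coords -` V" for n :: nat
    proof -
      have "0 < 1 / real (Suc n)" by simp
      then show ?thesis using neg by blast
    qed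
    then obtain \<nu> where \<nu>: "\<And>n. \<nu> n \<in> probs borel" "\<And>n. J \<mu> (\<nu> n) < ennreal (1 / Suc n)"
      "\<And>n. \<nu> n \<notin> fin_moment \<inter> coords -` V" by metis
    have \<mu>': "\<mu> \<in> fin_moment" "coords \<mu> \<in> V" using \<mu> by auto
    note conv = cost_tendsto_0_imp_coords_tendsto[OF \<mu>'(1) \<nu>(1,2)]
    have "\<forall>\<^sub>F n in sequentially. coords (\<nu> n) \<in> V"
      by (rule topological_tendstoD[OF conv(2) assms \<mu>'(2)])
    then have "\<forall>\<^sub>F n in sequentially. False"
      by eventually_elim (use \<nu>(3) conv(1) in auto)
    then show False by simp
  qed
qed

text \<open>Openness of the trace on \<open>fin_moment\<close> for the topology induced by
  \<open>coords\<close>, in a sequential form that matches the semicontinuity results. It amounts to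
  openness since \<open>coords\<close> takes values in a metric space.\<close>

definition seq_open :: "'a measure set \<Rightarrow> bool" where
  "seq_open U \<longleftrightarrow> (\<forall>\<mu> \<nu>. \<mu> \<in> U \<longrightarrow> \<mu> \<in> fin_moment \<longrightarrow> (\<forall>n. \<nu> n \<in> fin_moment) \<longrightarrow>
    (\<lambda>n. coords (\<nu> n)) \<longlonglongrightarrow> coords \<mu> \<longrightarrow> (\<forall>\<^sub>F n in sequentially. \<nu> n \<in> U))"

lemma seq_openD:
  assumes "seq_open U" "\<mu> \<in> U" "\<mu> \<in> fin_moment" "\<And>n. \<nu> n \<in> fin_moment" "(\<lambda>n. coords (\<nu> n)) \<longlonglongrightarrow> coords \<mu>"
  shows "\<forall>\<^sub>F n in sequentially. \<nu> n \<in> U"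
  using assms unfolding seq_open_def by blast

lemma seq_open_imp_open_trace:
  assumes U: "seq_open U"
  obtains V where "open V" "U \<inter> fin_moment = fin_moment \<inter> coords -` V"
proof -
  define V where "V = \<Union>{ball (coords \<mu>) e | \<mu> e. \<mu> \<in> U \<inter> fin_moment \<and> (\<forall>\<nu>\<in>fin_moment. coords \<nu> \<in> ball (coords \<mu>) e \<longrightarrow> \<nu> \<in> U)}"
  have ex: "\<exists>e>0. \<forall>\<nu>\<in>fin_moment. coords \<nu> \<in> ball (coords \<mu>) e \<longrightarrow> \<nu> \<in> U" if \<mu>: "\<mu> \<in> U" "\<mu> \<in> fin_moment" for \<mu>
  proof (rule ccontr)
    assume neg: "\<not> ?thesis"
    have "\<exists>\<nu>. \<nu> \<in> fin_moment \<and> dist (coords \<mu>) (coords \<nu>) < 1 / Suc n \<and> \<nu> \<notin> U" for n :: nat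
    proof -
      have "0 < 1 / real (Suc n)" by simp
      then show ?thesis using neg unfolding mem_ball by blast
    qed
    then obtain \<nu> where \<nu>: "\<And>n. \<nu> n \<in> fin_moment" "\<And>n. dist (coords \<mu>) (coords (\<nu> n)) < 1 / Suc n" "\<And>n. \<nu> n \<notin> U"
      by metis
    have "(\<lambda>n. coords (\<nu> n)) \<longlonglongrightarrow> coords \<mu>"
    proof (rule tendstoI)
      fix e :: real assume "0 < e"
      have "\<forall>\<^sub>F n in sequentially. 1 / real (Suc n) < e"
        by (rule order_tendstoD(2)[OF LIMSEQ_Suc[OF lim_1_over_n] \<open>0 < e\<close>])
      then show "\<forall>\<^sub>F n in sequentially. dist (coords (\<nu> n)) (coords \<mu>) < e"
      proof eventually_elim
        case (elim n)
        then show ?case using \<nu>(2)[of n] by (simp add: dist_commute)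
      qed
    qed
    from seq_openD[OF U \<mu> \<nu>(1) this] show False using \<nu>(3) by simp
  qed
  show ?thesis
  proof
    show "open V" unfolding V_def by (rule open_Union) auto
    show "U \<inter> fin_moment = fin_moment \<inter> coords -` V"
    proof (intro equalityI subsetI)
      fix \<mu> assume "\<mu> \<in> U \<inter> fin_moment"
      then have \<mu>: "\<mu> \<in> U" "\<mu> \<in> fin_moment" by auto
      from ex[OF \<mu>] obtain e where e: "0 < e" "\<forall>\<nu>\<in>fin_moment. coords \<nu> \<in> ball (coords \<mu>) e \<longrightarrow> \<nu> \<in> U" by blast
      have "ball (coords \<mu>) e \<subseteq> V" unfolding V_def using \<mu> e(2) by blast
      then have "coords \<mu> \<in> V" using e(1) by auto
      then show "\<mu> \<in> fin_moment \<inter> coords -` V" using \<mu> by simp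
    next
      fix \<nu> assume "\<nu> \<in> fin_moment \<inter> coords -` V"
      then show "\<nu> \<in> U \<inter> fin_moment" unfolding V_def by auto
    qed
  qed
qed

text \<open>The other half of the comparison. Induction over the generated open sets reduces it to
  balls, where it is upper semicontinuity in the second argument. A ball that meets
  \<open>fin_moment\<close> has its centre there, so that result applies.\<close>

lemma openin_imp_seq_open:
  assumes "openin (tau_J c) U"
  shows "seq_open U"
  using openin_topology_generated_by[OF assms[unfolded tau_J_def]]
proof induction
  case Empty
  show ?case by (simp add: seq_open_def)
next
  case (Int a b)
  then show ?case unfolding seq_open_def by (auto intro: eventually_conj)
next
  case (UN K)
  show ?case
    unfolding seq_open_def
  proof (intro allI impI)
    fix \<mu> \<nu> assume \<mu>: "\<mu> \<in> \<Union>K" and *: "\<mu> \<in> fin_moment" "\<forall>n. \<nu> n \<in> fin_moment" "(\<lambda>n. coords (\<nu> n)) \<longlonglongrightarrow> coords \<mu>"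
    then obtain k where k: "k \<in> K" "\<mu> \<in> k" by blast
    have "\<forall>\<^sub>F n in sequentially. \<nu> n \<in> k"
      using seq_openD[OF UN.IH[OF k(1)] k(2) *(1) _ *(3)] *(2) by blast
    then show "\<forall>\<^sub>F n in sequentially. \<nu> n \<in> \<Union>K" by eventually_elim (use k in blast)
  qed
next
  case (Basis s)
  then obtain \<mu> r where s: "s = {\<nu> \<in> probs borel. J \<mu> \<nu> < ennreal r}" "\<mu> \<in> probs borel" by blast
  show ?case
    unfolding seq_open_def
  proof (intro allI impI)
    fix \<nu>' \<nu> assume \<nu>': "\<nu>' \<in> s" "\<nu>' \<in> fin_moment" and \<nu>: "\<forall>n. \<nu> n \<in> fin_moment" "(\<lambda>n. coords (\<nu> n)) \<longlonglongrightarrow> coords \<nu>'"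
    have less: "J \<mu> \<nu>' < ennreal r" using \<nu>'(1) s by simp
    then have "\<mu> \<in> fin_moment"
      using fin_moment_if_cost_finite[OF s(2) fin_momentD(1)[OF \<nu>'(2)]] \<nu>'(2) less_trans[OF less ennreal_less_top]
      by simp
    with less have "\<forall>\<^sub>F n in sequentially. J \<mu> (\<nu> n) < ennreal r"
      using \<nu> \<nu>'(2) by (intro upper_semicontinuous_right) auto
    then show "\<forall>\<^sub>F n in sequentially. \<nu> n \<in> s"
      by eventually_elim (use \<nu>(1) fin_momentD(1) s in auto)
  qed
qed

text \<open>A Dirac first marginal leaves every coupling concentrated on pairs that start at
  \<open>x0\<close>.\<close>

lemma J_return:
  assumes \<nu>: "\<nu> \<in> probs borel"
  shows "J (return borel x0) \<nu> = moment \<nu>"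
proof (rule antisym)
  interpret prob_space \<nu> using \<nu> by (simp add: probs_iff)
  have [measurable_cong]: "sets \<nu> = sets borel" using \<nu> by (simp add: probs_iff)
  have "distr \<nu> borel (\<lambda>x. x) = \<nu>" by (rule distr_id2) (use \<nu> in \<open>simp add: probs_iff\<close>)
  moreover have "distr \<nu> borel (\<lambda>_. x0) = return borel x0" by (rule distr_const) simp
  ultimately show "J (return borel x0) \<nu> \<le> moment \<nu>"
    using transport_cost_le[OF c_continuous prob_space_axioms, of "\<lambda>_. x0" "\<lambda>x. x"] by (simp add: moment_def)
  show "moment \<nu> \<le> J (return borel x0) \<nu>"
    unfolding transport_cost_def
  proof (rule INF_greatest)
    fix \<gamma> assume \<gamma>: "\<gamma> \<in> couplings (return borel x0) \<nu>"
    have [measurable_cong]: "sets \<gamma> = sets borel" using couplingsD[OF \<gamma>] by simp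
    have "AE x in return borel x0. x = x0" by (subst AE_return) auto
    then have "AE x in distr \<gamma> borel fst. x = x0" unfolding couplingsD(3)[OF \<gamma>] .
    then have AE: "AE z in \<gamma>. fst z = x0" by (rule AE_distrD[rotated]) measurable
    have "moment \<nu> = (\<integral>\<^sup>+z. ennreal (c x0 (snd z)) \<partial>\<gamma>)"
      unfolding moment_def by (rule nn_integral_coupling_snd[OF \<gamma>, symmetric]) measurable
    also have "\<dots> = coupling_cost c \<gamma>"
      using AE by (intro nn_integral_cong_AE) auto
    finally show "moment \<nu> \<le> (\<integral>\<^sup>+ (x, y). ennreal (c x y) \<partial>\<gamma>)" by (simp add: case_prod_beta')
  qed
qed

section \<open>Borel measurability of costs on the space of measures\<close>

lemma E0_eq: "E0 c x0 = fin_moment"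
  unfolding E0_def fin_moment_def using J_return by auto

lemma space_borel_E0: "space (borel_E0 c x0) = fin_moment"
proof -
  have "topspace (subtopology (tau_J c) fin_moment) = fin_moment"
    by (auto simp: topspace_subtopology topspace_tau_J fin_moment_def)
  then show ?thesis
    unfolding borel_E0_def borel_of_def E0_eq using openin_subset
    by (subst space_measure_of) fastforce+
qed

lemma seq_open_in_borel_E0:
  assumes "seq_open U" "U \<subseteq> fin_moment"
  shows "U \<in> sets (borel_E0 c x0)"
proof -
  obtain V where V: "open V" "U \<inter> fin_moment = fin_moment \<inter> coords -` V"
    by (rule seq_open_imp_open_trace[OF assms(1)])
  have "openin (tau_J c) U" using openin_coords_vimage[OF V(1)] V(2) assms(2) by (simp add: Int_absorb2)
  then have "openin (subtopology (tau_J c) fin_moment) U"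
    using assms(2) by (auto simp: openin_subtopology)
  then show ?thesis
    unfolding borel_E0_def borel_of_def E0_eq
    using openin_subset by (subst sets_measure_of) (fastforce intro: sigma_sets.Basic)+
qed

lemma measurable_borel_E0_if_upper_semicontinuous:
  fixes f :: "'a measure \<Rightarrow> ennreal"
  assumes "\<And>a. seq_open {\<mu> \<in> fin_moment. f \<mu> < a}"
  shows "f \<in> borel_measurable (borel_E0 c x0)"
proof (rule borel_measurableI_less)
  fix a
  show "{\<mu> \<in> space (borel_E0 c x0). f \<mu> < a} \<in> sets (borel_E0 c x0)"
    unfolding space_borel_E0 by (rule seq_open_in_borel_E0[OF assms]) auto
qed

lemma J_left_measurable:
  assumes "\<nu> \<in> fin_moment"
  shows "(\<lambda>\<mu>. J \<mu> \<nu>) \<in> borel_measurable (borel_E0 c x0)"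
  using upper_semicontinuous_left[OF assms]
  by (intro measurable_borel_E0_if_upper_semicontinuous) (auto simp: seq_open_def)

text \<open>Infima of upper semicontinuous functions are upper semicontinuous, so measurability
  holds for uncountable \<open>S\<close> as well.\<close>

lemma INF_J_left_measurable:
  assumes "S \<subseteq> fin_moment"
  shows "(\<lambda>\<mu>. INF \<nu>\<in>S. J \<mu> \<nu>) \<in> borel_measurable (borel_E0 c x0)"
proof (rule measurable_borel_E0_if_upper_semicontinuous)
  fix a
  show "seq_open {\<mu> \<in> fin_moment. (INF \<nu>\<in>S. J \<mu> \<nu>) < a}"
    unfolding seq_open_def
  proof (intro allI impI)
    fix \<mu> \<mu>s assume \<mu>: "\<mu> \<in> {\<mu> \<in> fin_moment. (INF \<nu>\<in>S. J \<mu> \<nu>) < a}" "\<mu> \<in> fin_moment"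
      and \<mu>s: "\<forall>n. \<mu>s n \<in> fin_moment" "(\<lambda>n. coords (\<mu>s n)) \<longlonglongrightarrow> coords \<mu>"
    then obtain \<nu> where \<nu>: "\<nu> \<in> S" "J \<mu> \<nu> < a" by (auto simp: INF_less_iff)
    then have "\<forall>\<^sub>F n in sequentially. J (\<mu>s n) \<nu> < a"
      using assms \<mu> \<mu>s by (intro upper_semicontinuous_left) auto
    then show "\<forall>\<^sub>F n in sequentially. \<mu>s n \<in> {\<mu> \<in> fin_moment. (INF \<nu>\<in>S. J \<mu> \<nu>) < a}"
      by eventually_elim (use \<nu> \<mu>s in \<open>auto simp: INF_less_iff\<close>)
  qed
qed

end

section \<open>Stability of empirical barycenters\<close>

lemma nn_integral_empirical:
  assumes n: "1 \<le> n" and x: "\<And>i. i \<in> {1..n} \<Longrightarrow> x i \<in> space N" and [measurable]: "f \<in> borel_measurable N"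
  shows "(\<integral>\<^sup>+y. f y \<partial>empirical N n x) = ennreal (1 / n) * (\<Sum>i=1..n. f (x i))"
proof -
  let ?U = "point_measure {1..n} (\<lambda>_. ennreal (1 / n))"
  have x_meas[measurable]: "x \<in> measurable ?U N"
    unfolding measurable_point_measure_eq1 by (intro Pi_I x)
  have "empirical N n x = distr ?U N x"
  proof (rule measure_eqI)
    fix S assume "S \<in> sets (empirical N n x)"
    then have S[measurable]: "S \<in> sets N" by simp
    have "emeasure (distr ?U N x) S = (\<integral>\<^sup>+i. indicator S (x i) \<partial>?U)"
      by (subst nn_integral_distr[OF x_meas, symmetric]) simp_all
    also have "\<dots> = ennreal (1 / n) * (\<Sum>i=1..n. indicator S (x i))"
      by (subst nn_integral_point_measure_finite) (auto simp: sum_distrib_left)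
    also have "\<dots> = emeasure (empirical N n x) S"
      using S by (simp add: emeasure_empirical)
    finally show "emeasure (empirical N n x) S = emeasure (distr ?U N x) S" by simp
  qed simp
  then have "(\<integral>\<^sup>+y. f y \<partial>empirical N n x) = (\<integral>\<^sup>+i. f (x i) \<partial>?U)"
    by (simp only: nn_integral_distr[OF x_meas] measurable_distr_eq1 assms(3))
  also have "\<dots> = ennreal (1 / n) * (\<Sum>i=1..n. f (x i))"
    by (subst nn_integral_point_measure_finite) (auto simp: sum_distrib_left)
  finally show ?thesis .
qed

lemma prob_space_empirical:
  assumes "1 \<le> n" "\<And>i. i \<in> {1..n} \<Longrightarrow> x i \<in> space N"
  shows "prob_space (empirical N n x)"
proof
  have "emeasure (empirical N n x) (space (empirical N n x)) = (\<integral>\<^sup>+y. 1 \<partial>empirical N n x)" by simp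
  also have "\<dots> = ennreal (1 / n) * of_nat n"
    using assms by (subst nn_integral_empirical) auto
  also have "\<dots> = 1"
    using assms(1) by (simp add: ennreal_of_nat_eq_real_of_nat ennreal_mult'[symmetric])
  finally show "emeasure (empirical N n x) (space (empirical N n x)) = 1" .
qed

lemma iid_sequence_compose:
  fixes f :: "'b \<Rightarrow> real"
  assumes "prob_space M" and indep: "prob_space.indep_vars M (\<lambda>_. N) Y {1..}"
    and distributed: "\<And>n. 1 \<le> n \<Longrightarrow> distr M N (Y n) = P" and f[measurable]: "f \<in> borel_measurable N"
  shows "iid_sequence M (\<lambda>i \<omega>. f (Y (Suc i) \<omega>))"
    and "\<And>i. distr M borel (\<lambda>\<omega>. f (Y (Suc i) \<omega>)) = distr P borel f"
proof -
  interpret prob_space M by fact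
  have Y[measurable]: "Y (Suc i) \<in> measurable M N" for i using indep by (auto simp: indep_vars_def2)
  show law: "distr M borel (\<lambda>\<omega>. f (Y (Suc i) \<omega>)) = distr P borel f" for i
    using distr_distr[OF f Y[of i]] distributed[of "Suc i"] by (simp add: comp_def)
  have range_Suc: "range Suc = {1..}"
  proof safe
    fix n :: nat assume "1 \<le> n"
    then show "n \<in> range Suc" by (intro image_eqI[of _ _ "n - 1"]) auto
  qed simp
  have 1: "indep_vars (\<lambda>_. borel) (\<lambda>i \<omega>. f (Y i \<omega>)) (range Suc)"
    unfolding range_Suc by (rule indep_vars_compose2[OF indep]) simp
  show "iid_sequence M (\<lambda>i \<omega>. f (Y (Suc i) \<omega>))"
  proof
    show "indep_vars (\<lambda>_. borel) (\<lambda>i \<omega>. f (Y (Suc i) \<omega>)) UNIV"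
      by (rule indep_vars_reindex[OF 1]) simp
  qed (simp add: law)
qed

text \<open>Serves for the truncated local costs, whose empirical averages bound those of the random
  barycenters from below.\<close>

lemma empirical_mean_bounded:
  fixes h :: "'b \<Rightarrow> ennreal"
  assumes M: "prob_space M" and indep: "prob_space.indep_vars M (\<lambda>_. N) Y {1..}"
    and distributed: "\<And>n. 1 \<le> n \<Longrightarrow> distr M N (Y n) = P" and h[measurable]: "h \<in> borel_measurable N"
    and bound: "\<And>y. h y \<le> ennreal K" and K: "0 < K"
  shows "AE \<omega> in M. (\<lambda>n. \<integral>\<^sup>+y. h y \<partial>empirical N n (\<lambda>i. Y i \<omega>)) \<longlonglongrightarrow> (\<integral>\<^sup>+y. h y \<partial>P)"
proof -
  interpret prob_space M by fact
  have Y[measurable]: "Y i \<in> measurable M N" if "1 \<le> i" for i using indep that by (auto simp: indep_vars_def2)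
  define f where "f y = enn2real (h y)" for y
  have f[measurable]: "f \<in> borel_measurable N" unfolding f_def by measurable
  have hf: "h y = ennreal (f y)" for y
    using le_less_trans[OF bound[of y] ennreal_less_top] by (simp add: f_def)
  have f_bd: "0 \<le> f y" "f y \<le> K" for y
    using bound[of y] K unfolding f_def by (auto intro: enn2real_leI)
  interpret X: iid_sequence M "\<lambda>i \<omega>. f (Y (Suc i) \<omega>)"
    by (rule iid_sequence_compose(1)[OF M indep distributed f])
  have law: "distr M borel (\<lambda>\<omega>. f (Y (Suc 0) \<omega>)) = distr P borel f"
    by (rule iid_sequence_compose(2)[OF M indep distributed f])
  have P: "distr M N (Y 1) = P" by (rule distributed) simp
  have "ennreal (expectation (\<lambda>\<omega>. f (Y (Suc 0) \<omega>))) = (\<integral>\<^sup>+\<omega>. ennreal (f (Y (Suc 0) \<omega>)) \<partial>M)"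
    by (rule nn_integral_eq_integral[symmetric], rule integrable_const_bound[where B = K]) (use f_bd in auto)
  also have "\<dots> = (\<integral>\<^sup>+y. h y \<partial>P)"
    unfolding P[symmetric] by (simp add: nn_integral_distr hf)
  finally have E: "ennreal (expectation (\<lambda>\<omega>. f (Y (Suc 0) \<omega>))) = (\<integral>\<^sup>+y. h y \<partial>P)" .
  have "AE \<omega> in M. (\<lambda>n. (\<Sum>i<n. f (Y (Suc i) \<omega>)) / n) \<longlonglongrightarrow> expectation (\<lambda>\<omega>. f (Y (Suc 0) \<omega>))"
    by (rule X.slln_bounded[of K]) (use f_bd K in auto)
  then show ?thesis using AE_space
  proof eventually_elim
    case (elim \<omega>)
    from tendsto_ennrealI[OF elim(1)] have "(\<lambda>n. ennreal ((\<Sum>i<n. f (Y (Suc i) \<omega>)) / n)) \<longlonglongrightarrow> (\<integral>\<^sup>+y. h y \<partial>P)"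
      by (simp add: E)
    moreover have "\<forall>\<^sub>F n in sequentially. ennreal ((\<Sum>i<n. f (Y (Suc i) \<omega>)) / n) = (\<integral>\<^sup>+y. h y \<partial>empirical N n (\<lambda>i. Y i \<omega>))"
      using eventually_ge_at_top[of 1]
    proof eventually_elim
      case n: (elim n)
      have "(\<integral>\<^sup>+y. h y \<partial>empirical N n (\<lambda>i. Y i \<omega>)) = ennreal (1 / n) * (\<Sum>i=1..n. ennreal (f (Y i \<omega>)))"
        using n elim(2) measurable_space[OF Y] by (subst nn_integral_empirical) (auto simp: hf)
      also have "\<dots> = ennreal ((\<Sum>i<n. f (Y (Suc i) \<omega>)) / n)"
        using f_bd by (simp add: sum.atLeast1_atMost_eq ennreal_mult'[symmetric] sum_nonneg)
      finally show ?case by simp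
    qed
    ultimately show ?case by (rule Lim_transform_eventually)
  qed
qed

text \<open>Serves for the cost of a fixed barycenter, which may be unbounded but is integrable, and
  whose averages have to be controlled only from above.\<close>

lemma empirical_mean_upper:
  fixes h :: "'b \<Rightarrow> ennreal"
  assumes M: "prob_space M" and indep: "prob_space.indep_vars M (\<lambda>_. N) Y {1..}"
    and distributed: "\<And>n. 1 \<le> n \<Longrightarrow> distr M N (Y n) = P" and h[measurable]: "h \<in> borel_measurable N"
    and finite: "\<And>y. y \<in> space N \<Longrightarrow> h y < \<infinity>" and int: "(\<integral>\<^sup>+y. h y \<partial>P) < \<infinity>"
  shows "AE \<omega> in M. \<forall>e>0. \<forall>\<^sub>F n in sequentially.
    (\<integral>\<^sup>+y. h y \<partial>empirical N n (\<lambda>i. Y i \<omega>)) \<le> (\<integral>\<^sup>+y. h y \<partial>P) + ennreal e"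
proof -
  interpret prob_space M by fact
  have Y[measurable]: "Y i \<in> measurable M N" if "1 \<le> i" for i using indep that by (auto simp: indep_vars_def2)
  define f where "f y = enn2real (h y)" for y
  have f[measurable]: "f \<in> borel_measurable N" unfolding f_def by measurable
  have hf: "h y = ennreal (f y)" if "y \<in> space N" for y
    using finite[OF that] by (simp add: f_def)
  have f_bd: "0 \<le> f y" for y by (simp add: f_def)
  interpret X: iid_sequence M "\<lambda>i \<omega>. f (Y (Suc i) \<omega>)"
    by (rule iid_sequence_compose(1)[OF M indep distributed f])
  have P: "distr M N (Y 1) = P" by (rule distributed) simp
  have nn: "(\<integral>\<^sup>+\<omega>. ennreal (f (Y (Suc 0) \<omega>)) \<partial>M) = (\<integral>\<^sup>+y. h y \<partial>P)"
  proof -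
    have "(\<integral>\<^sup>+y. h y \<partial>P) = (\<integral>\<^sup>+\<omega>. h (Y 1 \<omega>) \<partial>M)"
      unfolding P[symmetric] by (rule nn_integral_distr) auto
    also have "\<dots> = (\<integral>\<^sup>+\<omega>. ennreal (f (Y (Suc 0) \<omega>)) \<partial>M)"
      using measurable_space[OF Y[of 1]] by (intro nn_integral_cong) (simp add: hf)
    finally show ?thesis by simp
  qed
  have int_f: "integrable M (\<lambda>\<omega>. f (Y (Suc 0) \<omega>))"
    by (rule integrableI_nonneg) (use nn int f_bd in auto)
  have E: "ennreal (expectation (\<lambda>\<omega>. f (Y (Suc 0) \<omega>))) = (\<integral>\<^sup>+y. h y \<partial>P)"
    using nn_integral_eq_integral[OF int_f] f_bd nn by simp
  have "AE \<omega> in M. \<forall>e>0. \<forall>\<^sub>F n in sequentially. (\<Sum>i<n. f (Y (Suc i) \<omega>)) / n \<le> expectation (\<lambda>\<omega>. f (Y (Suc 0) \<omega>)) + e"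
    by (rule X.slln_upper[OF int_f]) (use f_bd in auto)
  then show ?thesis using AE_space
  proof (eventually_elim, intro allI impI)
    case (elim \<omega>)
    fix e :: real assume e: "0 < e"
    show "\<forall>\<^sub>F n in sequentially. (\<integral>\<^sup>+y. h y \<partial>empirical N n (\<lambda>i. Y i \<omega>)) \<le> (\<integral>\<^sup>+y. h y \<partial>P) + ennreal e"
      using elim(1)[rule_format, OF e] eventually_ge_at_top[of 1]
    proof eventually_elim
      case n: (elim n)
      have "(\<integral>\<^sup>+y. h y \<partial>empirical N n (\<lambda>i. Y i \<omega>)) = ennreal (1 / n) * (\<Sum>i=1..n. h (Y i \<omega>))"
        using n elim(2) measurable_space[OF Y] by (subst nn_integral_empirical) auto
      also have "(\<Sum>i=1..n. h (Y i \<omega>)) = (\<Sum>i=1..n. ennreal (f (Y i \<omega>)))"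
        using elim(2) measurable_space[OF Y] by (intro sum.cong) (auto simp: hf)
      also have "ennreal (1 / n) * \<dots> = ennreal ((\<Sum>i<n. f (Y (Suc i) \<omega>)) / n)"
        using f_bd by (simp add: sum.atLeast1_atMost_eq ennreal_mult'[symmetric] sum_nonneg)
      also have "\<dots> \<le> ennreal (expectation (\<lambda>\<omega>. f (Y (Suc 0) \<omega>)) + e)" using n(1) by (rule ennreal_leI)
      also have "\<dots> = (\<integral>\<^sup>+y. h y \<partial>P) + ennreal e"
        unfolding E[symmetric] using e f_bd by (intro ennreal_plus) auto
      finally show ?case .
    qed
  qed
qed

context transport
begin

section \<open>Local costs and moment bounds for barycenters\<close>

lemma J_finite:
  assumes \<mu>: "\<mu> \<in> fin_moment" and \<nu>: "\<nu> \<in> fin_moment"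
  shows "J \<mu> \<nu> < \<infinity>"
proof -
  obtain \<gamma> where \<gamma>: "\<gamma> \<in> couplings \<mu> \<nu>"
    using couplings_nonempty[OF fin_momentD(1)[OF \<mu>] fin_momentD(1)[OF \<nu>]] by blast
  have "J \<mu> \<nu> \<le> coupling_cost c \<gamma>" by (rule transport_cost_le_coupling[OF \<gamma>])
  also have "\<dots> \<le> (\<integral>\<^sup>+z. ennreal (A + B * (c x0 (fst z) + c x0 (snd z))) \<partial>\<gamma>)"
    by (intro nn_integral_mono ennreal_leI cost_le_weights)
  also have "\<dots> = ennreal (A + B * (rmoment \<mu> + rmoment \<nu>))"
    using A_nonneg B_pos by (intro nn_integral_weights[OF \<gamma> \<mu> \<nu>]) auto
  finally show ?thesis by (rule le_less_trans) simp
qed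

text \<open>A nonrandom function of \<open>\<mu>\<close> that lies below
  \<open>J \<mu> \<nu>\<close> whenever \<open>\<nu>\<close> has finite moment and
  \<open>coords \<nu>\<close> lies in \<open>V\<close>, so that the law of large numbers applies to
  it even if \<open>\<nu>\<close> is random.\<close>

definition local_cost :: "(nat \<Rightarrow> real) set \<Rightarrow> 'a measure \<Rightarrow> ennreal" where
  "local_cost V \<mu> = (INF \<nu>\<in>fin_moment \<inter> coords -` V. J \<mu> \<nu>)"

lemma local_cost_measurable[measurable]: "local_cost V \<in> borel_measurable (borel_E0 c x0)"
  unfolding local_cost_def[abs_def] by (rule INF_J_left_measurable) simp

text \<open>If the local costs stayed below the bound along a subsequence, near-minimizers
  \<open>\<eta> j\<close> would have coordinates tending to \<open>(coords \<nu>')(0 := m)\<close>,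
  hence converge weakly to \<open>\<nu>'\<close> with moments tending to \<open>m\<close>, against
  \<open>transport_cost_lower_limit\<close>. The truncation level grows with \<open>j\<close> and
  disappears in the limit.\<close>

lemma local_cost_lower_limit:
  assumes \<mu>: "\<mu> \<in> fin_moment" and \<nu>': "\<nu>' \<in> fin_moment" and le: "rmoment \<nu>' \<le> m"
    and V: "\<And>j. V j \<subseteq> ball ((coords \<nu>')(0 := m)) (1 / Suc j)"
  shows "J \<mu> \<nu>' + ennreal ((m - rmoment \<nu>') / B) \<le> liminf (\<lambda>j. min (local_cost (V j) \<mu>) (ennreal (real (Suc j))))"
  unfolding le_Liminf_iff
proof (intro allI impI)
  fix y assume y: "y < J \<mu> \<nu>' + ennreal ((m - rmoment \<nu>') / B)"
  \<comment> \<open>A local cost of at most \<open>y\<close> need not be attained; the intermediate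
    value leaves room for measures with cost strictly below \<open>y'\<close>.\<close>
  obtain y' where y': "y < y'" "y' < J \<mu> \<nu>' + ennreal ((m - rmoment \<nu>') / B)"
    using dense[OF y] by blast
  obtain b where b: "y = ennreal b" "0 \<le> b" using y by (cases y) auto
  have "\<forall>\<^sub>F j in sequentially. y < local_cost (V j) \<mu>"
  proof (rule ccontr)
    assume "\<not> ?thesis"
    then obtain u :: "nat \<Rightarrow> nat" where u: "strict_mono u" "\<And>j. \<not> y < local_cost (V (u j)) \<mu>"
      using not_eventually_sequentiallyD by blast
    have "\<exists>\<eta>. \<eta> \<in> fin_moment \<and> coords \<eta> \<in> V (u j) \<and> J \<mu> \<eta> < y'" for j
    proof -
      have "local_cost (V (u j)) \<mu> < y'" using u(2)[of j] y'(1) by (simp add: not_less le_less_trans)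
      then show ?thesis unfolding local_cost_def INF_less_iff by blast
    qed
    then obtain \<eta> where \<eta>: "\<And>j. \<eta> j \<in> fin_moment" "\<And>j. coords (\<eta> j) \<in> V (u j)" "\<And>j. J \<mu> (\<eta> j) < y'" by metis
    have lim: "(\<lambda>j. coords (\<eta> j)) \<longlonglongrightarrow> (coords \<nu>')(0 := m)"
    proof (rule tendstoI)
      fix e :: real assume "0 < e"
      have "\<forall>\<^sub>F j in sequentially. 1 / real (Suc j) < e"
        by (rule order_tendstoD(2)[OF LIMSEQ_Suc[OF lim_1_over_n] \<open>0 < e\<close>])
      then show "\<forall>\<^sub>F j in sequentially. dist (coords (\<eta> j)) ((coords \<nu>')(0 := m)) < e"
      proof eventually_elim
        case (elim j)
        have "dist (coords (\<eta> j)) ((coords \<nu>')(0 := m)) < 1 / Suc (u j)"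
          using \<eta>(2)[of j] V[of "u j"] by (auto simp: dist_commute)
        also have "\<dots> \<le> 1 / Suc j" using seq_suble[OF u(1), of j] by (simp add: frac_le)
        finally show ?case using elim by simp
      qed
    qed
    obtain \<sigma> where \<sigma>: "\<sigma> \<in> fin_moment" "rmoment \<sigma> \<le> ((coords \<nu>')(0 := m)) 0" "\<And>j. coords \<sigma> (Suc j) = ((coords \<nu>')(0 := m)) (Suc j)"
      "weakly_converges \<eta> \<sigma>" "(\<lambda>n. rmoment (\<eta> n)) \<longlonglongrightarrow> ((coords \<nu>')(0 := m)) 0"
      by (rule coords_limit[OF \<eta>(1) lim], rule that)
    have "\<sigma> = \<nu>'" using \<sigma>(3) by (intro coords_inj[OF \<sigma>(1) \<nu>']) simp
    then have w: "weakly_converges \<eta> \<nu>'" "(\<lambda>n. rmoment (\<eta> n)) \<longlonglongrightarrow> m" using \<sigma>(4,5) by simp_all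
    obtain \<gamma> where \<gamma>: "\<gamma> \<in> couplings \<mu> \<nu>'"
      "coupling_cost c \<gamma> + ennreal ((m - rmoment \<nu>') / B) \<le> liminf (\<lambda>n. J \<mu> (\<eta> n))"
      by (rule transport_cost_lower_limit[OF \<mu> \<eta>(1) \<nu>' w le])
    have "J \<mu> \<nu>' + ennreal ((m - rmoment \<nu>') / B) \<le> liminf (\<lambda>n. J \<mu> (\<eta> n))"
      by (rule order.trans[OF add_right_mono[OF transport_cost_le_coupling[OF \<gamma>(1)]] \<gamma>(2)])
    also have "\<dots> \<le> liminf (\<lambda>n. y')"
      by (intro Liminf_mono always_eventually allI less_imp_le \<eta>(3))
    also have "\<dots> = y'" by (simp add: Liminf_const)
    finally show False using y'(2) by simp
  qed
  moreover have "\<forall>\<^sub>F j in sequentially. y < ennreal (real (Suc j))"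
    using eventually_gt_at_top[of "nat \<lceil>b\<rceil>"]
  proof eventually_elim
    case (elim j)
    then have "b < real (Suc j)" by linarith
    then show ?case using b by (simp add: ennreal_less_iff del: of_nat_Suc)
  qed
  ultimately show "\<forall>\<^sub>F j in sequentially. y < min (local_cost (V j) \<mu>) (ennreal (real (Suc j)))"
    by eventually_elim simp
qed

text \<open>The growth bound is used twice, from \<open>\<nu>\<close> through \<open>\<mu>\<close>
  to \<open>\<nu>0\<close>, and averaged over \<open>\<mu>\<close>. This turns bounds for average
  costs into a bound for the moment of a barycenter.\<close>

lemma cost_average_le:
  assumes Q: "prob_space Q" "sets Q = sets (borel_E0 c x0)" and \<nu>: "\<nu> \<in> fin_moment" and \<nu>0: "\<nu>0 \<in> fin_moment"
  shows "moment \<nu> \<le> ennreal A + ennreal B * (ennreal A + ennreal B * (moment \<nu>0 + (\<integral>\<^sup>+\<mu>. J \<mu> \<nu>0 \<partial>Q)) + (\<integral>\<^sup>+\<mu>. J \<mu> \<nu> \<partial>Q))"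
proof -
  interpret Q: prob_space Q by fact
  note [measurable_cong] = Q(2)
  note [measurable] = J_left_measurable[OF \<nu>] J_left_measurable[OF \<nu>0]
  have space_Q: "space Q = fin_moment" using sets_eq_imp_space_eq[OF Q(2)] by (simp add: space_borel_E0)
  have "moment \<nu> = (\<integral>\<^sup>+\<mu>. moment \<nu> \<partial>Q)" by (simp add: Q.emeasure_space_1)
  also have "\<dots> \<le> (\<integral>\<^sup>+\<mu>. ennreal A + ennreal B * (ennreal A + ennreal B * (moment \<nu>0 + J \<mu> \<nu>0) + J \<mu> \<nu>) \<partial>Q)"
  proof (rule nn_integral_mono)
    fix \<mu> assume "\<mu> \<in> space Q"
    then have \<mu>: "\<mu> \<in> probs borel" using fin_momentD(1) space_Q by simp
    have "moment \<mu> \<le> ennreal A + ennreal B * (moment \<nu>0 + J \<mu> \<nu>0)" by (rule moment_le(2)[OF \<mu> fin_momentD(1)[OF \<nu>0]])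
    then show "moment \<nu> \<le> ennreal A + ennreal B * (ennreal A + ennreal B * (moment \<nu>0 + J \<mu> \<nu>0) + J \<mu> \<nu>)"
      by (intro order.trans[OF moment_le(1)[OF \<mu> fin_momentD(1)[OF \<nu>]]] add_left_mono mult_left_mono add_right_mono) auto
  qed
  also have "\<dots> = ennreal A + ennreal B * (ennreal A + ennreal B * (moment \<nu>0 + (\<integral>\<^sup>+\<mu>. J \<mu> \<nu>0 \<partial>Q)) + (\<integral>\<^sup>+\<mu>. J \<mu> \<nu> \<partial>Q))"
    by (simp add: nn_integral_add nn_integral_cmult Q.emeasure_space_1)
  finally show ?thesis .
qed

text \<open>As \<open>G\<close> is bounded below at \<open>\<nu>\<close>, a finite functional has a
  finite average cost, so some \<open>\<mu>\<close> of finite moment has finite cost to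
  \<open>\<nu>\<close>.\<close>

lemma Bar_imp_fin_moment:
  assumes Q: "prob_space Q" "sets Q = sets (borel_E0 c x0)" and \<nu>: "\<nu> \<in> Bar c G Q"
    and G: "ereal g \<le> G \<nu>"
  shows "\<nu> \<in> fin_moment" "(\<integral>\<^sup>+\<mu>. J \<mu> \<nu> \<partial>Q) < \<infinity>" "\<bar>G \<nu>\<bar> \<noteq> \<infinity>"
proof -
  have probs: "\<nu> \<in> probs borel" and fin: "\<bar>frechet_functional c G Q \<nu>\<bar> \<noteq> \<infinity>"
    using \<nu> by (auto simp: Bar_def)
  show int: "(\<integral>\<^sup>+\<mu>. J \<mu> \<nu> \<partial>Q) < \<infinity>"
  proof (rule ccontr)
    assume "\<not> ?thesis"
    then have "(\<integral>\<^sup>+\<mu>. J \<mu> \<nu> \<partial>Q) = \<infinity>" by (simp add: not_less top_unique)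
    then show False using fin G unfolding frechet_functional_def by (cases "G \<nu>") auto
  qed
  then obtain I where I: "(\<integral>\<^sup>+\<mu>. J \<mu> \<nu> \<partial>Q) = ennreal I" "0 \<le> I"
    by (cases "\<integral>\<^sup>+\<mu>. J \<mu> \<nu> \<partial>Q") auto
  then show "\<bar>G \<nu>\<bar> \<noteq> \<infinity>"
    using fin G unfolding frechet_functional_def by (cases "G \<nu>") (auto simp: enn2ereal_ennreal)
  have "\<exists>\<mu>\<in>fin_moment. J \<mu> \<nu> < \<infinity>"
  proof (rule ccontr)
    assume "\<not> ?thesis"
    moreover have "space Q = fin_moment" using sets_eq_imp_space_eq[OF Q(2)] by (simp add: space_borel_E0)
    ultimately have "(\<integral>\<^sup>+\<mu>. J \<mu> \<nu> \<partial>Q) = (\<integral>\<^sup>+\<mu>. \<infinity> \<partial>Q)"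
      by (intro nn_integral_cong) (auto simp: not_less top_unique)
    then show False using int by (simp add: prob_space.emeasure_space_1[OF Q(1)])
  qed
  then obtain \<mu> where \<mu>: "\<mu> \<in> fin_moment" "J \<mu> \<nu> < \<infinity>" by blast
  then show "\<nu> \<in> fin_moment" using fin_moment_if_cost_finite[OF fin_momentD(1)[OF \<mu>(1)] probs] by simp
qed

text \<open>Wald's argument: near the limit point \<open>(coords \<nu>')(0 := m)\<close> the empirical averages of
  \<open>J\<close> are bounded from below by those of \<open>local_cost\<close>, to which the law of large numbers
  applies because only countably many sets \<open>V\<close> are involved. If the moments did not converge,
  the resulting lower bound would exceed the minimum by \<open>(m - rmoment \<nu>') / B\<close>.\<close>

lemma empirical_barycenters_subsequence:
  fixes G :: "'a measure \<Rightarrow> ereal" and P and \<nu>0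
  assumes P: "P \<in> probs (borel_E0 c x0)"
    and \<nu>0: "\<nu>0 \<in> Bar c G P"
    and G_bound: "\<And>\<nu>. \<nu> \<in> probs borel \<Longrightarrow> ereal g \<le> G \<nu>" and G_lsc: "weakly_lsc G"
    and basis: "topological_basis \<V>"
    and Q: "\<And>n. 1 \<le> n \<Longrightarrow> prob_space (Q n)" "\<And>n. sets (Q n) = sets (borel_E0 c x0)"
    and upper: "\<And>e. 0 < e \<Longrightarrow> \<forall>\<^sub>F n in sequentially. (\<integral>\<^sup>+\<mu>. J \<mu> \<nu>0 \<partial>Q n) \<le> (\<integral>\<^sup>+\<mu>. J \<mu> \<nu>0 \<partial>P) + ennreal e"
    and lower: "\<And>V j. V \<in> \<V> \<Longrightarrow> (\<lambda>n. \<integral>\<^sup>+\<mu>. min (local_cost V \<mu>) (ennreal (real (Suc j))) \<partial>Q n)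
      \<longlonglongrightarrow> (\<integral>\<^sup>+\<mu>. min (local_cost V \<mu>) (ennreal (real (Suc j))) \<partial>P)"
    and \<nu>: "\<And>n. 1 \<le> n \<Longrightarrow> \<nu> n \<in> Bar c G (Q n)" "\<And>n. 1 \<le> n \<Longrightarrow> \<nu> n \<in> fin_moment"
    and s: "filterlim s at_top sequentially"
  shows "\<exists>q \<nu>'. strict_mono (q :: nat \<Rightarrow> nat) \<and> \<nu>' \<in> Bar c G P \<and> \<nu>' \<in> fin_moment \<and>
    (\<lambda>k. coords (\<nu> (s (q k)))) \<longlonglongrightarrow> coords \<nu>'"
proof -
  interpret P: prob_space P using P by (simp add: probs_iff)
  have sets_P[measurable_cong]: "sets P = sets (borel_E0 c x0)" using P by (simp add: probs_iff)
  have space_P: "space P = fin_moment" using sets_eq_imp_space_eq[OF sets_P] by (simp add: space_borel_E0)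
  note [measurable_cong] = Q(2)
  have \<nu>0_probs: "\<nu>0 \<in> probs borel" using \<nu>0 by (simp add: Bar_def)
  note \<nu>0_fin = Bar_imp_fin_moment[OF P.prob_space_axioms sets_P \<nu>0 G_bound[OF \<nu>0_probs]]
  define I0 where "I0 = (\<integral>\<^sup>+\<mu>. J \<mu> \<nu>0 \<partial>P)"
  obtain i0 where i0: "I0 = ennreal i0" "0 \<le> i0" using \<nu>0_fin(2) unfolding I0_def[symmetric] by (cases I0) auto
  obtain g0 where g0: "G \<nu>0 = ereal g0" using \<nu>0_fin(3) by (cases "G \<nu>0") auto
  define a where "a n = (\<integral>\<^sup>+\<mu>. J \<mu> \<nu>0 \<partial>Q n)" for n
  define b where "b n = (\<integral>\<^sup>+\<mu>. J \<mu> (\<nu> n) \<partial>Q n)" for n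
  have \<nu>_probs: "\<nu> n \<in> probs borel" if "1 \<le> n" for n using \<nu>(2)[OF that] by (rule fin_momentD(1))
  have min: "enn2ereal (b n) + G (\<nu> n) \<le> enn2ereal (a n) + ereal g0" if "1 \<le> n" for n
    using \<nu>(1)[OF that] \<nu>0_probs unfolding Bar_def frechet_functional_def a_def b_def g0[symmetric] by blast
  obtain n0 where n0: "\<And>n. n0 \<le> n \<Longrightarrow> a n \<le> I0 + ennreal 1"
    using upper[of 1] unfolding a_def I0_def eventually_sequentially by auto
  \<comment> \<open>The successor also excludes the index 0, for which \<open>Q\<close> is not
    assumed to be a probability measure.\<close>
  define N where "N = Suc n0"
  \<comment> \<open>Minimality against \<open>\<nu>0\<close> bounds \<open>b n + G (\<nu> n)\<close>
    by \<open>i0 + 1 + g0\<close>, and \<open>G\<close> is at least \<open>g\<close>.\<close>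
  define R where "R = i0 + 1 + g0 - g"
  have b_bound: "b n \<le> ennreal R" if n: "N \<le> n" for n
  proof -
    have n1: "1 \<le> n" using n by (simp add: N_def)
    have "a n \<le> ennreal (i0 + 1)" using n0[of n] n i0 by (simp add: N_def)
    then have "enn2ereal (a n) \<le> ereal (i0 + 1)"
      using i0(2) enn2ereal_ennreal[of "i0 + 1"] by (metis add_nonneg_nonneg less_eq_ennreal.rep_eq zero_le_one)
    then have "enn2ereal (b n) + ereal g \<le> ereal (i0 + 1) + ereal g0"
      using min[OF n1] add_left_mono[OF G_bound[OF \<nu>_probs[OF n1]], of "enn2ereal (b n)"]
      by (meson add_right_mono order.trans)
    then have le: "enn2ereal (b n) \<le> ereal R"
      by (cases "enn2ereal (b n)") (auto simp: R_def)
    moreover have "0 \<le> enn2ereal (b n)" by simp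
    ultimately have "0 \<le> R" by (metis ereal_less_eq(5) order.trans)
    then show ?thesis using le by (simp add: less_eq_ennreal.rep_eq enn2ereal_ennreal)
  qed
  \<comment> \<open>The bound of \<open>cost_average_le\<close> when the averages \<open>a n\<close>
    and \<open>b n\<close> are at most \<open>i0 + 1\<close> and
    \<open>\<bar>R\<bar>\<close>.\<close>
  define D where "D = A + B * (A + B * (rmoment \<nu>0 + (i0 + 1)) + \<bar>R\<bar>)"
  have moment_bound: "rmoment (\<nu> n) \<le> D" if n: "N \<le> n" for n
  proof -
    have n1: "1 \<le> n" using n by (simp add: N_def)
    have "a n \<le> ennreal (i0 + 1)" using n0[of n] n i0 by (simp add: N_def)
    moreover have "b n \<le> ennreal \<bar>R\<bar>" by (rule order.trans[OF b_bound[OF n]]) (simp add: ennreal_leI)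
    ultimately have "moment (\<nu> n) \<le> ennreal A + ennreal B * (ennreal A + ennreal B * (ennreal (rmoment \<nu>0) + ennreal (i0 + 1)) + ennreal \<bar>R\<bar>)"
      using cost_average_le[OF Q(1)[OF n1] Q(2) \<nu>(2)[OF n1] \<nu>0_fin(1)]
      unfolding a_def[symmetric] b_def[symmetric] fin_momentD(2)[OF \<nu>0_fin(1)]
      by (elim order.trans) (intro add_mono mult_left_mono order.refl, auto)
    also have "\<dots> = ennreal D"
      unfolding D_def using A_nonneg B_pos rmoment_nonneg[of \<nu>0] i0(2)
      by (simp add: ennreal_mult' ennreal_plus)
    finally have "ennreal (rmoment (\<nu> n)) \<le> ennreal D" unfolding fin_momentD(2)[OF \<nu>(2)[OF n1]] .
    moreover have "0 \<le> D" unfolding D_def using A_nonneg B_pos rmoment_nonneg[of \<nu>0] i0(2) by simp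
    ultimately show ?thesis by simp
  qed
  obtain K where K: "\<And>k. K \<le> k \<Longrightarrow> N \<le> s k"
    using s unfolding filterlim_at_top eventually_sequentially by blast
  \<comment> \<open>Drops an initial piece so that all remaining indices are at least
    \<open>N\<close>, where the moment bound holds.\<close>
  define s' where "s' k = s (k + K)" for k
  have s'_ge: "N \<le> s' k" for k using K by (simp add: s'_def)
  have s'_1: "1 \<le> s' k" for k using s'_ge[of k] by (simp add: N_def)
  obtain q :: "nat \<Rightarrow> nat" and \<nu>' m where q: "strict_mono q" "\<nu>' \<in> fin_moment" "weakly_converges (\<lambda>n. \<nu> (s' (q n))) \<nu>'"
      "(\<lambda>n. rmoment (\<nu> (s' (q n)))) \<longlonglongrightarrow> m" "rmoment \<nu>' \<le> m"
    by (rule weak_compactness[of "\<lambda>n. \<nu> (s' n)", OF \<nu>(2)[OF s'_1] moment_bound[OF s'_ge]], rule that)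
  define t where "t k = s' (q k)" for k
  have q_K: "strict_mono (\<lambda>k. q k + K)" using q(1) by (auto simp: strict_mono_def)
  have t: "filterlim t at_top sequentially"
    using filterlim_compose[OF s filterlim_subseq[OF q_K]] by (simp add: t_def[abs_def] s'_def)
  have t_1: "1 \<le> t k" for k using s'_1 by (simp add: t_def)
  define p where "p = (coords \<nu>')(0 := m)"
  have p_lim: "(\<lambda>k. coords (\<nu> (t k))) \<longlonglongrightarrow> p"
    unfolding p_def t_def by (rule coords_tendsto[OF q(3,4)])
  define d where "d = (m - rmoment \<nu>') / B"
  have d: "0 \<le> d" using q(5) B_pos by (simp add: d_def)
  have "\<exists>V. V \<in> \<V> \<and> p \<in> V \<and> V \<subseteq> ball p (1 / Suc j)" for j :: nat
    by (rule topological_basisE[OF basis, of "ball p (1 / Suc j)" p]) auto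
  then obtain V where V: "\<And>j. V j \<in> \<V>" "\<And>j. p \<in> V j" "\<And>j. V j \<subseteq> ball p (1 / Suc j)" by metis
  define L where "L j = (\<integral>\<^sup>+\<mu>. min (local_cost (V j) \<mu>) (ennreal (real (Suc j))) \<partial>P)" for j
  define I where "I = (\<integral>\<^sup>+\<mu>. J \<mu> \<nu>' \<partial>P)"
  have [measurable]: "(\<lambda>\<mu>. J \<mu> \<nu>') \<in> borel_measurable P" using J_left_measurable[OF q(2)] by measurable
  have "I + ennreal d = (\<integral>\<^sup>+\<mu>. J \<mu> \<nu>' + ennreal d \<partial>P)"
    by (simp add: I_def nn_integral_add P.emeasure_space_1)
  also have "\<dots> \<le> (\<integral>\<^sup>+\<mu>. liminf (\<lambda>j. min (local_cost (V j) \<mu>) (ennreal (real (Suc j)))) \<partial>P)"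
    unfolding d_def
    by (intro nn_integral_mono local_cost_lower_limit) (use q(2,5) V(3) in \<open>auto simp: space_P p_def\<close>)
  also have "\<dots> \<le> liminf L"
    unfolding L_def by (rule nn_integral_liminf) measurable
  also have "\<dots> \<le> liminf (\<lambda>k. b (t k))"
  proof -
    \<comment> \<open>Here \<open>j\<close> stays fixed while \<open>k\<close> grows: the
      coordinates of the barycenters enter \<open>V j\<close>, and the law of large numbers gives
      the limit of the truncated averages.\<close>
    have "L j \<le> liminf (\<lambda>k. b (t k))" for j
    proof -
      have lim: "(\<lambda>k. \<integral>\<^sup>+\<mu>. min (local_cost (V j) \<mu>) (ennreal (real (Suc j))) \<partial>Q (t k)) \<longlonglongrightarrow> L j"
        using filterlim_compose[OF lower[OF V(1)] t] by (simp add: L_def)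
      have "open (V j)" using topological_basis_open[OF basis V(1)] .
      then have "\<forall>\<^sub>F k in sequentially. coords (\<nu> (t k)) \<in> V j"
        by (rule topological_tendstoD[OF p_lim _ V(2)])
      then have "\<forall>\<^sub>F k in sequentially. (\<integral>\<^sup>+\<mu>. min (local_cost (V j) \<mu>) (ennreal (real (Suc j))) \<partial>Q (t k)) \<le> b (t k)"
      proof eventually_elim
        case (elim k)
        have "local_cost (V j) \<mu> \<le> J \<mu> (\<nu> (t k))" for \<mu>
          unfolding local_cost_def using elim \<nu>(2)[OF t_1] by (intro INF_lower) auto
        then show ?case unfolding b_def by (intro nn_integral_mono) (auto intro: min.coboundedI1)
      qed
      from Liminf_mono[OF this] show ?thesis by (simp only: lim_imp_Liminf[OF trivial_limit_sequentially lim])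
    qed
    then have "liminf L \<le> liminf (\<lambda>j. liminf (\<lambda>k. b (t k)))" by (intro Liminf_mono always_eventually allI)
    then show ?thesis by (simp add: Liminf_const)
  qed
  finally have Id: "I + ennreal d \<le> liminf (\<lambda>k. b (t k))" .
  have le_e: "enn2ereal (I + ennreal d) + G \<nu>' \<le> ereal (i0 + g0 + e)" if e: "0 < e" for e
  proof -
    have "enn2ereal (I + ennreal d) \<le> enn2ereal (liminf (\<lambda>k. b (t k)))"
      using Id by (simp add: less_eq_ennreal.rep_eq)
    also have "\<dots> = liminf (\<lambda>k. enn2ereal (b (t k)))"
      by (rule Liminf_compose_continuous_mono[symmetric])
        (auto intro!: monoI continuous_on_enn2ereal simp: less_eq_ennreal.rep_eq)
    finally have 1: "enn2ereal (I + ennreal d) \<le> liminf (\<lambda>k. enn2ereal (b (t k)))" .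
    have 2: "G \<nu>' \<le> liminf (\<lambda>k. G (\<nu> (t k)))"
      using q(3) \<nu>_probs[OF t_1] fin_momentD(1)[OF q(2)]
      by (intro G_lsc[unfolded weakly_lsc_def, rule_format]) (simp add: t_def)
    \<comment> \<open>This bound and the next exclude a sum of opposite infinities when the liminf
      is split.\<close>
    have nonneg: "0 \<le> liminf (\<lambda>k. enn2ereal (b (t k)))" by (intro Liminf_bounded always_eventually allI) simp
    have bdd: "ereal g \<le> liminf (\<lambda>k. G (\<nu> (t k)))"
      by (intro Liminf_bounded always_eventually allI G_bound \<nu>_probs t_1)
    have "enn2ereal (I + ennreal d) + G \<nu>' \<le> liminf (\<lambda>k. enn2ereal (b (t k))) + liminf (\<lambda>k. G (\<nu> (t k)))"
      by (rule add_mono[OF 1 2])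
    also have "\<dots> \<le> liminf (\<lambda>k. enn2ereal (b (t k)) + G (\<nu> (t k)))"
      by (rule ereal_liminf_add_mono) (use nonneg bdd in auto)
    also have "\<dots> \<le> liminf (\<lambda>k. ereal (i0 + g0 + e))"
    proof (rule Liminf_mono)
      have ev: "\<forall>\<^sub>F n in sequentially. a n \<le> ennreal (i0 + e)"
        using upper[OF e] i0 e unfolding a_def[symmetric] I0_def[symmetric] by simp
      show "\<forall>\<^sub>F k in sequentially. enn2ereal (b (t k)) + G (\<nu> (t k)) \<le> ereal (i0 + g0 + e)"
        using eventually_compose_filterlim[OF ev t]
      proof eventually_elim
        case (elim k)
        then have "enn2ereal (a (t k)) \<le> ereal (i0 + e)"
          using i0(2) e by (simp add: less_eq_ennreal.rep_eq enn2ereal_ennreal del: ennreal_plus)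
        then have "enn2ereal (a (t k)) + ereal g0 \<le> ereal (i0 + e) + ereal g0" by (rule add_right_mono)
        with min[OF t_1[of k]] show ?case by (simp add: ac_simps)
      qed
    qed
    also have "\<dots> = ereal (i0 + g0 + e)" by (simp add: Liminf_const)
    finally show ?thesis .
  qed
  have le: "enn2ereal (I + ennreal d) + G \<nu>' \<le> ereal (i0 + g0)"
  proof (rule ereal_le_epsilon2)
    fix e :: real assume "0 < e"
    from le_e[OF this] show "enn2ereal (I + ennreal d) + G \<nu>' \<le> ereal (i0 + g0) + ereal e" by simp
  qed
  have \<nu>'_probs: "\<nu>' \<in> probs borel" using q(2) by (rule fin_momentD(1))
  have F0: "frechet_functional c G P \<nu>0 = ereal (i0 + g0)"
    using i0 by (simp add: frechet_functional_def I0_def[symmetric] g0 enn2ereal_ennreal)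
  have F': "frechet_functional c G P \<nu>' = enn2ereal I + G \<nu>'"
    by (simp add: frechet_functional_def I_def)
  \<comment> \<open>Minimality of \<open>\<nu>0\<close>. Since \<open>le\<close> holds with the
    additional term \<open>d\<close> on the left, the two inequalities squeeze \<open>d\<close> to
    0.\<close>
  have ge: "ereal (i0 + g0) \<le> enn2ereal I + G \<nu>'"
    using \<nu>0 \<nu>'_probs unfolding F0[symmetric] F'[symmetric] Bar_def by blast
  have "ereal g \<le> G \<nu>'" by (rule G_bound[OF \<nu>'_probs])
  have I_fin: "I \<noteq> \<top>"
    using le \<open>ereal g \<le> G \<nu>'\<close> by (cases "G \<nu>'") auto
  then obtain i where i: "I = ennreal i" "0 \<le> i" by (cases I) auto
  have Id': "enn2ereal (I + ennreal d) = ereal (i + d)"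
    using i d by (simp add: enn2ereal_ennreal ennreal_plus[symmetric] del: ennreal_plus)
  have I': "enn2ereal I = ereal i" using i by (simp add: enn2ereal_ennreal)
  obtain g' where g': "G \<nu>' = ereal g'"
    using le ge \<open>ereal g \<le> G \<nu>'\<close> unfolding Id' I' by (cases "G \<nu>'") auto
  have "d = 0" "i + g' = i0 + g0" using le ge d unfolding Id' I' g' by auto
  then have m: "m = rmoment \<nu>'" using B_pos by (simp add: d_def)
  have Bar': "\<nu>' \<in> Bar c G P"
    using \<nu>0 \<nu>'_probs \<open>i + g' = i0 + g0\<close> unfolding Bar_def mem_Collect_eq F0 F' I' g' by auto
  have "p = coords \<nu>'" by (simp add: p_def m fun_upd_idem)
  then have "(\<lambda>k. coords (\<nu> (s (q k + K)))) \<longlonglongrightarrow> coords \<nu>'"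
    using p_lim by (simp add: t_def s'_def)
  then show ?thesis using Bar' q(2) q_K by blast
qed

text \<open>The closure \<open>T\<close> of the coordinates is compact and consists of coordinates
  of measures, so an open cover of its preimage \<open>L\<close> becomes a cover of
  \<open>T\<close>. The assumption ranges over all \<open>s\<close> tending to infinity because
  indices that approximate points of the closure need not increase.\<close>

lemma precompactin_tau_J_if_subsequences:
  fixes \<nu> :: "nat \<Rightarrow> 'a measure"
  assumes \<nu>: "\<And>n. 1 \<le> n \<Longrightarrow> \<nu> n \<in> fin_moment"
    and sub: "\<And>s. filterlim s at_top sequentially \<Longrightarrow> \<exists>q \<nu>'. strict_mono (q :: nat \<Rightarrow> nat) \<and> \<nu>' \<in> fin_moment \<and>
      (\<lambda>k. coords (\<nu> (s (q k)))) \<longlonglongrightarrow> coords \<nu>'"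
  shows "precompactin (tau_J c) {\<nu> n | n. 1 \<le> n}"
proof -
  define S where "S = {\<nu> n | n. 1 \<le> n}"
  define T where "T = closure (coords ` S)"
  have conv: "\<exists>r \<nu>'. strict_mono (r :: nat \<Rightarrow> nat) \<and> \<nu>' \<in> fin_moment \<and> (\<lambda>k. x (r k)) \<longlonglongrightarrow> coords \<nu>'"
    if x: "\<And>k. x k \<in> T" for x
  proof -
    have "\<exists>n\<ge>1. dist (coords (\<nu> n)) (x k) < 1 / Suc k" for k :: nat
    proof -
      have "0 < 1 / real (Suc k)" by simp
      then obtain y where "y \<in> coords ` S" "dist y (x k) < 1 / Suc k"
        using x[of k] unfolding T_def closure_approachable by blast
      then show ?thesis unfolding S_def by blast
    qed
    then obtain n where n: "\<And>k. 1 \<le> n k" "\<And>k. dist (coords (\<nu> (n k))) (x k) < 1 / Suc k" by metis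
    have "\<exists>r \<nu>'. strict_mono (r :: nat \<Rightarrow> nat) \<and> \<nu>' \<in> fin_moment \<and> (\<lambda>k. coords (\<nu> (n (r k)))) \<longlonglongrightarrow> coords \<nu>'"
    proof (cases "filterlim n at_top sequentially")
      case True
      from sub[OF this] show ?thesis .
    next
      \<comment> \<open>The indices are then bounded along a subsequence, where only finitely many
        measures occur.\<close>
      case False
      then obtain N where "\<not> (\<forall>\<^sub>F k in sequentially. N \<le> n k)" unfolding filterlim_at_top by blast
      then obtain r :: "nat \<Rightarrow> nat" where r: "strict_mono r" "\<And>k. \<not> N \<le> n (r k)"
        using not_eventually_sequentiallyD by blast
      have fin_compact: "compact ((\<lambda>i. coords (\<nu> i)) ` {1..N})" by (intro finite_imp_compact) simp
      have all: "\<forall>k. coords (\<nu> (n (r k))) \<in> (\<lambda>i. coords (\<nu> i)) ` {1..N}"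
        using n(1) r(2) by (intro allI imageI) (simp add: not_le less_imp_le)
      obtain l q where l: "l \<in> (\<lambda>i. coords (\<nu> i)) ` {1..N}" and q: "strict_mono q"
        "((\<lambda>k. coords (\<nu> (n (r k)))) \<circ> q) \<longlonglongrightarrow> l"
        by (rule seq_compactE[OF compact_imp_seq_compact[OF fin_compact] all], rule that)
      have "strict_mono (\<lambda>k. r (q k))" using r(1) q(1) by (auto simp: strict_mono_def)
      moreover obtain v where "v \<in> {1..N}" "l = coords (\<nu> v)" using l by blast
      then have "\<nu> v \<in> fin_moment" "(\<lambda>k. coords (\<nu> (n (r (q k))))) \<longlonglongrightarrow> coords (\<nu> v)"
        using \<nu> q(2) by (auto simp: comp_def simp del: One_nat_def)
      ultimately show ?thesis by (intro exI[of _ "\<lambda>k. r (q k)"] exI[of _ "\<nu> v"]) simp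
    qed
    then obtain r \<nu>' where r: "strict_mono (r :: nat \<Rightarrow> nat)" "\<nu>' \<in> fin_moment"
      "(\<lambda>k. coords (\<nu> (n (r k)))) \<longlonglongrightarrow> coords \<nu>'" by blast
    have "(\<lambda>k. x (r k)) \<longlonglongrightarrow> coords \<nu>'"
    proof (rule tendstoI)
      fix e :: real assume "0 < e"
      then have "\<forall>\<^sub>F k in sequentially. 1 / real (Suc k) < e / 2"
        by (intro order_tendstoD(2)[OF LIMSEQ_Suc[OF lim_1_over_n]]) simp
      moreover have "\<forall>\<^sub>F k in sequentially. dist (coords (\<nu> (n (r k)))) (coords \<nu>') < e / 2"
        using tendstoD[OF r(3), of "e / 2"] \<open>0 < e\<close> by simp
      ultimately show "\<forall>\<^sub>F k in sequentially. dist (x (r k)) (coords \<nu>') < e"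
      proof eventually_elim
        case (elim k)
        have "1 / real (Suc (r k)) \<le> 1 / real (Suc k)" using seq_suble[OF r(1), of k] by (simp add: frac_le)
        then have "dist (coords (\<nu> (n (r k)))) (x (r k)) < e / 2" using n(2)[of "r k"] elim by linarith
        then show ?case
          using elim dist_triangle3[of "x (r k)" "coords \<nu>'" "coords (\<nu> (n (r k)))"] by linarith
      qed
    qed
    then show ?thesis using r by blast
  qed
  have "compact T"
    unfolding compact_eq_seq_compact_metric seq_compact_def
  proof (intro allI impI)
    fix x :: "nat \<Rightarrow> nat \<Rightarrow> real" assume x: "\<forall>k. x k \<in> T"
    then obtain r \<nu>' where r: "strict_mono (r :: nat \<Rightarrow> nat)" "(\<lambda>k. x (r k)) \<longlonglongrightarrow> coords \<nu>'" using conv by blast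
    have "coords \<nu>' \<in> T"
      by (rule closed_sequentially[OF _ _ r(2)]) (use x in \<open>auto simp: T_def\<close>)
    then show "\<exists>l\<in>T. \<exists>r. strict_mono r \<and> (x \<circ> r) \<longlonglongrightarrow> l" using r by (auto simp: comp_def)
  qed
  have T_sub: "T \<subseteq> coords ` fin_moment"
  proof
    fix x assume "x \<in> T"
    then obtain \<nu>' where "\<nu>' \<in> fin_moment" "(\<lambda>k::nat. x) \<longlonglongrightarrow> coords \<nu>'" using conv[of "\<lambda>_. x"] by blast
    moreover from this(2) have "x = coords \<nu>'" by (rule LIMSEQ_unique[OF tendsto_const])
    ultimately show "x \<in> coords ` fin_moment" by blast
  qed
  define L where "L = fin_moment \<inter> coords -` T"
  have "open (- T)" by (simp add: T_def open_Compl)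
  then have "closedin (tau_J c) (fin_moment - (fin_moment \<inter> coords -` (- T)))"
    by (intro closedin_diff fin_moment_clopen(2) openin_coords_vimage)
  also have "fin_moment - (fin_moment \<inter> coords -` (- T)) = L" by (auto simp: L_def)
  finally have L_closed: "closedin (tau_J c) L" .
  have "compactin (tau_J c) L"
    unfolding compactin_def
  proof (intro conjI allI impI)
    show "L \<subseteq> topspace (tau_J c)" using L_closed by (rule closedin_subset)
    fix \<U> assume "Ball \<U> (openin (tau_J c)) \<and> L \<subseteq> \<Union>\<U>"
    then have \<U>: "\<forall>U\<in>\<U>. openin (tau_J c) U" "L \<subseteq> \<Union>\<U>" by auto
    have "\<forall>U\<in>\<U>. \<exists>V. open V \<and> U \<inter> fin_moment = fin_moment \<inter> coords -` V"
      using \<U>(1) seq_open_imp_open_trace[OF openin_imp_seq_open] by metis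
    then obtain V where V: "\<And>U. U \<in> \<U> \<Longrightarrow> open (V U)" "\<And>U. U \<in> \<U> \<Longrightarrow> U \<inter> fin_moment = fin_moment \<inter> coords -` V U"
      by metis
    have cover: "T \<subseteq> (\<Union>U\<in>\<U>. V U)"
    proof
      fix x assume "x \<in> T"
      then obtain \<eta> where \<eta>: "\<eta> \<in> fin_moment" "x = coords \<eta>" using T_sub by blast
      then have "\<eta> \<in> L" using \<open>x \<in> T\<close> by (simp add: L_def)
      then obtain U where "U \<in> \<U>" "\<eta> \<in> U" using \<U>(2) by blast
      then show "x \<in> (\<Union>U\<in>\<U>. V U)" using V(2)[of U] \<eta> by blast
    qed
    obtain \<F> where \<F>: "\<F> \<subseteq> \<U>" "finite \<F>" "T \<subseteq> (\<Union>U\<in>\<F>. V U)"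
      by (rule compactE_image[OF \<open>compact T\<close> V(1) cover], assumption, rule that)
    have "L \<subseteq> \<Union>\<F>"
    proof
      fix \<eta> assume \<eta>: "\<eta> \<in> L"
      then obtain U where "U \<in> \<F>" "coords \<eta> \<in> V U" using \<F>(3) by (auto simp: L_def)
      then show "\<eta> \<in> \<Union>\<F>" using V(2)[of U] \<F>(1) \<eta> by (auto simp: L_def)
    qed
    then show "\<exists>\<F>. finite \<F> \<and> \<F> \<subseteq> \<U> \<and> L \<subseteq> \<Union>\<F>" using \<F> by blast
  qed
  moreover have "coords ` S \<subseteq> T" unfolding T_def by (rule closure_subset)
  then have "S \<subseteq> L" using \<nu> unfolding L_def S_def by blast
  then have "tau_J c closure_of S \<subseteq> L" by (rule closure_of_minimal[OF _ L_closed])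
  ultimately have "compactin (tau_J c) (tau_J c closure_of S)"
    by (rule closed_compactin) simp
  moreover have "S \<subseteq> topspace (tau_J c)"
    using \<open>S \<subseteq> L\<close> closedin_subset[OF L_closed] by blast
  ultimately show ?thesis unfolding precompactin_def S_def by blast
qed

text \<open>Tests the convergence on two kinds of open sets: the complement of
  \<open>fin_moment\<close>, which keeps the limit inside, and preimages under
  \<open>coords\<close>.\<close>

lemma limitin_tau_J_imp_coords_tendsto:
  assumes \<nu>: "\<forall>\<^sub>F k in sequentially. \<nu> k \<in> fin_moment" and lim: "limitin (tau_J c) \<nu> \<nu>' sequentially"
  shows "\<nu>' \<in> fin_moment" "(\<lambda>k. coords (\<nu> k)) \<longlonglongrightarrow> coords \<nu>'"
proof -
  have top: "\<nu>' \<in> topspace (tau_J c)"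
    and ev: "\<And>U. openin (tau_J c) U \<Longrightarrow> \<nu>' \<in> U \<Longrightarrow> \<forall>\<^sub>F k in sequentially. \<nu> k \<in> U"
    using lim by (auto simp: limitin_def)
  show fin: "\<nu>' \<in> fin_moment"
  proof (rule ccontr)
    assume "\<nu>' \<notin> fin_moment"
    then have "\<forall>\<^sub>F k in sequentially. \<nu> k \<in> topspace (tau_J c) - fin_moment"
      using top fin_moment_clopen(2) by (intro ev) (auto simp: closedin_def)
    with \<nu> have "\<forall>\<^sub>F k in sequentially. False" by eventually_elim simp
    then show False by simp
  qed
  show "(\<lambda>k. coords (\<nu> k)) \<longlonglongrightarrow> coords \<nu>'"
  proof (rule topological_tendstoI)
    fix V assume "open V" "coords \<nu>' \<in> V"
    then have "\<forall>\<^sub>F k in sequentially. \<nu> k \<in> fin_moment \<inter> coords -` V"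
      using fin by (intro ev openin_coords_vimage) auto
    then show "\<forall>\<^sub>F k in sequentially. coords (\<nu> k) \<in> V" by eventually_elim simp
  qed
qed

end

text \<open>Constant sequences in the consistency condition show that \<open>c\<close> vanishes
  exactly on the diagonal. Enlarging \<open>B\<close> to \<open>B + 1\<close> preserves the growth
  bound and makes the constant positive. Compactness moves from one centre to another by the growth
  bound.\<close>

lemma transport_if_assumptions:
  fixes c :: "'a::{metric_space, second_countable_topology} \<Rightarrow> 'a \<Rightarrow> real"
  assumes cost: "cost_function c" and "growth_assumption c" and "compactness_assumption c"
  obtains A B where "transport c x0 A B"
proof -
  obtain A B where AB: "0 \<le> A" "0 \<le> B" and growth: "\<And>x y z. c x y \<le> A + B * (c x z + c y z)"
    "\<And>x y z. c x y \<le> A + B * (c x z + c z y)" "\<And>x y z. c x y \<le> A + B * (c z x + c z y)"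
    using assms(2) unfolding growth_assumption_def by blast
  have nonneg: "0 \<le> c x y" for x y using cost by (simp add: cost_function_def)
  have cont: "continuous_on UNIV (\<lambda>(x, y). c x y)" and cons: "consistent_cost c"
    using cost by (simp_all add: cost_function_def)
  have le: "A + B * (c a b + c a' b') \<le> A + (B + 1) * (c a b + c a' b')" for a b a' b'
    using nonneg by (intro add_left_mono mult_right_mono) auto
  have weight: "continuous_on UNIV (c z)" for z
  proof -
    have "continuous_on UNIV (\<lambda>y. (z, y))" by (intro continuous_on_Pair continuous_on_const continuous_on_id)
    from continuous_on_compose2[OF cont this] show ?thesis by simp
  qed
  have "transport c x0 A (B + 1)"
  proof
    show "c x y = 0 \<longleftrightarrow> x = y" for x y
    proof
      assume "c x y = 0"
      then have "(\<lambda>n::nat. c x y) \<longlonglongrightarrow> 0" by simp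
      then have "(\<lambda>n::nat. y) \<longlonglongrightarrow> x"
        using cons[unfolded consistent_cost_def, rule_format, of x "\<lambda>_. y"] by simp
      then show "x = y" by (simp add: LIMSEQ_const_iff)
    next
      assume "x = y"
      have "(\<lambda>n::nat. c x x) \<longlonglongrightarrow> 0"
        using cons[unfolded consistent_cost_def, rule_format, of x "\<lambda>_. x"] by simp
      then show "c x y = 0" using \<open>x = y\<close> by (simp add: LIMSEQ_const_iff)
    qed
    show "compact {y. c x0 y \<le> r}" for r
    proof -
      obtain x1 where x1: "\<And>r. 0 \<le> r \<Longrightarrow> compact {y. c x1 y \<le> r}"
        using assms(3) unfolding compactness_assumption_def by blast
      \<comment> \<open>The growth bound from \<open>x1\<close> to \<open>y\<close> through
        \<open>x0\<close>; the absolute value keeps \<open>R\<close> nonnegative when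
        \<open>r\<close> is negative.\<close>
      define R where "R = A + B * (c x1 x0 + \<bar>r\<bar>)"
      have "0 \<le> R" using AB nonneg by (simp add: R_def)
      have sub: "{y. c x0 y \<le> r} \<subseteq> {y. c x1 y \<le> R}"
      proof safe
        fix y assume "c x0 y \<le> r"
        then have "B * (c x1 x0 + c x0 y) \<le> B * (c x1 x0 + \<bar>r\<bar>)" using AB by (intro mult_left_mono) auto
        then show "c x1 y \<le> R" using growth(2)[of x1 y x0] by (simp add: R_def)
      qed
      have "closed {y. c x0 y \<le> r}" by (intro closed_Collect_le weight continuous_on_const)
      from compact_Int_closed[OF x1[OF \<open>0 \<le> R\<close>] this] show ?thesis unfolding Int_absorb1[OF sub] .
    qed
    show "c x y \<le> A + (B + 1) * (c z x + c z y)" "c x y \<le> A + (B + 1) * (c x z + c z y)"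
      "c x y \<le> A + (B + 1) * (c x z + c y z)" for x y z
      by (rule order.trans[OF growth(3) le] order.trans[OF growth(2) le] order.trans[OF growth(1) le])+
  qed (use AB nonneg cont in auto)
  then show ?thesis by (rule that)
qed

section \<open>Almost sure precompactness and identification of partial limits\<close>

theorem corollary5p9:
  fixes c :: "'a::{metric_space, second_countable_topology} \<Rightarrow> 'a \<Rightarrow> real"
    and x0 :: 'a
    and G :: "'a measure \<Rightarrow> ereal"
    and M :: "'w measure"
    and P :: "'a measure measure"
    and \<mu> \<nu> :: "nat \<Rightarrow> 'w \<Rightarrow> 'a measure"
  assumes "radon_space TYPE('a)"
    and "cost_function c"
    and "growth_assumption c"
    and "compactness_assumption c"
    and G_bounded_below: "\<exists>m::real. \<forall>\<nu>\<in>probs borel. ereal m \<le> G \<nu>"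
    and G_lsc: "weakly_lsc G"
    and "prob_space M"
    and P: "P \<in> probs (borel_E0 c x0)"
    and indep: "prob_space.indep_vars M (\<lambda>_. borel_E0 c x0) \<mu> {1..}"
    and distributed: "\<And>n. 1 \<le> n \<Longrightarrow> distr M (borel_E0 c x0) (\<mu> n) = P"
    and "Bar c G P \<noteq> {}"
    and measurable_choice: "\<And>n. 1 \<le> n \<Longrightarrow> \<nu> n \<in> M \<rightarrow>\<^sub>M borel_of (tau_J c)"
    and empirical_barycenter: "\<And>n \<omega>. 1 \<le> n \<Longrightarrow> \<omega> \<in> space M \<Longrightarrow>
          \<nu> n \<omega> \<in> Bar c G (empirical (borel_E0 c x0) n (\<lambda>i. \<mu> i \<omega>))"
  shows "AE \<omega> in M.
    precompactin (tau_J c) {\<nu> n \<omega> | n. 1 \<le> n} \<and>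
    (\<forall>r \<nu>'. strict_mono r \<and> limitin (tau_J c) (\<lambda>k. \<nu> (r k) \<omega>) \<nu>' sequentially \<longrightarrow>
      \<nu>' \<in> Bar c G P)"
proof -
  obtain A B where "transport c x0 A B" by (rule transport_if_assumptions[OF assms(2-4)])
  then interpret transport c x0 A B .
  interpret prob_space M by fact
  let ?E = "borel_E0 c x0"
  obtain g where G_bound: "\<And>\<nu>. \<nu> \<in> probs borel \<Longrightarrow> ereal g \<le> G \<nu>" using G_bounded_below by blast
  obtain \<nu>0 where \<nu>0: "\<nu>0 \<in> Bar c G P" using \<open>Bar c G P \<noteq> {}\<close> by blast
  have P_prob: "prob_space P" "sets P = sets ?E" using P by (simp_all add: probs_iff)
  have "\<nu>0 \<in> probs borel" using \<nu>0 by (simp add: Bar_def)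
  note \<nu>0_fin = Bar_imp_fin_moment[OF P_prob \<nu>0 G_bound[OF this]]
  obtain \<V> :: "(nat \<Rightarrow> real) set set" where \<V>: "countable \<V>" "topological_basis \<V>"
    using ex_countable_basis by blast
  have \<mu>_meas: "\<mu> i \<in> measurable M ?E" if "1 \<le> i" for i using indep that by (auto simp: indep_vars_def2)
  have upper: "AE \<omega> in M. \<forall>e>0. \<forall>\<^sub>F n in sequentially.
      (\<integral>\<^sup>+\<mu>. J \<mu> \<nu>0 \<partial>empirical ?E n (\<lambda>i. \<mu> i \<omega>)) \<le> (\<integral>\<^sup>+\<mu>. J \<mu> \<nu>0 \<partial>P) + ennreal e"
    using \<nu>0_fin by (intro empirical_mean_upper[OF \<open>prob_space M\<close> indep distributed] J_left_measurable J_finite)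
      (auto simp: space_borel_E0)
  have lower1: "AE \<omega> in M. (\<lambda>n. \<integral>\<^sup>+\<mu>. min (local_cost V \<mu>) (ennreal (real (Suc j))) \<partial>empirical ?E n (\<lambda>i. \<mu> i \<omega>))
      \<longlonglongrightarrow> (\<integral>\<^sup>+\<mu>. min (local_cost V \<mu>) (ennreal (real (Suc j))) \<partial>P)" for V j
    by (rule empirical_mean_bounded[OF \<open>prob_space M\<close> indep distributed, where K = "real (Suc j)"]) auto
  \<comment> \<open>One null set serves all members of the countable base and all truncation levels;
    the rest of the argument is pathwise.\<close>
  have lower: "AE \<omega> in M. \<forall>V\<in>\<V>. \<forall>j. (\<lambda>n. \<integral>\<^sup>+\<mu>. min (local_cost V \<mu>) (ennreal (real (Suc j))) \<partial>empirical ?E n (\<lambda>i. \<mu> i \<omega>))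
      \<longlonglongrightarrow> (\<integral>\<^sup>+\<mu>. min (local_cost V \<mu>) (ennreal (real (Suc j))) \<partial>P)"
    unfolding AE_ball_countable[OF \<V>(1)] AE_all_countable using lower1 by blast
  show ?thesis
    using upper lower AE_space
  proof eventually_elim
    case (elim \<omega>)
    define Q where "Q n = empirical ?E n (\<lambda>i. \<mu> i \<omega>)" for n
    have Q: "prob_space (Q n)" if "1 \<le> n" for n
      unfolding Q_def using measurable_space[OF \<mu>_meas elim(3)] by (intro prob_space_empirical[OF that]) auto
    have Q_sets: "sets (Q n) = sets ?E" for n by (simp add: Q_def)
    have bar: "\<nu> n \<omega> \<in> Bar c G (Q n)" if "1 \<le> n" for n
      unfolding Q_def by (rule empirical_barycenter[OF that elim(3)])
    have fin: "\<nu> n \<omega> \<in> fin_moment" if "1 \<le> n" for n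
    proof -
      have "\<nu> n \<omega> \<in> probs borel" using bar[OF that] by (simp add: Bar_def)
      then show ?thesis using Bar_imp_fin_moment(1)[OF Q[OF that] Q_sets bar[OF that] G_bound] by blast
    qed
    have sub: "\<exists>q \<nu>'. strict_mono (q :: nat \<Rightarrow> nat) \<and> \<nu>' \<in> Bar c G P \<and> \<nu>' \<in> fin_moment \<and>
        (\<lambda>k. coords (\<nu> (s (q k)) \<omega>)) \<longlonglongrightarrow> coords \<nu>'" if s: "filterlim s at_top sequentially" for s
      by (rule empirical_barycenters_subsequence[of P \<nu>0 G g \<V> Q "\<lambda>n. \<nu> n \<omega>" s])
        (use P \<nu>0 G_bound G_lsc \<V>(2) Q Q_sets elim(1,2) bar fin s in \<open>auto simp: Q_def\<close>)
    have "precompactin (tau_J c) {\<nu> n \<omega> | n. 1 \<le> n}"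
      using fin sub by (intro precompactin_tau_J_if_subsequences) blast+
    moreover have "\<nu>' \<in> Bar c G P"
      if r: "strict_mono r" and lim: "limitin (tau_J c) (\<lambda>k. \<nu> (r k) \<omega>) \<nu>' sequentially" for r \<nu>'
    proof -
      have "\<forall>\<^sub>F k in sequentially. \<nu> (r k) \<omega> \<in> fin_moment"
        using eventually_ge_at_top[of 1]
      proof eventually_elim
        case (elim k)
        then show ?case using seq_suble[OF r, of k] by (intro fin) simp
      qed
      note conv = limitin_tau_J_imp_coords_tendsto[OF this lim]
      \<comment> \<open>A further subsequence reaches a barycenter \<open>\<eta>\<close>; it has the
        coordinates of the partial limit and therefore equals it.\<close>
      obtain q \<eta> where q: "strict_mono (q :: nat \<Rightarrow> nat)" "\<eta> \<in> Bar c G P" "\<eta> \<in> fin_moment"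
        "(\<lambda>k. coords (\<nu> (r (q k)) \<omega>)) \<longlonglongrightarrow> coords \<eta>"
        using sub[OF filterlim_subseq[OF r]] by blast
      have "coords \<nu>' = coords \<eta>"
        by (rule LIMSEQ_unique[OF _ q(4)]) (use LIMSEQ_subseq_LIMSEQ[OF conv(2) q(1)] in \<open>simp add: comp_def\<close>)
      then have "\<nu>' = \<eta>" by (intro coords_inj[OF conv(1) q(3)]) simp
      then show ?thesis using q(2) by simp
    qed
    ultimately show ?case by blast
  qed
qed

end
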